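(* Let $M$ be a connected compact Riemannian manifold and let $f_\infty=(f_n)_{n\ge0}$ be an equicontinuous sequence of $C^1$-expanding maps $f_n:M\to M$ with expansion factors uniformly bounded away from one, i.e., there is $\lambda>1$ with $|Df_n(v)|\ge\lambda|v|$ for all $v\in TM$ and all $n\ge0$. Assume that the map induced by $f_n$ on the fundamental group $\pi_1(M)$ is the same for all $n$, say $(f_n)_*=\varphi\in\mathrm{End}(\pi_1(M))$ for all $n\ge0$. Then a full variational principle holds, i.e., $$\sup_{\mu_\infty}h_{\mathcal{E}_{\mathrm M}}(f_\infty;\mu_\infty)=h_{\mathrm{top}}(f_\infty),$$ where the supremum is taken over all invariant measure sequences $\mu_\infty$ for $f_\infty$.
   Context: Notation: $f_k^n:=f_{k+n-1}\circ\cdots\circ f_k$, $f_k^0=\mathrm{id}$, $f_k^{-n}:=(f_k^n)^{-1}$ on sets; $d$ is the Riemannian distance. Equicontinuous means that the family $\{f_n\}_{n\ge 0}$ is uniformly equicontinuous. Convention on induced maps: a continuous map $g:M\to M$ and a path $\beta$ from $g(x_0)$ to a base point $x_0$ induce an endomorphism $g_*$ of $\pi_1(M,x_0)$ by composing with the change-of-base-point isomorphism along $\beta$; "$g_*=\varphi$" is understood for a suitable choice of $\beta$ (the endomorphism is determined up to inner automorphisms). An invariant measure sequence (IMS) is a sequence $\mu_\infty=(\mu_n)_{n\ge0}$ of Borel probability measures on $M$ such that the push-forward of $\mu_n$ under $f_n$ is $\mu_{n+1}$ for all $n$. For a sequence $\mathcal{P}_\infty=(\mathcal{P}_n)$ of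 finite Borel partitions of $M$, $h(f_\infty;\mathcal{P}_\infty;\mu_\infty):=\limsup_{n\to\infty}\frac1n H_{\mu_0}\big(\bigvee_{i=0}^{n-1}f_0^{-i}\mathcal{P}_i\big)$, where $H_{\mu_0}$ is the Shannon entropy of a partition. The class $\mathcal{E}_{\mathrm M}$ (associated with $\mu_\infty$) consists of all sequences $\mathcal{P}_\infty$, $\mathcal{P}_n=\{P_{n,1},\dots,P_{n,k_n}\}$, with $\sup_nk_n<\infty$ such that for every $\varepsilon>0$ there are $\delta>0$ and compact sets $K_{n,i}\subset P_{n,i}$ with $\mu_n(P_{n,i}\setminus K_{n,i})\le\varepsilon$ and $\min_{1\le i<j\le k_n}\min_{(x,y)\in K_{n,i}\times K_{n,j}}d(x,y)\ge\delta$ for all $n\ge0$. $h_{\mathcal{E}_{\mathrm M}}(f_\infty;\mu_\infty):=\sup_{\mathcal{P}_\infty\in\mathcal{E}_{\mathrm M}}h(f_\infty;\mathcal{P}_\infty;\mu_\infty)$. Topological entropy: for a sequence $\mathcal{U}_\infty=(\mathcal{U}_n)_{n\ge0}$ of open covers of $M$, $h_{\mathrm{top}}(f_\infty;\mathcal{U}_\infty):=\limsup_{n\to\infty}\frac1n\log\mathcal{N}\big(\bigvee_{i=0}^{n-1}f_0^{-i}\mathcal{U}_i\big)$, with $\mathcal{N}(\cdot)$ the minimal cardinality of a subcover; $h_{\mathrm{top}}(f_\infty)$ is the supremum of these numbers over all sequences $\mathcal{U}_\infty$ of open covers whose Lebesgue numbers are bounded away from zero. *)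

theory Defs
  imports "HOL-Probability.Probability_Measure" "HOL-Algebra.Group"
begin

section \<open>Smooth manifolds\<close>

text \<open>
  The manifold is the universe of a type \<open>'a\<close>; its smooth structure is given by an atlas (not
  necessarily maximal) of charts into a finite-dimensional Euclidean space \<open>'e\<close>. The class
  \<open>euclidean_space\<close> would exclude dimension zero, hence \<open>real_inner\<close> together with a
  finite spanning set.
\<close>

text \<open>
  \<open>C\<^sup>k\<close> on an open subset of a finite-dimensional space: there, continuity of all
  directional derivatives amounts to continuity of the derivative as a map into linear maps.
\<close>

primrec Ck_on ::
  "nat \<Rightarrow> ('e::real_normed_vector \<Rightarrow> 'f::real_normed_vector) \<Rightarrow> 'e set \<Rightarrow> bool" where
  "Ck_on 0 f S \<longleftrightarrow> continuous_on S f"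
| "Ck_on (Suc k) f S \<longleftrightarrow>
     (\<forall>x\<in>S. f differentiable (at x)) \<and>
     (\<forall>w. Ck_on k (\<lambda>x. frechet_derivative f (at x) w) S)"

definition smooth_on ::
  "('e::real_normed_vector \<Rightarrow> 'f::real_normed_vector) \<Rightarrow> 'e set \<Rightarrow> bool" where
  "smooth_on f S \<longleftrightarrow> (\<forall>k. Ck_on k f S)"

text \<open>A chart is a pair of its domain and its coordinate map, the latter being irrelevant
  outside the domain.\<close>

type_synonym ('a, 'e) chart = "'a set \<times> ('a \<Rightarrow> 'e)"

definition chart_inv :: "('a, 'e) chart \<Rightarrow> 'e \<Rightarrow> 'a" where
  "chart_inv c = inv_into (fst c) (snd c)"

definition is_chart :: "('a::topological_space, 'e::real_inner) chart \<Rightarrow> bool" where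
  "is_chart c \<longleftrightarrow>
     open (fst c) \<and> open (snd c ` fst c) \<and>
     homeomorphism (fst c) (snd c ` fst c) (snd c) (chart_inv c)"

definition smooth_atlas :: "('a::topological_space, 'e::real_inner) chart set \<Rightarrow> bool" where
  "smooth_atlas A \<longleftrightarrow>
     (\<exists>B::'e set. finite B \<and> span B = UNIV) \<and>
     (\<forall>c\<in>A. is_chart c) \<and> (\<Union>c\<in>A. fst c) = UNIV \<and>
     (\<forall>c\<in>A. \<forall>c'\<in>A. smooth_on (snd c' \<circ> chart_inv c) (snd c ` (fst c \<inter> fst c')))"

definition C1_map ::
  "('a::topological_space, 'e::real_inner) chart set \<Rightarrow> ('a \<Rightarrow> 'a) \<Rightarrow> bool" where
  "C1_map A f \<longleftrightarrow>
     continuous_on UNIV f \<and>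
     (\<forall>c\<in>A. \<forall>c'\<in>A. Ck_on 1 (snd c' \<circ> f \<circ> chart_inv c) (snd c ` (fst c \<inter> f -` fst c')))"

text \<open>
  A tangent vector at \<open>x\<close> is the family of its coordinate vectors in all charts around \<open>x\<close>, which
  transform by the derivatives of the coordinate changes (with value 0 at all other charts, so
  that equality of tangent vectors is equality of functions).
\<close>

type_synonym ('a, 'e) tvec = "('a, 'e) chart \<Rightarrow> 'e"

definition tangent_space ::
  "('a, 'e::real_inner) chart set \<Rightarrow> 'a \<Rightarrow> ('a, 'e) tvec set" where
  "tangent_space A x =
     {v. (\<forall>c\<in>A. \<forall>c'\<in>A. x \<in> fst c \<longrightarrow> x \<in> fst c' \<longrightarrow>
            v c' = frechet_derivative (snd c' \<circ> chart_inv c) (at (snd c x)) (v c)) \<and>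
         (\<forall>c. \<not> (c \<in> A \<and> x \<in> fst c) \<longrightarrow> v c = 0)}"

text \<open>The tangent vector at \<open>x\<close> whose coordinate vector in the chart \<open>c\<close> is \<open>w\<close>.\<close>

definition coord_vector ::
  "('a, 'e::real_inner) chart set \<Rightarrow> ('a, 'e) chart \<Rightarrow> 'a \<Rightarrow> 'e \<Rightarrow> ('a, 'e) tvec" where
  "coord_vector A c x w =
     (\<lambda>c'. if c' \<in> A \<and> x \<in> fst c'
           then frechet_derivative (snd c' \<circ> chart_inv c) (at (snd c x)) w else 0)"

text \<open>The derivative \<open>Df : T\<^sub>xM \<rightarrow> T\<^bsub>f x\<^esub>M\<close>. By the chain rule it does not depend on the choice of
  the chart \<open>c\<close> around \<open>x\<close>.\<close>

definition tangent_map ::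
  "('a, 'e::real_inner) chart set \<Rightarrow> ('a \<Rightarrow> 'a) \<Rightarrow> 'a \<Rightarrow> ('a, 'e) tvec \<Rightarrow> ('a, 'e) tvec" where
  "tangent_map A f x v =
     (let c = (SOME c. c \<in> A \<and> x \<in> fst c) in
      (\<lambda>c'. if c' \<in> A \<and> f x \<in> fst c'
            then frechet_derivative (snd c' \<circ> f \<circ> chart_inv c) (at (snd c x)) (v c) else 0))"

section \<open>Riemannian metric and distance\<close>

text \<open>The number \<open>g x v w\<close> is meaningful for \<open>v\<close> and \<open>w\<close> in the tangent space at \<open>x\<close>.\<close>

type_synonym ('a, 'e) metric_tensor = "'a \<Rightarrow> ('a, 'e) tvec \<Rightarrow> ('a, 'e) tvec \<Rightarrow> real"

text \<open>The metric in the coordinates of the chart \<open>c\<close>: for basis vectors \<open>w\<close>, \<open>w'\<close> these are the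
  coefficients \<open>g\<^sub>i\<^sub>j\<close>.\<close>

definition metric_coeff ::
  "('a, 'e::real_inner) chart set \<Rightarrow> ('a, 'e) metric_tensor \<Rightarrow> ('a, 'e) chart \<Rightarrow> 'a \<Rightarrow>
   'e \<Rightarrow> 'e \<Rightarrow> real" where
  "metric_coeff A g c x w w' = g x (coord_vector A c x w) (coord_vector A c x w')"

definition riemannian_manifold ::
  "('a::topological_space, 'e::real_inner) chart set \<Rightarrow> ('a, 'e) metric_tensor \<Rightarrow> bool" where
  "riemannian_manifold A g \<longleftrightarrow>
     smooth_atlas A \<and>
     (\<forall>c\<in>A.
        (\<forall>x\<in>fst c.
           bilinear (metric_coeff A g c x) \<and>
           (\<forall>w w'. metric_coeff A g c x w w' = metric_coeff A g c x w' w) \<and>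
           (\<forall>w. w \<noteq> 0 \<longrightarrow> metric_coeff A g c x w w > 0)) \<and>
        (\<forall>w w'. smooth_on (\<lambda>u. metric_coeff A g c (chart_inv c u) w w') (snd c ` fst c)))"

definition tnorm :: "('a, 'e) metric_tensor \<Rightarrow> 'a \<Rightarrow> ('a, 'e) tvec \<Rightarrow> real" where
  "tnorm g x v = sqrt (g x v v)"

definition C1_curve ::
  "('a::topological_space, 'e::real_inner) chart set \<Rightarrow> real \<Rightarrow> real \<Rightarrow> (real \<Rightarrow> 'a) \<Rightarrow> bool" where
  "C1_curve A a b \<gamma> \<longleftrightarrow>
     continuous_on {a..b} \<gamma> \<and>
     (\<forall>c\<in>A. \<exists>D. continuous_on ({a..b} \<inter> \<gamma> -` fst c) D \<and>
        (\<forall>t\<in>{a..b} \<inter> \<gamma> -` fst c.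
           ((snd c \<circ> \<gamma>) has_vector_derivative D t) (at t within {a..b})))"

text \<open>Below, \<open>S\<close> is the set of points of a subdivision of the unit interval.\<close>

definition piecewise_C1_curve ::
  "('a::topological_space, 'e::real_inner) chart set \<Rightarrow> (real \<Rightarrow> 'a) \<Rightarrow> bool" where
  "piecewise_C1_curve A \<gamma> \<longleftrightarrow>
     path \<gamma> \<and>
     (\<exists>S. finite S \<and> {0, 1} \<subseteq> S \<and> S \<subseteq> {0..1} \<and>
        (\<forall>a\<in>S. \<forall>b\<in>S. a < b \<longrightarrow> {a<..<b} \<inter> S = {} \<longrightarrow> C1_curve A a b \<gamma>))"

definition velocity ::
  "('a, 'e::real_inner) chart set \<Rightarrow> (real \<Rightarrow> 'a) \<Rightarrow> real \<Rightarrow> ('a, 'e) tvec" where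
  "velocity A \<gamma> t =
     (\<lambda>c. if c \<in> A \<and> \<gamma> t \<in> fst c then vector_derivative (snd c \<circ> \<gamma>) (at t) else 0)"

text \<open>At the finitely many subdivision points the integrand may be arbitrary.\<close>

definition curve_length ::
  "('a, 'e::real_inner) chart set \<Rightarrow> ('a, 'e) metric_tensor \<Rightarrow> (real \<Rightarrow> 'a) \<Rightarrow> real" where
  "curve_length A g \<gamma> = integral {0..1} (\<lambda>t. tnorm g (\<gamma> t) (velocity A \<gamma> t))"

definition riemannian_dist ::
  "('a::topological_space, 'e::real_inner) chart set \<Rightarrow> ('a, 'e) metric_tensor \<Rightarrow>
   'a \<Rightarrow> 'a \<Rightarrow> real" where
  "riemannian_dist A g x y =
     (INF \<gamma>\<in>{\<gamma>. piecewise_C1_curve A \<gamma> \<and> pathstart \<gamma> = x \<and> pathfinish \<gamma> = y}. curve_length A g \<gamma>)"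

section \<open>Fundamental group\<close>

definition fundamental_group :: "'a::topological_space \<Rightarrow> (real \<Rightarrow> 'a) set monoid" where
  "fundamental_group x0 =
     \<lparr>carrier = {{q. homotopic_paths UNIV p q} | p. path p \<and> pathstart p = x0 \<and> pathfinish p = x0},
      mult = (\<lambda>a b. {r. \<exists>p\<in>a. \<exists>q\<in>b. homotopic_paths UNIV (p +++ q) r}),
      one = {q. homotopic_paths UNIV (\<lambda>_. x0) q}\<rparr>"

text \<open>The endomorphism of the fundamental group induced by \<open>f\<close> and a path \<open>\<beta>\<close> from \<open>f x0\<close>
  to the base point \<open>x0\<close>.\<close>

definition induced_endo ::
  "('a::topological_space \<Rightarrow> 'a) \<Rightarrow> (real \<Rightarrow> 'a) \<Rightarrow> (real \<Rightarrow> 'a) set \<Rightarrow> (real \<Rightarrow> 'a) set" where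
  "induced_endo f \<beta> a = {r. \<exists>p\<in>a. homotopic_paths UNIV (reversepath \<beta> +++ (f \<circ> p) +++ \<beta>) r}"

section \<open>Nonautonomous dynamical systems\<close>

primrec iterate :: "(nat \<Rightarrow> 'a \<Rightarrow> 'a) \<Rightarrow> nat \<Rightarrow> nat \<Rightarrow> 'a \<Rightarrow> 'a" where
  "iterate f k 0 = id"
| "iterate f k (Suc n) = f (k + n) \<circ> iterate f k n"

definition uniformly_equicontinuous ::
  "('a \<Rightarrow> 'a \<Rightarrow> real) \<Rightarrow> (nat \<Rightarrow> 'a \<Rightarrow> 'a) \<Rightarrow> bool" where
  "uniformly_equicontinuous d f \<longleftrightarrow>
     (\<forall>\<epsilon>>0. \<exists>\<delta>>0. \<forall>n x y. d x y < \<delta> \<longrightarrow> d (f n x) (f n y) < \<epsilon>)"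

text \<open>The join of the pull-backs of \<open>C 0, \<dots>, C (n - 1)\<close> to time 0.\<close>

definition pullback_join :: "(nat \<Rightarrow> 'a \<Rightarrow> 'a) \<Rightarrow> (nat \<Rightarrow> 'a set set) \<Rightarrow> nat \<Rightarrow> 'a set set" where
  "pullback_join f C n =
     {(\<Inter>i<n. iterate f 0 i -` s i) | s. \<forall>i<n. s i \<in> C i}"

subsection \<open>Metric entropy\<close>

definition invariant_measure_seq ::
  "(nat \<Rightarrow> 'a::topological_space \<Rightarrow> 'a) \<Rightarrow> (nat \<Rightarrow> 'a measure) \<Rightarrow> bool" where
  "invariant_measure_seq f \<mu> \<longleftrightarrow>
     (\<forall>n. prob_space (\<mu> n) \<and> sets (\<mu> n) = sets borel \<and> distr (\<mu> n) borel (f n) = \<mu> (Suc n))"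

definition shannon_entropy :: "'a measure \<Rightarrow> 'a set set \<Rightarrow> real" where
  "shannon_entropy m Q = - (\<Sum>P\<in>Q. measure m P * ln (measure m P))"

definition partition_entropy ::
  "(nat \<Rightarrow> 'a \<Rightarrow> 'a) \<Rightarrow> (nat \<Rightarrow> 'a set set) \<Rightarrow> (nat \<Rightarrow> 'a measure) \<Rightarrow> ereal" where
  "partition_entropy f P \<mu> =
     limsup (\<lambda>n. ereal (shannon_entropy (\<mu> 0) (pullback_join f P n) / real n))"

definition finite_borel_partition :: "'a::topological_space set set \<Rightarrow> bool" where
  "finite_borel_partition Q \<longleftrightarrow> finite Q \<and> partition_on UNIV Q \<and> Q \<subseteq> sets borel"

definition class_EM ::
  "('a::topological_space \<Rightarrow> 'a \<Rightarrow> real) \<Rightarrow> (nat \<Rightarrow> 'a measure) \<Rightarrow> (nat \<Rightarrow> 'a set set) set" where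
  "class_EM d \<mu> =
     {P. (\<forall>n. finite_borel_partition (P n)) \<and>
         (\<exists>N. \<forall>n. card (P n) \<le> N) \<and>
         (\<forall>\<epsilon>>0. \<exists>\<delta>>0. \<exists>K. \<forall>n.
            (\<forall>Q\<in>P n. compact (K n Q) \<and> K n Q \<subseteq> Q \<and> measure (\<mu> n) (Q - K n Q) \<le> \<epsilon>) \<and>
            (\<forall>Q\<in>P n. \<forall>R\<in>P n. Q \<noteq> R \<longrightarrow> (\<forall>x\<in>K n Q. \<forall>y\<in>K n R. d x y \<ge> \<delta>)))}"

definition metric_entropy_EM ::
  "('a::topological_space \<Rightarrow> 'a \<Rightarrow> real) \<Rightarrow> (nat \<Rightarrow> 'a \<Rightarrow> 'a) \<Rightarrow> (nat \<Rightarrow> 'a measure) \<Rightarrow> ereal" where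
  "metric_entropy_EM d f \<mu> = (SUP P\<in>class_EM d \<mu>. partition_entropy f P \<mu>)"

subsection \<open>Topological entropy\<close>

definition open_cover :: "'a::topological_space set set \<Rightarrow> bool" where
  "open_cover C \<longleftrightarrow> (\<forall>U\<in>C. open U) \<and> \<Union>C = UNIV"

text \<open>Every set of diameter less than \<open>\<delta>\<close> is contained in a member of the cover.\<close>

definition lebesgue_number :: "('a \<Rightarrow> 'a \<Rightarrow> real) \<Rightarrow> 'a set set \<Rightarrow> real \<Rightarrow> bool" where
  "lebesgue_number d C \<delta> \<longleftrightarrow>
     \<delta> > 0 \<and> (\<forall>S. (\<exists>r<\<delta>. \<forall>x\<in>S. \<forall>y\<in>S. d x y \<le> r) \<longrightarrow> (\<exists>U\<in>C. S \<subseteq> U))"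

text \<open>Minimal cardinality of a (finite) subcover; only used for open covers of a compact space.\<close>

definition min_subcover_card :: "'a set set \<Rightarrow> nat" where
  "min_subcover_card C = (LEAST k. \<exists>D\<subseteq>C. finite D \<and> \<Union>D = UNIV \<and> card D = k)"

definition cover_entropy :: "(nat \<Rightarrow> 'a \<Rightarrow> 'a) \<Rightarrow> (nat \<Rightarrow> 'a set set) \<Rightarrow> ereal" where
  "cover_entropy f U =
     limsup (\<lambda>n. ereal (ln (real (min_subcover_card (pullback_join f U n))) / real n))"

definition topological_entropy ::
  "('a::topological_space \<Rightarrow> 'a \<Rightarrow> real) \<Rightarrow> (nat \<Rightarrow> 'a \<Rightarrow> 'a) \<Rightarrow> ereal" where
  "topological_entropy d f =
     (SUP U\<in>{U. (\<forall>n. open_cover (U n)) \<and> (\<exists>\<delta>>0. \<forall>n. lebesgue_number d (U n) \<delta>)}. cover_entropy f U)"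

end

theory Submission
  imports Defs "HOL-Probability.Information" "HOL-Probability.Infinite_Product_Measure"
begin

text \<open>
  Every \<open>f\<^sub>n\<close> is a covering map, so that all points have the same finite number \<open>d\<^sub>n\<close> of preimages
  under \<open>f\<^sub>n\<close>. Both sides of the variational principle are equal to the upper limit of
  \<open>1/n \<Sum> ln d\<^sub>i\<close>, the sum being over \<open>i < n\<close>. This is shown in three steps.

  The topological entropy is at most this number
  (\<open>topological_entropy_le_degree_growth\<close>). Since inverse branches contract, every orbit of length
  \<open>n\<close> is shadowed by the orbit of an \<open>n\<close>-fold preimage of a point of a fixed finite net, and there
  are at most \<open>d\<^sub>0 \<cdots> d\<^bsub>n-1\<^esub>\<close> such preimages for each point of the net.

  Some invariant measure sequence has at least this entropy (\<open>degree_growth_le_metric_entropy\<close>).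
  An invariant measure sequence is determined by its measure at time 0, which may be arbitrary; so
  it suffices to find one measure that gives mass at most \<open>1/(d\<^sub>0 \<cdots> d\<^bsub>n-1\<^esub>)\<close> to each cylinder of
  length \<open>n\<close>. Consider the tree of the preimages of a base point. Fibres over different points are
  transported to each other injectively, with contracting errors
  (\<open>fibre_injection_uniform\<close>), hence a random sequence of digits, the digit \<open>n\<close> being uniform among
  \<open>d\<^sub>n\<close> values, yields a sequence of tree points that converges geometrically. The law of the limit is
  the measure sought. A sequence of partitions in the class \<open>\<E>\<^sub>M\<close> with small cells is given by balls
  whose radii are chosen, at each time, such that thin shells around their boundaries have mass that
  is small uniformly in time (\<open>small_partitions_in_class_EM\<close>).

  The metric entropy never exceeds the topological entropy
  (\<open>partition_entropy_le_topological_entropy\<close>). This holds for every continuous sequence on a compact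
  space: up to information of small entropy, the itinerary of a point is determined by an element of
  a sufficiently fine cover that contains the point.

  The uniformity in \<open>n\<close> rests on one topological fact, \<open>uniformly_locally_injective\<close>: all \<open>f\<^sub>n\<close> are
  injective on all balls of one radius. By equicontinuity, small loops have images in coordinate
  balls, where they contract, and the contraction lifts.

  The geometry enters through four properties of the Riemannian distance. It is a metric for the given
  topology (\<open>open_iff_dist\<close>); nearly shortest chains of small steps exist (\<open>dist_chain\<close>);
  small balls are uniformly contractible (\<open>local_contraction\<close>); and expanding maps have contracting
  local inverses (\<open>expanding_local_inverse\<close>). They all follow from the fact that the distance near a
  point is almost the norm that is given by the metric at this point (\<open>dist_near_point\<close>).
\<close>

section \<open>Finite-dimensional inner product spaces\<close>

lemma finite_orthonormal_basis:
  fixes B :: "'e::real_inner set"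
  assumes "finite B" "span B = UNIV"
  obtains C :: "'e set" where "finite C" "\<And>b. b \<in> C \<Longrightarrow> norm b = 1" "pairwise orthogonal C"
    "\<And>w. (\<Sum>b\<in>C. (w \<bullet> b) *\<^sub>R b) = w"
proof -
  obtain C0 where C0: "finite C0" "span C0 = span B" "pairwise orthogonal C0"
    using basis_orthogonal[OF assms(1)] by blast
  define C where "C = (\<lambda>c. c /\<^sub>R norm c) ` (C0 - {0})"
  have fin: "finite C" unfolding C_def using C0 by auto
  have nrm: "norm b = 1" if bC: "b \<in> C" for b
  proof -
    from bC obtain c where "c \<in> C0 - {0}" "b = c /\<^sub>R norm c" unfolding C_def by (rule imageE)
    then show ?thesis by simp
  qed
  have orth: "pairwise orthogonal C"
    unfolding pairwise_def
  proof (intro ballI impI)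
    fix x y assume "x \<in> C" "y \<in> C" "x \<noteq> y"
    then obtain c c' where "c \<in> C0" "c' \<in> C0" "x = c /\<^sub>R norm c" "y = c' /\<^sub>R norm c'" "c \<noteq> c'"
      unfolding C_def by (elim imageE) auto
    moreover then have "c \<bullet> c' = 0" using C0(3) unfolding pairwise_def orthogonal_def by simp
    ultimately show "orthogonal x y" by (simp add: orthogonal_def)
  qed
  have "C0 \<subseteq> span C"
  proof
    fix c assume c: "c \<in> C0"
    show "c \<in> span C"
    proof (cases "c = 0")
      case False
      then have "c = norm c *\<^sub>R (c /\<^sub>R norm c)" "c /\<^sub>R norm c \<in> C" using c unfolding C_def by auto
      then show ?thesis by (metis span_base span_scale)
    qed (simp add: span_zero)
  qed
  then have "span C = UNIV" using C0(2) assms(2) span_minimal[OF _ subspace_span] by (metis top.extremum_uniqueI)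
  then have "(\<Sum>b\<in>C. (w \<bullet> b) *\<^sub>R b) = w" for w
    using orthonormal_basis_expand[OF orth nrm _ fin] by simp
  then show ?thesis using that fin nrm orth by blast
qed

text \<open>The ball is a closed subset of the image of a cube of coordinates.\<close>

lemma compact_cball_finite_span:
  fixes B :: "'e::real_inner set"
  assumes "finite B" "span B = UNIV"
  shows "compact (cball (a::'e) r)"
proof -
  obtain C where C: "finite C" "\<And>b. b \<in> C \<Longrightarrow> norm b = (1::real)" "pairwise orthogonal C"
    "\<And>w. (\<Sum>b\<in>C. (w \<bullet> b) *\<^sub>R b) = (w::'e)"
    using finite_orthonormal_basis[OF assms] by blast
  have cpt: "compact {(\<Sum>b\<in>D. x b *\<^sub>R b) | x. \<forall>b\<in>D. x b \<in> {-R..R}}" if "finite D" for D :: "'e set" and R :: real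
    using that
  proof induction
    case empty
    then show ?case by simp
  next
    case (insert d D)
    have "compact ((\<lambda>t. t *\<^sub>R d) ` {-R..R})"
      by (intro compact_continuous_image continuous_intros) auto
    note * = compact_sums'[OF this insert.IH]
    have "{(\<Sum>b\<in>insert d D. x b *\<^sub>R b) | x. \<forall>b\<in>insert d D. x b \<in> {-R..R}} =
        (\<Union>x\<in>(\<lambda>t. t *\<^sub>R d) ` {-R..R}. \<Union>y\<in>{(\<Sum>b\<in>D. x b *\<^sub>R b) | x. \<forall>b\<in>D. x b \<in> {-R..R}}. {x + y})" (is "?L = ?R")
    proof (rule subset_antisym; rule subsetI)
      fix z assume "z \<in> ?L"
      then obtain x where "z = (\<Sum>b\<in>insert d D. x b *\<^sub>R b)" "\<forall>b\<in>insert d D. x b \<in> {-R..R}" by blast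
      then have "x d *\<^sub>R d \<in> (\<lambda>t. t *\<^sub>R d) ` {-R..R}"
        "(\<Sum>b\<in>D. x b *\<^sub>R b) \<in> {(\<Sum>b\<in>D. x b *\<^sub>R b) | x. \<forall>b\<in>D. x b \<in> {-R..R}}"
        "z = x d *\<^sub>R d + (\<Sum>b\<in>D. x b *\<^sub>R b)" using insert.hyps by auto
      then show "z \<in> ?R" by (metis (no_types, lifting) UN_I singletonI)
    next
      fix z assume "z \<in> ?R"
      then obtain t x where t: "t \<in> {-R..R}" "\<forall>b\<in>D. x b \<in> {-R..R}" "z = t *\<^sub>R d + (\<Sum>b\<in>D. x b *\<^sub>R b)" by blast
      have "(\<Sum>b\<in>insert d D. (x(d := t)) b *\<^sub>R b) = t *\<^sub>R d + (\<Sum>b\<in>D. (x(d := t)) b *\<^sub>R b)"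
        using insert.hyps by simp
      also have "(\<Sum>b\<in>D. (x(d := t)) b *\<^sub>R b) = (\<Sum>b\<in>D. x b *\<^sub>R b)"
        using insert.hyps by (intro sum.cong) auto
      finally have "z = (\<Sum>b\<in>insert d D. (x(d := t)) b *\<^sub>R b)" using t by simp
      then show "z \<in> ?L" using t by (intro CollectI exI[of _ "x(d:=t)"]) auto
    qed
    then show ?case using * by simp
  qed
  define R where "R = norm a + \<bar>r\<bar>"
  have "cball a r \<subseteq> {(\<Sum>b\<in>C. x b *\<^sub>R b) | x. \<forall>b\<in>C. x b \<in> {-R..R}}"
  proof
    fix w assume "w \<in> cball a r"
    then have "norm w \<le> R" unfolding R_def using norm_triangle_sub[of w a] by (auto simp: dist_norm norm_minus_commute)
    moreover have "\<bar>w \<bullet> b\<bar> \<le> norm w" if "b \<in> C" for b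
      using Cauchy_Schwarz_ineq2[of w b] C(2)[OF that] by simp
    ultimately have "\<forall>b\<in>C. w \<bullet> b \<in> {-R..R}" by (metis abs_le_iff atLeastAtMost_iff minus_le_iff order_trans)
    then show "w \<in> {(\<Sum>b\<in>C. x b *\<^sub>R b) | x. \<forall>b\<in>C. x b \<in> {-R..R}}"
      using C(4)[of w, symmetric] by (intro CollectI exI[of _ "\<lambda>b. w \<bullet> b"] conjI)
  qed
  then have "cball a r \<inter> {(\<Sum>b\<in>C. x b *\<^sub>R b) | x. \<forall>b\<in>C. x b \<in> {-R..R}} = cball a r"
    by (rule Int_absorb2)
  then show ?thesis using closed_Int_compact[OF closed_cball cpt[OF C(1)], of a r R] by simp
qed

lemma complete_finite_span:
  fixes B :: "'e::real_inner set"
  assumes "finite B" "span B = UNIV"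
  shows "complete (cball (a::'e) r)"
  using compact_cball_finite_span[OF assms] compact_imp_complete by blast

lemma bounded_linear_finite_span:
  fixes B :: "'e::real_inner set" and L :: "'e \<Rightarrow> 'f::real_normed_vector"
  assumes "finite B" "span B = UNIV" "linear L"
  shows "bounded_linear L"
proof -
  obtain C where C: "finite C" "\<And>b. b \<in> C \<Longrightarrow> norm b = (1::real)" "pairwise orthogonal C"
    "\<And>w. (\<Sum>b\<in>C. (w \<bullet> b) *\<^sub>R b) = (w::'e)"
    using finite_orthonormal_basis[OF assms(1,2)] by blast
  have "L w = (\<Sum>b\<in>C. (w \<bullet> b) *\<^sub>R L b)" for w
    using C(4)[of w] linear_sum[OF assms(3)] linear_scale[OF assms(3)] by (metis (no_types, lifting) sum.cong)
  then have "L = (\<lambda>w. \<Sum>b\<in>C. (w \<bullet> b) *\<^sub>R L b)" by (rule ext)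
  moreover have "bounded_linear (\<lambda>w. \<Sum>b\<in>C. (w \<bullet> b) *\<^sub>R L b)"
    by (intro bounded_linear_intros)
  ultimately show ?thesis by simp
qed

lemma bij_injective_linear_finite_span:
  fixes B :: "'e::real_inner set" and L :: "'e \<Rightarrow> 'e"
  assumes "finite B" "span B = UNIV" "linear L" "inj L"
  shows "bij L"
proof -
  obtain B' where B': "B' \<subseteq> B" "independent B'" "span B' = UNIV"
    using maximal_independent_subset[of B] assms(2)
    by (metis span_span span_superset top.extremum_uniqueI span_mono)
  interpret V: finite_dimensional_vector_space scaleR B'
    by unfold_locales (use B' assms(1) finite_subset in \<open>auto simp: dependent_raw_def span_raw_def\<close>)
  have "Vector_Spaces.linear scaleR scaleR L" using assms(3) by (simp add: linear_def)
  from V.linear_inj_imp_surj[OF this assms(4)] show ?thesis using assms(4) by (simp add: bij_def)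
qed

section \<open>Inner products given by bilinear forms\<close>

lemma posdef_Cauchy_Schwarz:
  fixes q :: "'e::real_vector \<Rightarrow> 'e \<Rightarrow> real"
  assumes "bilinear q" "\<And>v w. q v w = q w v" "\<And>w. w \<noteq> 0 \<Longrightarrow> q w w > 0"
  shows "\<bar>q v w\<bar> \<le> sqrt (q v v) * sqrt (q w w)"
proof -
  note b = assms(1)
  have nn: "q w w \<ge> 0" for w using assms(3)[of w] bilinear_lzero[OF b] by (cases "w = 0") auto
  have "(q v w)\<^sup>2 \<le> q v v * q w w"
  proof (cases "w = 0")
    case True
    then show ?thesis using bilinear_rzero[OF b] by simp
  next
    case False
    define t where "t = q v w / q w w"
    have "q (v - t *\<^sub>R w) (v - t *\<^sub>R w) = q v v - 2 * t * q v w + t\<^sup>2 * q w w"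
      using assms(2)[of w v]
      by (simp add: bilinear_lsub[OF b] bilinear_rsub[OF b] bilinear_lmul[OF b] bilinear_rmul[OF b] power2_eq_square algebra_simps)
    moreover have "t * q w w = q v w" using assms(3)[OF False] by (simp add: t_def)
    then have "t\<^sup>2 * q w w = t * q v w" by (simp add: power2_eq_square)
    ultimately have "0 \<le> q v v - t * q v w" using nn[of "v - t *\<^sub>R w"] by simp
    then show ?thesis using assms(3)[OF False] by (simp add: t_def field_simps power2_eq_square)
  qed
  then have "sqrt ((q v w)\<^sup>2) \<le> sqrt (q v v * q w w)" by (rule real_sqrt_le_mono)
  then show ?thesis by (simp add: real_sqrt_mult)
qed

lemma posdef_triangle:
  fixes q :: "'e::real_vector \<Rightarrow> 'e \<Rightarrow> real"
  assumes "bilinear q" "\<And>v w. q v w = q w v" "\<And>w. w \<noteq> 0 \<Longrightarrow> q w w > 0"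
  shows "sqrt (q (v + w) (v + w)) \<le> sqrt (q v v) + sqrt (q w w)"
proof (rule real_le_lsqrt)
  note b = assms(1)
  have nn: "q w w \<ge> 0" for w using assms(3)[of w] bilinear_lzero[OF b] by (cases "w = 0") auto
  show "0 \<le> sqrt (q v v) + sqrt (q w w)" using nn by simp
  have "q (v + w) (v + w) = q v v + 2 * q v w + q w w"
    using assms(2)[of w v] by (simp add: bilinear_ladd[OF b] bilinear_radd[OF b])
  also have "\<dots> \<le> q v v + 2 * (sqrt (q v v) * sqrt (q w w)) + q w w"
    using posdef_Cauchy_Schwarz[OF assms, of v w] by simp
  also have "\<dots> = (sqrt (q v v) + sqrt (q w w))\<^sup>2" using nn by (simp add: power2_sum)
  finally show "q (v + w) (v + w) \<le> (sqrt (q v v) + sqrt (q w w))\<^sup>2" .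
qed

text \<open>By compactness of the unit sphere.\<close>

lemma posdef_norm_equiv:
  fixes B :: "'e::real_inner set" and q :: "'e \<Rightarrow> 'e \<Rightarrow> real"
  assumes fd: "finite B" "span B = UNIV"
    and q: "bilinear q" "\<And>w. w \<noteq> 0 \<Longrightarrow> q w w > 0"
  shows "\<exists>m>0. \<exists>M>0. \<forall>w. m * norm w \<le> sqrt (q w w) \<and> sqrt (q w w) \<le> M * norm w"
proof -
  obtain C where C: "finite C" "\<And>b. b \<in> C \<Longrightarrow> norm b = (1::real)" "pairwise orthogonal C"
    "\<And>w. (\<Sum>b\<in>C. (w \<bullet> b) *\<^sub>R b) = (w::'e)"
    using finite_orthonormal_basis[OF fd] by blast
  have "q w w = (\<Sum>(b,b')\<in>C\<times>C. (w \<bullet> b) * (w \<bullet> b') * q b b')" for w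
    using bilinear_sum[OF q(1), of "\<lambda>b. (w \<bullet> b) *\<^sub>R b" C "\<lambda>b. (w \<bullet> b) *\<^sub>R b" C] C(4)[of w]
    by (simp add: bilinear_lmul[OF q(1)] bilinear_rmul[OF q(1)] mult_ac)
  then have "(\<lambda>w. q w w) = (\<lambda>w. \<Sum>(b,b')\<in>C\<times>C. (w \<bullet> b) * (w \<bullet> b') * q b b')" by (rule ext)
  moreover have "continuous_on UNIV (\<lambda>w. \<Sum>(b,b')\<in>C\<times>C. (w \<bullet> b) * (w \<bullet> b') * q b b')"
    unfolding case_prod_beta by (intro continuous_intros)
  ultimately have cont: "continuous_on S (\<lambda>w. sqrt (q w w))" for S
    by (intro continuous_intros) (metis continuous_on_subset top_greatest)
  have "closed {w::'e. norm w = 1}" by (intro closed_Collect_eq continuous_intros)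
  from closed_Int_compact[OF this compact_cball_finite_span[OF fd, of 0 1]]
  have "compact ({w::'e. norm w = 1} \<inter> cball 0 1)" .
  also have "{w::'e. norm w = 1} \<inter> cball 0 1 = sphere 0 1" unfolding sphere_def cball_def dist_norm by auto
  finally have cS: "compact (sphere (0::'e) 1)" .
  have sc: "sqrt (q w w) = norm w * sqrt (q (w /\<^sub>R norm w) (w /\<^sub>R norm w))" if "w \<noteq> 0" for w
  proof -
    have "q (t *\<^sub>R v) (t *\<^sub>R v) = t\<^sup>2 * q v v" for t v
      unfolding bilinear_lmul[OF q(1)] bilinear_rmul[OF q(1)] by (simp add: power2_eq_square)
    from this[of "norm w" "w /\<^sub>R norm w"] show ?thesis using that by (simp add: real_sqrt_mult)
  qed
  show ?thesis
  proof (cases "sphere (0::'e) 1 = {}")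
    case True
    have "w = 0" for w :: 'e
    proof (rule ccontr)
      assume "w \<noteq> 0"
      then have "w /\<^sub>R norm w \<in> sphere 0 1" by simp
      then show False using True by blast
    qed
    then have "norm w = 0" "q w w = 0" for w :: 'e using bilinear_lzero[OF q(1)] by (metis norm_zero)+
    then have "1 * norm w \<le> sqrt (q w w) \<and> sqrt (q w w) \<le> 1 * norm w" for w :: 'e by simp
    then show ?thesis using zero_less_one by metis
  next
    case False
    from continuous_attains_inf[OF cS False cont]
    obtain a where a: "a \<in> sphere 0 1" "\<forall>y\<in>sphere 0 1. sqrt (q a a) \<le> sqrt (q y y)" by (rule bexE)
    from continuous_attains_sup[OF cS False cont]
    obtain e where e: "e \<in> sphere 0 1" "\<forall>y\<in>sphere 0 1. sqrt (q y y) \<le> sqrt (q e e)" by (rule bexE)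
    have "a \<noteq> 0" "e \<noteq> 0" using a(1) e(1) by (auto simp: sphere_def)
    then have pos: "sqrt (q a a) > 0" "sqrt (q e e) > 0" using q(2) by simp_all
    have "sqrt (q a a) * norm w \<le> sqrt (q w w) \<and> sqrt (q w w) \<le> sqrt (q e e) * norm w" for w
    proof (cases "w = 0")
      case True
      then show ?thesis by (simp add: bilinear_lzero[OF q(1)])
    next
      case False
      then have "w /\<^sub>R norm w \<in> sphere 0 1" by simp
      from bspec[OF a(2) this] bspec[OF e(2) this] show ?thesis
        unfolding sc[OF False] by (simp add: mult.commute mult_left_mono)
    qed
    then show ?thesis using pos by blast
  qed
qed

locale riemannian =
  fixes A :: "('a::t2_space, 'e::real_inner) chart set" and g :: "('a, 'e) metric_tensor"
  assumes manifold: "riemannian_manifold A g"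
begin

abbreviation gc where "gc c x v w \<equiv> metric_coeff A g c x v w"

section \<open>Charts and tangent vectors\<close>

lemma finite_dimensional: "\<exists>B::'e set. finite B \<and> span B = UNIV"
  using manifold unfolding riemannian_manifold_def smooth_atlas_def by blast

lemma ex_chart: "\<exists>c\<in>A. x \<in> fst c"
  using manifold unfolding riemannian_manifold_def smooth_atlas_def by (metis UNIV_I UN_E)

lemma chart_facts:
  assumes "c \<in> A"
  shows open_chart_domain: "open (fst c)"
    and open_chart_image: "open (snd c ` fst c)"
    and chart_inv_left: "\<And>x. x \<in> fst c \<Longrightarrow> chart_inv c (snd c x) = x"
    and chart_inv_right: "\<And>u. u \<in> snd c ` fst c \<Longrightarrow> snd c (chart_inv c u) = u"
    and chart_inv_mem: "\<And>u. u \<in> snd c ` fst c \<Longrightarrow> chart_inv c u \<in> fst c"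
    and continuous_on_chart: "continuous_on (fst c) (snd c)"
    and continuous_on_chart_inv: "continuous_on (snd c ` fst c) (chart_inv c)"
proof -
  have c: "is_chart c"
    using manifold assms unfolding riemannian_manifold_def smooth_atlas_def by blast
  show "open (fst c)" "open (snd c ` fst c)" using c unfolding is_chart_def by auto
  have h: "homeomorphism (fst c) (snd c ` fst c) (snd c) (chart_inv c)"
    using c unfolding is_chart_def by blast
  show "chart_inv c (snd c x) = x" if "x \<in> fst c" for x
    using h that by (rule homeomorphism_apply1)
  show "snd c (chart_inv c u) = u" if "u \<in> snd c ` fst c" for u
    using h that by (rule homeomorphism_apply2)
  show "chart_inv c u \<in> fst c" if "u \<in> snd c ` fst c" for u
    using h that unfolding homeomorphism_def by blast
  show "continuous_on (fst c) (snd c)" "continuous_on (snd c ` fst c) (chart_inv c)"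
    using h unfolding homeomorphism_def by auto
qed

lemma transition_has_derivative:
  assumes "c \<in> A" "c' \<in> A" "x \<in> fst c" "x \<in> fst c'"
  shows "(snd c' \<circ> chart_inv c has_derivative
           frechet_derivative (snd c' \<circ> chart_inv c) (at (snd c x))) (at (snd c x))"
proof -
  have "smooth_on (snd c' \<circ> chart_inv c) (snd c ` (fst c \<inter> fst c'))"
    using manifold assms unfolding riemannian_manifold_def smooth_atlas_def by blast
  then have "Ck_on (Suc 0) (snd c' \<circ> chart_inv c) (snd c ` (fst c \<inter> fst c'))"
    unfolding smooth_on_def by blast
  then have "(snd c' \<circ> chart_inv c) differentiable (at (snd c x))" using assms by simp
  then show ?thesis by (simp add: frechet_derivative_works)
qed

lemma has_vector_derivative_change_chart:
  fixes \<gamma> :: "real \<Rightarrow> 'a"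
  assumes "c \<in> A" "c' \<in> A" "\<gamma> t \<in> fst c" "\<gamma> t \<in> fst c'" "continuous (at t within X) \<gamma>" "t \<in> X"
    and D: "(snd c \<circ> \<gamma> has_vector_derivative D) (at t within X)"
  shows "(snd c' \<circ> \<gamma> has_vector_derivative
     frechet_derivative (snd c' \<circ> chart_inv c) (at (snd c (\<gamma> t))) D) (at t within X)"
proof -
  let ?T = "snd c' \<circ> chart_inv c" and ?T' = "frechet_derivative (snd c' \<circ> chart_inv c) (at (snd c (\<gamma> t)))"
  have T: "(?T has_derivative ?T') (at (snd c (\<gamma> t)))"
    by (rule transition_has_derivative[OF assms(1-4)])
  have D': "(snd c \<circ> \<gamma> has_derivative (\<lambda>h. h *\<^sub>R D)) (at t within X)"
    using D by (simp add: has_vector_derivative_def)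
  have "((\<lambda>s. ?T ((snd c \<circ> \<gamma>) s)) has_derivative (\<lambda>h. ?T' (h *\<^sub>R D))) (at t within X)"
    using has_derivative_compose[OF D', of ?T ?T'] T by simp
  moreover have "\<forall>\<^sub>F s in at t within X. \<gamma> s \<in> fst c"
    using assms(3,5) open_chart_domain[OF assms(1)] unfolding continuous_within
    by (metis topological_tendstoD)
  then have "\<forall>\<^sub>F s in at t within X. ?T ((snd c \<circ> \<gamma>) s) = (snd c' \<circ> \<gamma>) s"
    by (rule eventually_mono) (simp add: chart_inv_left[OF assms(1)])
  moreover have "?T ((snd c \<circ> \<gamma>) t) = (snd c' \<circ> \<gamma>) t" using assms(3) by (simp add: chart_inv_left[OF assms(1)])
  ultimately have "(snd c' \<circ> \<gamma> has_derivative (\<lambda>h. ?T' (h *\<^sub>R D))) (at t within X)"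
    using assms(6) by (rule has_derivative_transform_eventually)
  moreover have "?T' (h *\<^sub>R D) = h *\<^sub>R ?T' D" for h
    using has_derivative_linear[OF T] by (rule linear_scale)
  ultimately show ?thesis by (simp add: has_vector_derivative_def)
qed

lemma coord_vector_own_chart:
  assumes "c \<in> A" "x \<in> fst c"
  shows "coord_vector A c x w c = w"
proof -
  have "((\<lambda>u. u) has_derivative (\<lambda>u. u)) (at (snd c x))" by simp
  then have "(snd c \<circ> chart_inv c has_derivative (\<lambda>u. u)) (at (snd c x))"
    by (rule has_derivative_transform_within_open[OF _ open_chart_image[OF assms(1)]])
      (use assms chart_inv_right[OF assms(1)] in auto)
  then have "frechet_derivative (snd c \<circ> chart_inv c) (at (snd c x)) = (\<lambda>u. u)"
    by (metis frechet_derivative_at)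
  then show ?thesis using assms by (simp add: coord_vector_def)
qed

lemma velocity_eq_coord_vector:
  assumes "c \<in> A" "\<gamma> t \<in> fst c" "continuous (at t) \<gamma>" "(snd c \<circ> \<gamma> has_vector_derivative D) (at t)"
  shows "velocity A \<gamma> t = coord_vector A c (\<gamma> t) D"
proof
  fix c'
  show "velocity A \<gamma> t c' = coord_vector A c (\<gamma> t) D c'"
    using has_vector_derivative_change_chart[OF assms(1) _ assms(2) _ assms(3) UNIV_I assms(4), of c']
    by (auto simp: velocity_def coord_vector_def intro: vector_derivative_at)
qed

lemma
  assumes "c \<in> A" "x \<in> fst c"
  shows bilinear_gc: "bilinear (gc c x)"
    and gc_sym: "\<And>v w. gc c x v w = gc c x w v"
    and gc_pos: "\<And>w. w \<noteq> 0 \<Longrightarrow> gc c x w w > 0"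
  using manifold assms unfolding riemannian_manifold_def by blast+

lemma gc_nonneg: "c \<in> A \<Longrightarrow> x \<in> fst c \<Longrightarrow> gc c x w w \<ge> 0"
  using gc_pos[of c x w] bilinear_lzero[OF bilinear_gc, of c x 0] by (cases "w = 0") auto

text \<open>Smoothness of the metric is a statement about constant coordinate vectors; arbitrary vectors are
  expanded in an orthonormal basis.\<close>

lemma continuous_on_gc:
  assumes "c \<in> A" "continuous_on X \<gamma>" "\<gamma> ` X \<subseteq> fst c" "continuous_on X v" "continuous_on X w"
  shows "continuous_on X (\<lambda>t. gc c (\<gamma> t) (v t) (w t))"
proof -
  obtain B :: "'e set" where B: "finite B" "span B = UNIV" using finite_dimensional by blast
  obtain C where C: "finite C" "\<And>b. b \<in> C \<Longrightarrow> norm b = (1::real)" "pairwise orthogonal C"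
    "\<And>w. (\<Sum>b\<in>C. (w \<bullet> b) *\<^sub>R b) = (w::'e)"
    using finite_orthonormal_basis[OF B] by blast
  have "gc c (\<gamma> t) (v t) (w t) = (\<Sum>(b,b')\<in>C\<times>C. (v t \<bullet> b) * (w t \<bullet> b') * gc c (\<gamma> t) b b')" if "t \<in> X" for t
  proof -
    have q: "bilinear (gc c (\<gamma> t))" using bilinear_gc assms that by blast
    show ?thesis
      using bilinear_sum[OF q, of "\<lambda>b. (v t \<bullet> b) *\<^sub>R b" C "\<lambda>b. (w t \<bullet> b) *\<^sub>R b" C] C(4)[of "v t"] C(4)[of "w t"]
      by (simp add: bilinear_lmul[OF q] bilinear_rmul[OF q] mult_ac)
  qed
  moreover have "continuous_on X (\<lambda>t. \<Sum>(b,b')\<in>C\<times>C. (v t \<bullet> b) * (w t \<bullet> b') * gc c (\<gamma> t) b b')"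
  proof -
    have "continuous_on X (\<lambda>t. gc c (\<gamma> t) b b')" for b b'
    proof -
      have "smooth_on (\<lambda>u. gc c (chart_inv c u) b b') (snd c ` fst c)"
        using manifold assms(1) unfolding riemannian_manifold_def by blast
      then have "Ck_on 0 (\<lambda>u. gc c (chart_inv c u) b b') (snd c ` fst c)" unfolding smooth_on_def by blast
      then have 1: "continuous_on (snd c ` fst c) (\<lambda>u. gc c (chart_inv c u) b b')" by simp
      have 2: "continuous_on X (\<lambda>t. snd c (\<gamma> t))"
        by (rule continuous_on_compose2[OF continuous_on_chart[OF assms(1)] assms(2,3)])
      have "continuous_on X (\<lambda>t. gc c (chart_inv c (snd c (\<gamma> t))) b b')"
        by (rule continuous_on_compose2[OF 1 2]) (use assms(3) in blast)
      then show ?thesis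
        by (rule continuous_on_eq) (use assms(3) chart_inv_left[OF assms(1)] in auto)
    qed
    then show ?thesis unfolding case_prod_beta by (intro continuous_intros assms(4,5))
  qed
  ultimately show ?thesis by (rule continuous_on_eq[rotated, OF sym])
qed

section \<open>Curves and their length\<close>

lemma C1_curve_subset:
  assumes "C1_curve A a b \<gamma>" "a \<le> a'" "b' \<le> b"
  shows "C1_curve A a' b' \<gamma>"
  unfolding C1_curve_def
proof (intro conjI ballI)
  have sub: "{a'..b'} \<subseteq> {a..b}" using assms by auto
  show "continuous_on {a'..b'} \<gamma>" using assms(1) sub unfolding C1_curve_def by (metis continuous_on_subset)
  fix c assume "c \<in> A"
  then obtain D where D: "continuous_on ({a..b} \<inter> \<gamma> -` fst c) D"
    "\<And>t. t \<in> {a..b} \<inter> \<gamma> -` fst c \<Longrightarrow> (snd c \<circ> \<gamma> has_vector_derivative D t) (at t within {a..b})"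
    using assms(1) unfolding C1_curve_def by blast
  show "\<exists>D. continuous_on ({a'..b'} \<inter> \<gamma> -` fst c) D \<and>
     (\<forall>t\<in>{a'..b'} \<inter> \<gamma> -` fst c. (snd c \<circ> \<gamma> has_vector_derivative D t) (at t within {a'..b'}))"
  proof (intro exI[of _ D] conjI ballI)
    show "continuous_on ({a'..b'} \<inter> \<gamma> -` fst c) D"
      by (rule continuous_on_subset[OF D(1)]) (use sub in blast)
    show "(snd c \<circ> \<gamma> has_vector_derivative D t) (at t within {a'..b'})"
      if "t \<in> {a'..b'} \<inter> \<gamma> -` fst c" for t
      by (rule has_vector_derivative_within_subset[OF D(2) sub]) (use sub that in blast)
  qed
qed

lemma C1_curve_cong:
  assumes "C1_curve A a b \<gamma>" "\<And>t. t \<in> {a..b} \<Longrightarrow> \<eta> t = \<gamma> t"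
  shows "C1_curve A a b \<eta>"
  unfolding C1_curve_def
proof (intro conjI ballI)
  show "continuous_on {a..b} \<eta>"
    using assms(1) unfolding C1_curve_def by (metis (no_types, lifting) assms(2) continuous_on_cong)
  fix c assume "c \<in> A"
  then obtain D where D: "continuous_on ({a..b} \<inter> \<gamma> -` fst c) D"
    "\<And>t. t \<in> {a..b} \<inter> \<gamma> -` fst c \<Longrightarrow> (snd c \<circ> \<gamma> has_vector_derivative D t) (at t within {a..b})"
    using assms(1) unfolding C1_curve_def by blast
  have eq: "{a..b} \<inter> \<eta> -` fst c = {a..b} \<inter> \<gamma> -` fst c" using assms(2) by fastforce
  show "\<exists>D. continuous_on ({a..b} \<inter> \<eta> -` fst c) D \<and>
     (\<forall>t\<in>{a..b} \<inter> \<eta> -` fst c. (snd c \<circ> \<eta> has_vector_derivative D t) (at t within {a..b}))"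
    unfolding eq
  proof (intro exI[of _ D] conjI ballI D(1))
    fix t assume t: "t \<in> {a..b} \<inter> \<gamma> -` fst c"
    show "(snd c \<circ> \<eta> has_vector_derivative D t) (at t within {a..b})"
      by (rule has_vector_derivative_transform[OF _ _ D(2)[OF t]]) (use t assms(2) in \<open>simp_all add: comp_def\<close>)
  qed
qed

lemma C1_curve_affine:
  fixes k l :: real
  assumes C: "C1_curve A a b \<gamma>" and L: "(\<lambda>t. l + k * t) ` {a'..b'} \<subseteq> {a..b}"
  shows "C1_curve A a' b' (\<lambda>t. \<gamma> (l + k * t))"
  unfolding C1_curve_def
proof (intro conjI ballI)
  have contL: "continuous_on X (\<lambda>t. l + k * t)" for X by (intro continuous_intros)
  have "continuous_on {a..b} \<gamma>" using C unfolding C1_curve_def by blast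
  then show "continuous_on {a'..b'} (\<lambda>t. \<gamma> (l + k * t))"
    by (rule continuous_on_compose2[OF _ contL L])
  fix c assume "c \<in> A"
  then obtain D where D: "continuous_on ({a..b} \<inter> \<gamma> -` fst c) D"
    "\<And>t. t \<in> {a..b} \<inter> \<gamma> -` fst c \<Longrightarrow> (snd c \<circ> \<gamma> has_vector_derivative D t) (at t within {a..b})"
    using C unfolding C1_curve_def by blast
  show "\<exists>D. continuous_on ({a'..b'} \<inter> (\<lambda>t. \<gamma> (l + k * t)) -` fst c) D \<and>
     (\<forall>t\<in>{a'..b'} \<inter> (\<lambda>t. \<gamma> (l + k * t)) -` fst c.
        (snd c \<circ> (\<lambda>t. \<gamma> (l + k * t)) has_vector_derivative D t) (at t within {a'..b'}))"
  proof (intro exI[of _ "\<lambda>t. k *\<^sub>R D (l + k * t)"] conjI ballI)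
    have "continuous_on ({a'..b'} \<inter> (\<lambda>t. \<gamma> (l + k * t)) -` fst c) (\<lambda>t. D (l + k * t))"
      by (rule continuous_on_compose2[OF D(1) contL]) (use L in \<open>auto simp: image_subset_iff\<close>)
    then show "continuous_on ({a'..b'} \<inter> (\<lambda>t. \<gamma> (l + k * t)) -` fst c) (\<lambda>t. k *\<^sub>R D (l + k * t))"
      by (intro continuous_intros)
    fix t assume t: "t \<in> {a'..b'} \<inter> (\<lambda>t. \<gamma> (l + k * t)) -` fst c"
    have "((\<lambda>t. l + k * t) has_vector_derivative k) (at t within {a'..b'})"
      unfolding has_vector_derivative_def by (auto intro!: derivative_eq_intros)
    moreover have "(snd c \<circ> \<gamma> has_vector_derivative D (l + k * t)) (at (l + k * t) within (\<lambda>t. l + k * t) ` {a'..b'})"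
      by (rule has_vector_derivative_within_subset[OF D(2) L]) (use t L in \<open>auto simp: image_subset_iff\<close>)
    ultimately have "((snd c \<circ> \<gamma>) \<circ> (\<lambda>t. l + k * t) has_vector_derivative k *\<^sub>R D (l + k * t)) (at t within {a'..b'})"
      by (rule vector_diff_chain_within)
    then show "(snd c \<circ> (\<lambda>t. \<gamma> (l + k * t)) has_vector_derivative k *\<^sub>R D (l + k * t)) (at t within {a'..b'})"
      by (simp add: comp_def)
  qed
qed

text \<open>In this form the set of exceptional points may be enlarged, which simplifies the treatment of
  images and unions of subdivisions.\<close>

lemma piecewise_C1_curve_iff:
  "piecewise_C1_curve A \<gamma> \<longleftrightarrow> path \<gamma> \<and> (\<exists>S. finite S \<and>
     (\<forall>a b. 0 \<le> a \<longrightarrow> a < b \<longrightarrow> b \<le> 1 \<longrightarrow> {a<..<b} \<inter> S = {} \<longrightarrow> C1_curve A a b \<gamma>))"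
proof
  assume "piecewise_C1_curve A \<gamma>"
  then obtain S where S: "path \<gamma>" "finite S" "0 \<in> S" "1 \<in> S"
    "\<And>a b. a \<in> S \<Longrightarrow> b \<in> S \<Longrightarrow> a < b \<Longrightarrow> {a<..<b} \<inter> S = {} \<Longrightarrow> C1_curve A a b \<gamma>"
    unfolding piecewise_C1_curve_def by (metis insert_subset)
  have "C1_curve A a b \<gamma>" if ab: "0 \<le> a" "a < b" "b \<le> 1" "{a<..<b} \<inter> S = {}" for a b
  proof -
    define a' where "a' = Max {s\<in>S. s \<le> a}"
    define b' where "b' = Min {s\<in>S. b \<le> s}"
    have f: "finite {s\<in>S. s \<le> a}" "finite {s\<in>S. b \<le> s}" "{s\<in>S. s \<le> a} \<noteq> {}" "{s\<in>S. b \<le> s} \<noteq> {}"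
      using S(2,3,4) ab(1,2,3) by auto
    have a': "a' \<in> S" "a' \<le> a" using Max_in[OF f(1,3)] unfolding a'_def by auto
    have b': "b' \<in> S" "b \<le> b'" using Min_in[OF f(2,4)] unfolding b'_def by auto
    have "{a'<..<b'} \<inter> S = {}"
    proof (rule ccontr)
      assume "{a'<..<b'} \<inter> S \<noteq> {}"
      then obtain s where s: "s \<in> S" "a' < s" "s < b'" by auto
      have "\<not> s \<le> a" using Max_ge[OF f(1), of s] s unfolding a'_def by auto
      moreover have "\<not> b \<le> s" using Min_le[OF f(2), of s] s unfolding b'_def by auto
      ultimately have "s \<in> {a<..<b}" by simp
      then show False using ab(4) s(1) by blast
    qed
    moreover have "a' < b'" using a'(2) b'(2) ab(2) by linarith
    ultimately have "C1_curve A a' b' \<gamma>" using S(5) a'(1) b'(1) by blast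
    then show ?thesis using C1_curve_subset a' b' by blast
  qed
  then show "path \<gamma> \<and> (\<exists>S. finite S \<and>
     (\<forall>a b. 0 \<le> a \<longrightarrow> a < b \<longrightarrow> b \<le> 1 \<longrightarrow> {a<..<b} \<inter> S = {} \<longrightarrow> C1_curve A a b \<gamma>))"
    using S(1,2) by blast
next
  assume "path \<gamma> \<and> (\<exists>S. finite S \<and>
     (\<forall>a b. 0 \<le> a \<longrightarrow> a < b \<longrightarrow> b \<le> 1 \<longrightarrow> {a<..<b} \<inter> S = {} \<longrightarrow> C1_curve A a b \<gamma>))"
  then obtain S where S: "path \<gamma>" "finite S"
    "\<And>a b. 0 \<le> a \<Longrightarrow> a < b \<Longrightarrow> b \<le> 1 \<Longrightarrow> {a<..<b} \<inter> S = {} \<Longrightarrow> C1_curve A a b \<gamma>" by blast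
  show "piecewise_C1_curve A \<gamma>"
    unfolding piecewise_C1_curve_def
  proof (intro conjI S(1) exI[of _ "insert 0 (insert 1 (S \<inter> {0..1}))"] ballI impI)
    fix a b assume ab: "a \<in> insert 0 (insert 1 (S \<inter> {0..1}))" "b \<in> insert 0 (insert 1 (S \<inter> {0..1}))"
      "a < b" "{a<..<b} \<inter> insert 0 (insert 1 (S \<inter> {0..1})) = {}"
    then have "0 \<le> a" "b \<le> 1" by auto
    moreover then have "{a<..<b} \<inter> S = {}" using ab(4) by fastforce
    ultimately show "C1_curve A a b \<gamma>" using S(3) ab(3) by blast
  qed (use S(2) in auto)
qed

lemma piecewise_C1_curve_differentiable:
  assumes "piecewise_C1_curve A \<gamma>"
  shows "\<exists>S. finite S \<and> (\<forall>t\<in>{0<..<1} - S. \<forall>c\<in>A. \<gamma> t \<in> fst c \<longrightarrow>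
     (\<exists>D. (snd c \<circ> \<gamma> has_vector_derivative D) (at t)))"
proof -
  obtain S where S: "finite S"
    "\<And>a b. 0 \<le> a \<Longrightarrow> a < b \<Longrightarrow> b \<le> 1 \<Longrightarrow> {a<..<b} \<inter> S = {} \<Longrightarrow> C1_curve A a b \<gamma>"
    using assms unfolding piecewise_C1_curve_iff by blast
  have "\<exists>D. (snd c \<circ> \<gamma> has_vector_derivative D) (at t)"
    if t: "t \<in> {0<..<1} - S" and c: "c \<in> A" "\<gamma> t \<in> fst c" for t c
  proof -
    have "open ({0<..<1} - S)" using S(1) by (simp add: finite_imp_closed open_Diff)
    then obtain e where e: "e > 0" "ball t e \<subseteq> {0<..<1} - S" using t by (meson openE)
    define a b where "a = t - e/2" and "b = t + e/2"
    have sub: "{a..b} \<subseteq> ball t e" unfolding a_def b_def using e(1) by (auto simp: dist_real_def abs_if)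
    then have "{a..b} \<subseteq> {0<..<1} - S" using e(2) by blast
    moreover have "a < b" "t \<in> {a<..<b}" using e(1) unfolding a_def b_def by auto
    moreover have "a \<in> {a..b}" "b \<in> {a..b}" using \<open>a < b\<close> by auto
    ultimately have "a \<in> {0<..<1}" "b \<in> {0<..<1}" by blast+
    then have "0 \<le> a" "b \<le> 1" by auto
    moreover have "{a<..<b} \<subseteq> {a..b}" by auto
    then have "{a<..<b} \<inter> S = {}" using \<open>{a..b} \<subseteq> {0<..<1} - S\<close> by blast
    ultimately have "C1_curve A a b \<gamma>" using S(2) \<open>a < b\<close> by blast
    then obtain D where "(snd c \<circ> \<gamma> has_vector_derivative D t) (at t within {a..b})"
      using c \<open>t \<in> {a<..<b}\<close> unfolding C1_curve_def by fastforce
    then show ?thesis using \<open>t \<in> {a<..<b}\<close> by (metis at_within_Icc_at greaterThanLessThan_iff)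
  qed
  then show ?thesis using S(1) by blast
qed

definition speed where "speed \<gamma> t = tnorm g (\<gamma> t) (velocity A \<gamma> t)"

lemma curve_length_eq: "curve_length A g \<gamma> = integral {0..1} (speed \<gamma>)"
  unfolding curve_length_def speed_def ..

lemma speed_eq:
  assumes "c \<in> A" "\<gamma> t \<in> fst c" "continuous (at t) \<gamma>" "(snd c \<circ> \<gamma> has_vector_derivative D) (at t)"
  shows "speed \<gamma> t = sqrt (gc c (\<gamma> t) D D)"
  using velocity_eq_coord_vector[OF assms] by (simp add: speed_def tnorm_def metric_coeff_def)

lemma continuous_at_of_path:
  fixes \<gamma> :: "real \<Rightarrow> 'a"
  assumes "path \<gamma>" "0 < t" "t < 1" shows "continuous (at t) \<gamma>"
  using assms unfolding path_def continuous_on_eq_continuous_within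
  by (metis at_within_Icc_at atLeastAtMost_iff less_le)

lemma speed_integrable_in_chart:
  assumes "C1_curve A u v \<gamma>" "c \<in> A" "\<gamma> ` {u..v} \<subseteq> fst c"
  shows "speed \<gamma> integrable_on {u..v}"
proof -
  obtain D where D: "continuous_on ({u..v} \<inter> \<gamma> -` fst c) D"
    "\<And>t. t \<in> {u..v} \<inter> \<gamma> -` fst c \<Longrightarrow> (snd c \<circ> \<gamma> has_vector_derivative D t) (at t within {u..v})"
    using assms(1,2) unfolding C1_curve_def by blast
  have cont: "continuous_on {u..v} \<gamma>" using assms(1) unfolding C1_curve_def by blast
  have eq: "{u..v} \<inter> \<gamma> -` fst c = {u..v}" using assms(3) by auto
  have "continuous_on {u..v} (\<lambda>t. sqrt (gc c (\<gamma> t) (D t) (D t)))"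
    using D(1) unfolding eq by (intro continuous_intros continuous_on_gc assms(2,3) cont)
  then have int: "(\<lambda>t. sqrt (gc c (\<gamma> t) (D t) (D t))) integrable_on {u..v}"
    by (rule integrable_continuous_interval)
  show ?thesis
  proof (rule integrable_spike_finite[OF _ _ int, of "{u,v}"])
    fix t assume "t \<in> {u..v} - {u,v}"
    then have t: "u < t" "t < v" by auto
    have "(snd c \<circ> \<gamma> has_vector_derivative D t) (at t)"
      using D(2)[of t] t unfolding eq by (simp add: at_within_Icc_at)
    moreover have "continuous (at t) \<gamma>"
      using cont t unfolding continuous_on_eq_continuous_within by (metis at_within_Icc_at atLeastAtMost_iff less_le)
    ultimately show "speed \<gamma> t = sqrt (gc c (\<gamma> t) (D t) (D t))"
      using t assms(2,3) by (intro speed_eq) auto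
  qed simp
qed

text \<open>Near each parameter and on either side of it, the speed is a continuous function, except at end
  points.\<close>

lemma speed_integrable:
  assumes "piecewise_C1_curve A \<gamma>"
  shows "speed \<gamma> integrable_on {0..1}"
proof -
  obtain S where S: "finite S"
    "\<And>a b. 0 \<le> a \<Longrightarrow> a < b \<Longrightarrow> b \<le> 1 \<Longrightarrow> {a<..<b} \<inter> S = {} \<Longrightarrow> C1_curve A a b \<gamma>"
    using assms unfolding piecewise_C1_curve_iff by blast
  have cont: "continuous_on {0..1} \<gamma>" using assms unfolding piecewise_C1_curve_iff path_def by blast
  have "\<exists>d>0. \<forall>u v. x \<in> cbox u v \<and> cbox u v \<subseteq> ball x d \<and> cbox u v \<subseteq> cbox 0 1 \<longrightarrow> speed \<gamma> integrable_on cbox u v"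
    if x: "x \<in> cbox 0 (1::real)" for x
  proof -
    obtain c where c: "c \<in> A" "\<gamma> x \<in> fst c" using ex_chart by blast
    obtain T where T: "open T" "T \<inter> {0..1} = \<gamma> -` fst c \<inter> {0..1}"
      using cont open_chart_domain[OF c(1)] unfolding continuous_on_open_invariant by blast
    have "x \<in> T \<inter> {0..1}" unfolding T(2) using c(2) x by simp
    then have "x \<in> T - (S - {x})" by simp
    moreover have "open (T - (S - {x}))" using T(1) S(1) by (simp add: finite_imp_closed open_Diff)
    ultimately obtain d where d: "d > 0" "ball x d \<subseteq> T - (S - {x})" by (meson openE)
    have "speed \<gamma> integrable_on cbox u v"
      if uv: "x \<in> cbox u v" "cbox u v \<subseteq> ball x d" "cbox u v \<subseteq> cbox 0 1" for u v
    proof -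
      have piece: "speed \<gamma> integrable_on {a..b}" if ab: "{a..b} \<subseteq> {u..v}" "a = x \<or> b = x" for a b
      proof (cases "a < b")
        case True
        have "{u..v} \<subseteq> ball x d" "{u..v} \<subseteq> {0..1}" using uv by simp_all
        then have sub: "{a..b} \<subseteq> T - (S - {x})" "{a..b} \<subseteq> {0..1}" using ab(1) d(2) by blast+
        have "{a..b} \<subseteq> T \<inter> {0..1}" using sub by blast
        then have "\<gamma> ` {a..b} \<subseteq> fst c" unfolding T(2) by blast
        moreover have "{a<..<b} \<inter> S = {}"
        proof (rule ccontr)
          assume "{a<..<b} \<inter> S \<noteq> {}"
          then obtain s where s: "s \<in> S" "a < s" "s < b" by auto
          then have "s \<in> {a..b}" by simp
          then have "s = x" using sub(1) s(1) by blast
          then show False using ab(2) s by simp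
        qed
        moreover have "0 \<le> a" "b \<le> 1" using sub(2) True by auto
        ultimately show ?thesis using S(2) True c(1) speed_integrable_in_chart by blast
      next
        case False
        then have "{a..b} = {} \<or> {a..b} = cbox a a" by (cases "a = b") auto
        then show ?thesis using integrable_on_empty integrable_on_refl by metis
      qed
      have "speed \<gamma> integrable_on {u..x}" "speed \<gamma> integrable_on {x..v}"
        using uv(1) by (auto intro!: piece)
      moreover have "u \<le> x" "x \<le> v" using uv(1) by auto
      ultimately show ?thesis using Henstock_Kurzweil_Integration.integrable_combine[of u x v] by simp
    qed
    then show ?thesis using d(1) by blast
  qed
  then have "speed \<gamma> integrable_on cbox 0 1" by (intro integrable_on_little_subintervals) blast
  then show ?thesis by simp
qed

lemma speed_nonneg_off_finite:
  assumes "piecewise_C1_curve A \<gamma>"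
  shows "\<exists>S. finite S \<and> (\<forall>t\<in>{0..1} - S. speed \<gamma> t \<ge> 0)"
proof -
  obtain S where S: "finite S" "\<And>t c. t \<in> {0<..<1} - S \<Longrightarrow> c \<in> A \<Longrightarrow> \<gamma> t \<in> fst c \<Longrightarrow>
     \<exists>D. (snd c \<circ> \<gamma> has_vector_derivative D) (at t)"
    using piecewise_C1_curve_differentiable[OF assms] by blast
  have "speed \<gamma> t \<ge> 0" if t: "t \<in> {0..1} - (insert 0 (insert 1 S))" for t
  proof -
    obtain c where c: "c \<in> A" "\<gamma> t \<in> fst c" using ex_chart by blast
    have t': "t \<in> {0<..<1} - S" using t by auto
    obtain D where D: "(snd c \<circ> \<gamma> has_vector_derivative D) (at t)" using S(2)[OF t' c] by blast
    have "continuous (at t) \<gamma>" using assms t' unfolding piecewise_C1_curve_iff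
      by (auto intro: continuous_at_of_path)
    then show ?thesis using speed_eq[OF c _ D] gc_nonneg[OF c] by simp
  qed
  then show ?thesis using S(1) by (intro exI[of _ "insert 0 (insert 1 S)"]) auto
qed

end

lemma integral_le_off_finite:
  fixes f h :: "real \<Rightarrow> real"
  assumes "f integrable_on {a..b}" "h integrable_on {a..b}" "finite S"
    "\<And>t. t \<in> {a..b} - S \<Longrightarrow> f t \<le> h t"
  shows "integral {a..b} f \<le> integral {a..b} h"
proof -
  let ?f = "\<lambda>t. if t \<in> S then h t else f t"
  have "integral {a..b} f = integral {a..b} ?f"
    by (rule integral_spike[OF negligible_finite[OF assms(3)]]) simp
  moreover have "?f integrable_on {a..b}"
    by (rule integrable_spike_finite[OF assms(3) _ assms(1)]) simp
  then have "integral {a..b} ?f \<le> integral {a..b} h"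
    by (rule integral_le[OF _ assms(2)]) (use assms(4) in auto)
  ultimately show ?thesis by simp
qed

context riemannian
begin

lemma speed_integrable_subinterval:
  assumes "piecewise_C1_curve A \<gamma>" "0 \<le> a" "b \<le> 1"
  shows "speed \<gamma> integrable_on {a..b}"
  by (rule integrable_on_subinterval[OF speed_integrable[OF assms(1)]]) (use assms in auto)

lemma integral_speed_nonneg:
  assumes "piecewise_C1_curve A \<gamma>" "0 \<le> a" "b \<le> 1"
  shows "0 \<le> integral {a..b} (speed \<gamma>)"
proof -
  obtain S where S: "finite S" "\<forall>t\<in>{0..1} - S. speed \<gamma> t \<ge> 0"
    using speed_nonneg_off_finite[OF assms(1)] by blast
  have "integral {a..b} (\<lambda>t. 0) \<le> integral {a..b} (speed \<gamma>)"
    by (rule integral_le_off_finite[OF _ speed_integrable_subinterval[OF assms] S(1)])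
      (use S(2) assms in auto)
  then show ?thesis by simp
qed

lemma integral_speed_mono:
  assumes "piecewise_C1_curve A \<gamma>" "0 \<le> t" "t \<le> 1"
  shows "integral {0..t} (speed \<gamma>) \<le> curve_length A g \<gamma>"
  using Henstock_Kurzweil_Integration.integral_combine[OF assms(2,3) speed_integrable[OF assms(1)]] integral_speed_nonneg[OF assms(1,2), of 1]
  by (simp add: curve_length_eq)

text \<open>Integrate the component of the velocity in the direction of the displacement.\<close>

lemma integral_speed_ge_displacement:
  assumes "piecewise_C1_curve A \<gamma>" "0 \<le> t" "t \<le> 1" "c \<in> A" "\<gamma> ` {0..t} \<subseteq> fst c"
    and q: "bilinear q" "\<And>v w. q v w = q w v" "\<And>w. w \<noteq> 0 \<Longrightarrow> q w w > 0"
    and \<kappa>: "0 \<le> \<kappa>" "\<And>s w. s \<in> {0..t} \<Longrightarrow> \<kappa> * sqrt (q w w) \<le> sqrt (gc c (\<gamma> s) w w)"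
  defines "\<Delta> \<equiv> snd c (\<gamma> t) - snd c (\<gamma> 0)"
  shows "\<kappa> * sqrt (q \<Delta> \<Delta>) \<le> integral {0..t} (speed \<gamma>)"
proof (cases "\<Delta> = 0")
  case True
  then show ?thesis using integral_speed_nonneg[OF assms(1) order_refl assms(3)] bilinear_lzero[OF q(1)] by simp
next
  case False
  obtain B :: "'e set" where B: "finite B" "span B = UNIV" using finite_dimensional by blast
  have "linear (\<lambda>w. q w \<Delta>)" using q(1) unfolding bilinear_def by blast
  then have bl: "bounded_linear (\<lambda>w. q w \<Delta>)" by (rule bounded_linear_finite_span[OF B])
  obtain S where S: "finite S" "\<And>s c. s \<in> {0<..<1} - S \<Longrightarrow> c \<in> A \<Longrightarrow> \<gamma> s \<in> fst c \<Longrightarrow>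
     \<exists>D. (snd c \<circ> \<gamma> has_vector_derivative D) (at s)"
    using piecewise_C1_curve_differentiable[OF assms(1)] by blast
  define D where "D s = vector_derivative (snd c \<circ> \<gamma>) (at s)" for s
  have D: "(snd c \<circ> \<gamma> has_vector_derivative D s) (at s)" if "s \<in> {0<..<t} - S" for s
    using S(2)[of s c] that assms(3,4,5) vector_derivative_works[of "snd c \<circ> \<gamma>" "at s"]
    unfolding D_def by (auto simp: image_subset_iff intro: differentiableI_vector)
  have path: "path \<gamma>" using assms(1) unfolding piecewise_C1_curve_iff by blast
  have cont: "continuous_on {0..t} (\<lambda>s. q (snd c (\<gamma> s)) \<Delta>)"
  proof -
    have "continuous_on {0..t} \<gamma>"
      by (rule continuous_on_subset[of "{0..1}"]) (use path assms(3) in \<open>auto simp: path_def\<close>)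
    from continuous_on_compose2[OF continuous_on_chart[OF assms(4)] this assms(5)]
    show ?thesis by (rule bounded_linear.continuous_on[OF bl])
  qed
  have "((\<lambda>s. q (D s) \<Delta>) has_integral q (snd c (\<gamma> t)) \<Delta> - q (snd c (\<gamma> 0)) \<Delta>) {0..t}"
  proof (rule fundamental_theorem_of_calculus_interior_strong[OF S(1) assms(2) _ cont])
    fix s assume s: "s \<in> {0<..<t} - S"
    show "((\<lambda>s. q (snd c (\<gamma> s)) \<Delta>) has_vector_derivative q (D s) \<Delta>) (at s)"
      using bounded_linear.has_vector_derivative[OF bl D[OF s]] by (simp add: comp_def)
  qed
  then have int: "((\<lambda>s. \<kappa> * q (D s) \<Delta>) has_integral \<kappa> * q \<Delta> \<Delta>) {0..t}"
    unfolding \<Delta>_def bilinear_lsub[OF q(1)] by (rule has_integral_mult_right)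
  have "\<kappa> * q \<Delta> \<Delta> = integral {0..t} (\<lambda>s. \<kappa> * q (D s) \<Delta>)" using integral_unique[OF int] by (rule sym)
  also have "\<dots> \<le> integral {0..t} (\<lambda>s. sqrt (q \<Delta> \<Delta>) * speed \<gamma> s)"
  proof (rule integral_le_off_finite)
    show "(\<lambda>s. \<kappa> * q (D s) \<Delta>) integrable_on {0..t}" using int by blast
    show "(\<lambda>s. sqrt (q \<Delta> \<Delta>) * speed \<gamma> s) integrable_on {0..t}"
      using integrable_on_cmult_left[OF speed_integrable_subinterval[OF assms(1) order_refl assms(3)]] by simp
    show "finite (insert 0 (insert t S))" using S(1) by simp
    fix s assume s: "s \<in> {0..t} - insert 0 (insert t S)"
    have mem: "\<gamma> s \<in> fst c" "s \<in> {0<..<t} - S" using s assms(5) by auto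
    have "continuous (at s) \<gamma>" using continuous_at_of_path[OF path] s assms(3) by simp
    then have sp: "speed \<gamma> s = sqrt (gc c (\<gamma> s) (D s) (D s))"
      using speed_eq[OF assms(4) mem(1) _ D[OF mem(2)]] by simp
    have "\<kappa> * q (D s) \<Delta> \<le> \<kappa> * (sqrt (q (D s) (D s)) * sqrt (q \<Delta> \<Delta>))"
      using posdef_Cauchy_Schwarz[OF q, of "D s" \<Delta>] \<kappa>(1) by (intro mult_left_mono) auto
    also have "\<dots> = (\<kappa> * sqrt (q (D s) (D s))) * sqrt (q \<Delta> \<Delta>)" by simp
    also have "\<dots> \<le> speed \<gamma> s * sqrt (q \<Delta> \<Delta>)"
      unfolding sp using \<kappa>(2)[of s "D s"] s q(3)[OF False] by (intro mult_right_mono) auto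
    finally show "\<kappa> * q (D s) \<Delta> \<le> sqrt (q \<Delta> \<Delta>) * speed \<gamma> s" by (simp add: mult.commute)
  qed
  also have "\<dots> = sqrt (q \<Delta> \<Delta>) * integral {0..t} (speed \<gamma>)" by simp
  finally have "sqrt (q \<Delta> \<Delta>) * (\<kappa> * sqrt (q \<Delta> \<Delta>)) \<le> sqrt (q \<Delta> \<Delta>) * integral {0..t} (speed \<gamma>)"
    using q(3)[OF False] by (simp add: mult.left_commute)
  then show ?thesis using q(3)[OF False] by simp
qed

text \<open>This covers both the passage to a subarc and the reversal of a curve.\<close>

lemma affine_reparametrization:
  fixes k l :: real
  assumes pw: "piecewise_C1_curve A \<gamma>" and k: "k \<noteq> 0" and L: "(\<lambda>t. l + k * t) ` {0..1} \<subseteq> {0..1}"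
  shows "piecewise_C1_curve A (\<lambda>t. \<gamma> (l + k * t))"
    and "curve_length A g (\<lambda>t. \<gamma> (l + k * t)) = integral ((\<lambda>t. l + k * t) ` {0..1}) (speed \<gamma>)"
proof -
  let ?L = "\<lambda>t. l + k * t" and ?\<eta> = "\<lambda>t. \<gamma> (l + k * t)"
  obtain S where S: "path \<gamma>" "finite S"
    "\<And>a b. 0 \<le> a \<Longrightarrow> a < b \<Longrightarrow> b \<le> 1 \<Longrightarrow> {a<..<b} \<inter> S = {} \<Longrightarrow> C1_curve A a b \<gamma>"
    using pw unfolding piecewise_C1_curve_iff by blast
  have contL: "continuous_on {0..1} ?L" by (intro continuous_intros)
  have path: "path ?\<eta>"
    using continuous_on_compose2[OF _ contL L] S(1) unfolding path_def by blast
  have finL: "finite (?L -` X)" if "finite X" for X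
    using that k by (intro finite_vimageI) (auto intro: injI)
  show pw': "piecewise_C1_curve A ?\<eta>"
    unfolding piecewise_C1_curve_iff
  proof (intro conjI path exI[of _ "?L -` S"] finL S(2) allI impI)
    fix a b :: real assume ab: "0 \<le> a" "a < b" "b \<le> 1" "{a<..<b} \<inter> ?L -` S = {}"
    define p q where "p = min (?L a) (?L b)" and "q = max (?L a) (?L b)"
    have "?L a \<in> {0..1}" "?L b \<in> {0..1}" using L ab by (auto simp: image_subset_iff)
    then have "0 \<le> p" "q \<le> 1" unfolding p_def q_def by auto
    moreover have "?L a \<noteq> ?L b" using k ab(2) by simp
    then have "p < q" unfolding p_def q_def by linarith
    moreover have "{p<..<q} \<inter> S = {}"
    proof (rule ccontr)
      assume "{p<..<q} \<inter> S \<noteq> {}"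
      then obtain s where s: "s \<in> S" "p < s" "s < q" by auto
      define t where "t = (s - l) / k"
      have st: "s = ?L t" unfolding t_def using k by simp
      have "a < t \<and> t < b"
      proof (cases "k > 0")
        case True
        then have "p = ?L a" "q = ?L b" unfolding p_def q_def using ab(2) by auto
        then show ?thesis using s st True by simp
      next
        case False
        then have "p = ?L b" "q = ?L a" unfolding p_def q_def using ab(2) k by (auto simp: min_def max_def)
        then show ?thesis using s st False k by (auto simp: mult_less_cancel_left)
      qed
      then have "t \<in> {a<..<b}" "t \<in> ?L -` S" using s(1) st by auto
      then show False using ab(4) by blast
    qed
    ultimately have "C1_curve A p q \<gamma>" using S(3) by blast
    moreover have "?L ` {a..b} \<subseteq> {p..q}"
    proof (cases "k > 0")
      case True
      then have "p = ?L a" "q = ?L b" unfolding p_def q_def using ab(2) by auto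
      then show ?thesis using True by auto
    next
      case False
      then have "p = ?L b" "q = ?L a" unfolding p_def q_def using ab(2) k by (auto simp: min_def max_def)
      then show ?thesis using False k by (auto simp: mult_le_cancel_left)
    qed
    ultimately show "C1_curve A a b ?\<eta>" by (rule C1_curve_affine)
  qed
  obtain S' where S': "finite S'" "\<And>s c. s \<in> {0<..<1} - S' \<Longrightarrow> c \<in> A \<Longrightarrow> \<gamma> s \<in> fst c \<Longrightarrow>
     \<exists>D. (snd c \<circ> \<gamma> has_vector_derivative D) (at s)"
    using piecewise_C1_curve_differentiable[OF pw] by blast
  have speed: "speed ?\<eta> t = \<bar>k\<bar> * speed \<gamma> (?L t)" if t: "t \<in> {0..1} - ({0,1} \<union> ?L -` (S' \<union> {0,1}))" for t
  proof -
    have Lt: "?L t \<in> {0<..<1} - S'"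
    proof -
      have "?L t \<in> {0..1}" using L t unfolding image_subset_iff by blast
      then show ?thesis using t by auto
    qed
    obtain c where c: "c \<in> A" "\<gamma> (?L t) \<in> fst c" using ex_chart by blast
    obtain D where D: "(snd c \<circ> \<gamma> has_vector_derivative D) (at (?L t))" using S'(2)[OF Lt c] by blast
    have "(?L has_vector_derivative k) (at t)"
      unfolding has_vector_derivative_def by (auto intro!: derivative_eq_intros)
    from vector_diff_chain_at[OF this D]
    have D': "(snd c \<circ> ?\<eta> has_vector_derivative k *\<^sub>R D) (at t)" by (simp add: comp_def)
    have "speed \<gamma> (?L t) = sqrt (gc c (\<gamma> (?L t)) D D)"
      by (rule speed_eq[OF c _ D]) (rule continuous_at_of_path[OF S(1)], use Lt in auto)
    moreover have "speed ?\<eta> t = sqrt (gc c (\<gamma> (?L t)) (k *\<^sub>R D) (k *\<^sub>R D))"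
      by (rule speed_eq[OF c(1) _ _ D']) (use c(2) continuous_at_of_path[OF path] t in auto)
    moreover have "gc c (\<gamma> (?L t)) (k *\<^sub>R D) (k *\<^sub>R D) = k\<^sup>2 * gc c (\<gamma> (?L t)) D D"
      unfolding bilinear_lmul[OF bilinear_gc[OF c]] bilinear_rmul[OF bilinear_gc[OF c]] by (simp add: power2_eq_square)
    ultimately show ?thesis by (simp add: real_sqrt_mult)
  qed
  define p q where "p = min l (l + k)" and "q = max l (l + k)"
  have img: "?L ` {0..1} = cbox p q"
  proof (cases "k > 0")
    case True
    have "?L ` {0..1} = {l..l+k}"
    proof (intro equalityI subsetI)
      fix s assume "s \<in> {l..l+k}"
      then have "(s - l) / k \<in> {0..1}" "s = ?L ((s - l) / k)" using True by (auto simp: field_simps)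
      then show "s \<in> ?L ` {0..1}" by blast
    qed (use True in \<open>auto simp: mult_le_cancel_left1\<close>)
    then show ?thesis unfolding p_def q_def using True by simp
  next
    case False
    have "?L ` {0..1} = {l+k..l}"
    proof (intro equalityI subsetI)
      fix s assume "s \<in> {l+k..l}"
      then have "(s - l) / k \<in> {0..1}" "s = ?L ((s - l) / k)" using False k by (auto simp: field_simps)
      then show "s \<in> ?L ` {0..1}" by blast
    qed (use False k in \<open>auto simp: mult_le_0_iff mult_le_cancel_left1\<close>)
    then show ?thesis unfolding p_def q_def using False k by (simp add: min_def max_def)
  qed
  have "speed \<gamma> integrable_on cbox p q"
    using integrable_on_subinterval[OF speed_integrable[OF pw]] L unfolding img by simp
  then have "(speed \<gamma> has_integral integral (cbox p q) (speed \<gamma>)) (cbox p q)" by (rule integrable_integral)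
  from has_integral_affinity[OF this k, of l]
  have 1: "((\<lambda>x. speed \<gamma> (k * x + l)) has_integral (1 / \<bar>k\<bar>) * integral (cbox p q) (speed \<gamma>))
      ((\<lambda>x. (1 / k) * x + - ((1 / k) * l)) ` cbox p q)" by simp
  have "(\<lambda>x. (1 / k) * x + - ((1 / k) * l)) ` cbox p q = {0..1}"
    unfolding img[symmetric] image_image using k by (simp add: field_simps)
  with 1 have "((\<lambda>x. \<bar>k\<bar> * speed \<gamma> (k * x + l)) has_integral \<bar>k\<bar> * ((1 / \<bar>k\<bar>) * integral (cbox p q) (speed \<gamma>))) {0..1}"
    by (intro has_integral_mult_right) simp
  then have "((\<lambda>t. \<bar>k\<bar> * speed \<gamma> (?L t)) has_integral integral (cbox p q) (speed \<gamma>)) {0..1}"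
    using k by (simp add: add.commute)
  then have "integral {0..1} (\<lambda>t. \<bar>k\<bar> * speed \<gamma> (?L t)) = integral (cbox p q) (speed \<gamma>)"
    by (rule integral_unique)
  moreover have "integral {0..1} (speed ?\<eta>) = integral {0..1} (\<lambda>t. \<bar>k\<bar> * speed \<gamma> (?L t))"
    by (rule integral_spike[of "{0,1} \<union> ?L -` (S' \<union> {0,1})"])
      (use finL S'(1) speed in \<open>auto intro!: negligible_finite\<close>)
  ultimately show "curve_length A g ?\<eta> = integral (?L ` {0..1}) (speed \<gamma>)"
    unfolding curve_length_eq img by simp
qed

text \<open>Two-sided derivatives inside the unit interval see the curve on the unit interval only.\<close>

lemma curve_length_cong:
  assumes "\<And>t. t \<in> {0..1} \<Longrightarrow> \<eta> t = \<gamma> t"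
  shows "curve_length A g \<eta> = curve_length A g \<gamma>"
  unfolding curve_length_eq
proof (rule integral_spike[of "{0,1}"])
  fix t :: real assume "t \<in> {0..1} - {0,1}"
  then have t: "t \<in> {0<..<1}" by auto
  have "\<forall>\<^sub>F s in nhds t. s \<in> {0<..<1}" using t by (intro eventually_nhds_in_open) auto
  then have ev: "\<forall>\<^sub>F s in nhds t. \<eta> s = \<gamma> s" by (rule eventually_mono) (use assms in auto)
  have "vector_derivative (snd c \<circ> \<eta>) (at t) = vector_derivative (snd c \<circ> \<gamma>) (at t)" for c :: "('a, 'e) chart"
    by (rule vector_derivative_cong_eq) (use ev in \<open>auto elim: eventually_mono\<close>)
  then show "speed \<gamma> t = speed \<eta> t"
    using assms[of t] t unfolding speed_def velocity_def by (simp cong: if_cong)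
qed simp

lemma piecewise_C1_join:
  assumes p: "piecewise_C1_curve A \<gamma>" and q: "piecewise_C1_curve A \<eta>" and eq: "pathfinish \<gamma> = pathstart \<eta>"
  shows "piecewise_C1_curve A (\<gamma> +++ \<eta>)"
    and "curve_length A g (\<gamma> +++ \<eta>) = curve_length A g \<gamma> + curve_length A g \<eta>"
proof -
  obtain S where S: "path \<gamma>" "finite S"
    "\<And>a b. 0 \<le> a \<Longrightarrow> a < b \<Longrightarrow> b \<le> 1 \<Longrightarrow> {a<..<b} \<inter> S = {} \<Longrightarrow> C1_curve A a b \<gamma>"
    using p unfolding piecewise_C1_curve_iff by blast
  obtain T where T: "path \<eta>" "finite T"
    "\<And>a b. 0 \<le> a \<Longrightarrow> a < b \<Longrightarrow> b \<le> 1 \<Longrightarrow> {a<..<b} \<inter> T = {} \<Longrightarrow> C1_curve A a b \<eta>"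
    using q unfolding piecewise_C1_curve_iff by blast
  have left: "(\<gamma> +++ \<eta>) t = \<gamma> (0 + 2 * t)" if "t \<le> 1/2" for t
    using that by (simp add: joinpaths_def)
  have right: "(\<gamma> +++ \<eta>) t = \<eta> (-1 + 2 * t)" if "t \<ge> 1/2" for t
  proof (cases "t = 1/2")
    case True
    then have "t = 1/2" by simp
    then show ?thesis using eq unfolding \<open>t = 1/2\<close> joinpaths_def pathfinish_def pathstart_def by simp
  qed (use that in \<open>simp add: joinpaths_def\<close>)
  show pw: "piecewise_C1_curve A (\<gamma> +++ \<eta>)"
    unfolding piecewise_C1_curve_iff
  proof (intro conjI exI[of _ "insert (1/2) ((\<lambda>s. s/2) ` S \<union> (\<lambda>s. (s+1)/2) ` T)"] allI impI)
    show "path (\<gamma> +++ \<eta>)" using S(1) T(1) eq by simp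
    show "finite (insert (1/2) ((\<lambda>s. s/2) ` S \<union> (\<lambda>s. (s+1)/2) ` T))" using S(2) T(2) by simp
    fix a b :: real
    assume ab: "0 \<le> a" "a < b" "b \<le> 1" and free: "{a<..<b} \<inter> insert (1/2) ((\<lambda>s. s/2) ` S \<union> (\<lambda>s. (s+1)/2) ` T) = {}"
    have "b \<le> 1/2 \<or> 1/2 \<le> a" using free by (cases "1/2 \<in> {a<..<b}") auto
    then show "C1_curve A a b (\<gamma> +++ \<eta>)"
    proof
      assume b: "b \<le> 1/2"
      have "{2*a<..<2*b} \<inter> S = {}"
      proof (rule ccontr)
        assume "{2*a<..<2*b} \<inter> S \<noteq> {}"
        then obtain s where s: "s \<in> S" "2*a < s" "s < 2*b" by auto
        then have "s/2 \<in> {a<..<b}" "s/2 \<in> (\<lambda>s. s/2) ` S" by auto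
        then show False using free by blast
      qed
      then have C: "C1_curve A (2*a) (2*b) \<gamma>" using S(3) ab b by simp
      show ?thesis
        by (rule C1_curve_cong[OF C1_curve_affine[OF C, of 0 2 a b]]) (use b left in auto)
    next
      assume a: "1/2 \<le> a"
      have "{-1+2*a<..<-1+2*b} \<inter> T = {}"
      proof (rule ccontr)
        assume "{-1+2*a<..<-1+2*b} \<inter> T \<noteq> {}"
        then obtain s where s: "s \<in> T" "-1+2*a < s" "s < -1+2*b" by auto
        then have "(s+1)/2 \<in> {a<..<b}" "(s+1)/2 \<in> (\<lambda>s. (s+1)/2) ` T" by auto
        then show False using free by blast
      qed
      then have C: "C1_curve A (-1+2*a) (-1+2*b) \<eta>" using T(3) ab a by simp
      show ?thesis
        by (rule C1_curve_cong[OF C1_curve_affine[OF C, of "-1" 2 a b]]) (use a right in auto)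
    qed
  qed
  have img: "(\<lambda>t. 0 + (1/2) * t) ` {0..1} = {0..1/2::real}" "(\<lambda>t. 1/2 + (1/2) * t) ` {0..1} = {1/2..1::real}"
    using image_affinity_atLeastAtMost[of "1/2" "0::real" 0 1] image_affinity_atLeastAtMost[of "1/2" "1/2::real" 0 1]
    by (simp_all add: add.commute)
  have "curve_length A g \<gamma> = curve_length A g (\<lambda>t. (\<gamma> +++ \<eta>) (0 + (1/2) * t))"
    by (rule curve_length_cong) (use left in auto)
  also have "\<dots> = integral {0..1/2} (speed (\<gamma> +++ \<eta>))"
    using affine_reparametrization(2)[OF pw, of "1/2" 0] unfolding img by simp
  finally have 1: "curve_length A g \<gamma> = integral {0..1/2} (speed (\<gamma> +++ \<eta>))" .
  have "curve_length A g \<eta> = curve_length A g (\<lambda>t. (\<gamma> +++ \<eta>) (1/2 + (1/2) * t))"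
    by (rule curve_length_cong) (use right in auto)
  also have "\<dots> = integral {1/2..1} (speed (\<gamma> +++ \<eta>))"
    using affine_reparametrization(2)[OF pw, of "1/2" "1/2"] unfolding img by simp
  finally have 2: "curve_length A g \<eta> = integral {1/2..1} (speed (\<gamma> +++ \<eta>))" .
  have "integral {0..1/2} (speed (\<gamma> +++ \<eta>)) + integral {1/2..1} (speed (\<gamma> +++ \<eta>)) = integral {0..1} (speed (\<gamma> +++ \<eta>))"
    by (rule Henstock_Kurzweil_Integration.integral_combine[OF _ _ speed_integrable[OF pw]]) auto
  then show "curve_length A g (\<gamma> +++ \<eta>) = curve_length A g \<gamma> + curve_length A g \<eta>"
    unfolding 1 2 unfolding curve_length_eq by simp
qed

lemma coordinate_segment:
  assumes c: "c \<in> A" and seg: "\<And>t. t \<in> {0..1} \<Longrightarrow> u + t *\<^sub>R (v - u) \<in> snd c ` fst c"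
  defines "\<gamma> \<equiv> \<lambda>t. chart_inv c (u + t *\<^sub>R (v - u))"
  shows "piecewise_C1_curve A \<gamma>"
    and "t \<in> {0<..<1} \<Longrightarrow> speed \<gamma> t = sqrt (gc c (\<gamma> t) (v - u) (v - u))"
proof -
  have cl: "continuous_on X (\<lambda>t. u + t *\<^sub>R (v - u))" for X :: "real set" by (intro continuous_intros)
  have cont: "continuous_on {0..1} \<gamma>"
    unfolding \<gamma>_def by (rule continuous_on_compose2[OF continuous_on_chart_inv[OF c] cl]) (use seg in auto)
  have mem: "\<gamma> t \<in> fst c" "snd c (\<gamma> t) = u + t *\<^sub>R (v - u)" if "t \<in> {0..1}" for t
    unfolding \<gamma>_def using chart_inv_mem[OF c seg[OF that]] chart_inv_right[OF c seg[OF that]] by auto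
  have D: "(snd c \<circ> \<gamma> has_vector_derivative v - u) (at t within X)" if "t \<in> X" "X \<subseteq> {0..1}" for t X
  proof (rule has_vector_derivative_transform[OF that(1)])
    show "(snd c \<circ> \<gamma>) s = u + s *\<^sub>R (v - u)" if "s \<in> X" for s
      using mem that \<open>X \<subseteq> {0..1}\<close> by auto
    show "((\<lambda>s. u + s *\<^sub>R (v - u)) has_vector_derivative v - u) (at t within X)"
      unfolding has_vector_derivative_def by (auto intro!: derivative_eq_intros)
  qed
  have "C1_curve A a b \<gamma>" if ab: "0 \<le> a" "a < b" "b \<le> 1" for a b
    unfolding C1_curve_def
  proof (intro conjI ballI)
    have sub: "{a..b} \<subseteq> {0..1}" using ab by auto
    show contab: "continuous_on {a..b} \<gamma>" by (rule continuous_on_subset[OF cont sub])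
    fix c' assume c': "c' \<in> A"
    let ?T = "snd c' \<circ> chart_inv c"
    show "\<exists>D. continuous_on ({a..b} \<inter> \<gamma> -` fst c') D \<and>
       (\<forall>t\<in>{a..b} \<inter> \<gamma> -` fst c'. (snd c' \<circ> \<gamma> has_vector_derivative D t) (at t within {a..b}))"
    proof (intro exI[of _ "\<lambda>t. frechet_derivative ?T (at (snd c (\<gamma> t))) (v - u)"] conjI ballI)
      have "smooth_on ?T (snd c ` (fst c \<inter> fst c'))"
        using manifold c c' unfolding riemannian_manifold_def smooth_atlas_def by blast
      then have "Ck_on (Suc 0) ?T (snd c ` (fst c \<inter> fst c'))" unfolding smooth_on_def by blast
      then have 1: "continuous_on (snd c ` (fst c \<inter> fst c')) (\<lambda>x. frechet_derivative ?T (at x) (v - u))" by simp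
      have 2: "continuous_on ({a..b} \<inter> \<gamma> -` fst c') (\<lambda>t. snd c (\<gamma> t))"
        by (rule continuous_on_compose2[OF continuous_on_chart[OF c] continuous_on_subset[OF contab]])
          (use mem sub in auto)
      show "continuous_on ({a..b} \<inter> \<gamma> -` fst c') (\<lambda>t. frechet_derivative ?T (at (snd c (\<gamma> t))) (v - u))"
        by (rule continuous_on_compose2[OF 1 2]) (use mem(1) sub in auto)
      fix t assume t: "t \<in> {a..b} \<inter> \<gamma> -` fst c'"
      show "(snd c' \<circ> \<gamma> has_vector_derivative frechet_derivative ?T (at (snd c (\<gamma> t))) (v - u)) (at t within {a..b})"
      proof (rule has_vector_derivative_change_chart[OF c c'])
        show "\<gamma> t \<in> fst c" using mem t sub by auto
        show "\<gamma> t \<in> fst c'" using t by auto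
        show "continuous (at t within {a..b}) \<gamma>" using contab t unfolding continuous_on_eq_continuous_within by blast
        show "t \<in> {a..b}" using t by auto
        show "(snd c \<circ> \<gamma> has_vector_derivative v - u) (at t within {a..b})" by (rule D) (use t sub in auto)
      qed
    qed
  qed
  then show "piecewise_C1_curve A \<gamma>"
    unfolding piecewise_C1_curve_iff path_def using cont finite.emptyI by blast
  show "speed \<gamma> t = sqrt (gc c (\<gamma> t) (v - u) (v - u))" if t: "t \<in> {0<..<1}"
  proof (rule speed_eq[OF c])
    show "\<gamma> t \<in> fst c" using mem t by auto
    show "continuous (at t) \<gamma>"
      using continuous_at_of_path[of \<gamma> t] cont t by (simp add: path_def)
    show "(snd c \<circ> \<gamma> has_vector_derivative v - u) (at t)"
      using D[of t "{0..1}"] t by (simp add: at_within_Icc_at)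
  qed
qed

section \<open>The distance in coordinates\<close>

abbreviation dM where "dM \<equiv> riemannian_dist A g"

abbreviation gnorm where "gnorm c x w \<equiv> sqrt (metric_coeff A g c x w w)"

lemma gnorm_equiv:
  assumes "c \<in> A" "x \<in> fst c"
  obtains m M where "m > 0" "M > 0" "\<And>w. m * norm w \<le> gnorm c x w" "\<And>w. gnorm c x w \<le> M * norm w"
proof -
  obtain B :: "'e set" where B: "finite B" "span B = UNIV" using finite_dimensional by blast
  from posdef_norm_equiv[OF B bilinear_gc[OF assms] gc_pos[OF assms]] that show ?thesis by blast
qed

text \<open>The coefficients of the metric are continuous, and there are finitely many of them.\<close>

lemma metric_nearly_constant:
  assumes c: "c \<in> A" "x \<in> fst c" and \<epsilon>: "0 < \<epsilon>" "\<epsilon> < 1"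
  obtains R where "R > 0" "ball (snd c x) R \<subseteq> snd c ` fst c"
    "\<And>u w. u \<in> ball (snd c x) R \<Longrightarrow> (1 - \<epsilon>) * gnorm c x w \<le> gnorm c (chart_inv c u) w"
    "\<And>u w. u \<in> ball (snd c x) R \<Longrightarrow> gnorm c (chart_inv c u) w \<le> (1 + \<epsilon>) * gnorm c x w"
proof -
  obtain B :: "'e set" where B: "finite B" "span B = UNIV" using finite_dimensional by blast
  obtain C where C: "finite C" "\<And>b. b \<in> C \<Longrightarrow> norm b = (1::real)" "pairwise orthogonal C"
    "\<And>w. (\<Sum>b\<in>C. (w \<bullet> b) *\<^sub>R b) = (w::'e)"
    using finite_orthonormal_basis[OF B] by blast
  obtain m M where m: "m > 0" "M > 0" "\<And>w. m * norm w \<le> gnorm c x w" "\<And>w. gnorm c x w \<le> M * norm w"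
    using gnorm_equiv[OF c] by blast
  let ?u = "snd c x"
  define \<eta> where "\<eta> = \<epsilon> * m\<^sup>2 / (real (card (C \<times> C)) + 1)"
  have \<eta>: "\<eta> > 0" unfolding \<eta>_def using \<epsilon> m(1) by (intro divide_pos_pos mult_pos_pos) auto
  have u: "?u \<in> snd c ` fst c" using c(2) by blast
  have near: "\<forall>\<^sub>F u in nhds ?u. u \<in> snd c ` fst c"
    by (rule eventually_nhds_in_open[OF open_chart_image[OF c(1)] u])
  have "\<forall>\<^sub>F u in nhds ?u. \<bar>gc c (chart_inv c u) b b' - gc c x b b'\<bar> < \<eta>" for b b'
  proof -
    have "continuous_on (snd c ` fst c) (\<lambda>u. gc c (chart_inv c u) b b')"
      by (rule continuous_on_gc[OF c(1) continuous_on_chart_inv[OF c(1)]])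
        (use chart_inv_mem[OF c(1)] in \<open>auto intro: continuous_intros\<close>)
    then have "continuous (at ?u) (\<lambda>u. gc c (chart_inv c u) b b')"
      unfolding continuous_on_eq_continuous_at[OF open_chart_image[OF c(1)]] using u by blast
    then have "((\<lambda>u. gc c (chart_inv c u) b b') \<longlongrightarrow> gc c x b b') (nhds ?u)"
      using tendsto_at_iff_tendsto_nhds[of "\<lambda>u. gc c (chart_inv c u) b b'" ?u]
      unfolding continuous_at by (simp add: chart_inv_left[OF c])
    then have "\<forall>\<^sub>F u in nhds ?u. dist (gc c (chart_inv c u) b b') (gc c x b b') < \<eta>"
      using \<eta> by (rule tendstoD)
    then show ?thesis by (simp add: dist_real_def)
  qed
  then have "\<forall>\<^sub>F u in nhds ?u. \<forall>p\<in>C\<times>C. \<bar>gc c (chart_inv c u) (fst p) (snd p) - gc c x (fst p) (snd p)\<bar> < \<eta>"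
    using C(1) by (intro eventually_ball_finite) auto
  with near have "\<forall>\<^sub>F u in nhds ?u. u \<in> snd c ` fst c \<and>
      (\<forall>p\<in>C\<times>C. \<bar>gc c (chart_inv c u) (fst p) (snd p) - gc c x (fst p) (snd p)\<bar> < \<eta>)"
    by (rule eventually_conj)
  then obtain R where R: "R > 0" "\<And>u. dist u ?u < R \<Longrightarrow> u \<in> snd c ` fst c \<and>
      (\<forall>p\<in>C\<times>C. \<bar>gc c (chart_inv c u) (fst p) (snd p) - gc c x (fst p) (snd p)\<bar> < \<eta>)"
    unfolding eventually_nhds_metric by blast
  have expand: "gc c y w w = (\<Sum>p\<in>C\<times>C. (w \<bullet> fst p) * (w \<bullet> snd p) * gc c y (fst p) (snd p))" if "y \<in> fst c" for y w
  proof -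
    have q: "bilinear (gc c y)" using bilinear_gc c(1) that by blast
    show ?thesis
      using bilinear_sum[OF q, of "\<lambda>b. (w \<bullet> b) *\<^sub>R b" C "\<lambda>b. (w \<bullet> b) *\<^sub>R b" C] C(4)[of "w"]
      by (simp add: bilinear_lmul[OF q] bilinear_rmul[OF q] mult_ac case_prod_beta)
  qed
  have close: "\<bar>gc c (chart_inv c u) w w - gc c x w w\<bar> \<le> \<epsilon> * gc c x w w" if "u \<in> ball ?u R" for u w
  proof -
    have u: "u \<in> snd c ` fst c" "\<forall>p\<in>C\<times>C. \<bar>gc c (chart_inv c u) (fst p) (snd p) - gc c x (fst p) (snd p)\<bar> < \<eta>"
      using R(2)[of u] that by (auto simp: dist_commute)
    have "gc c (chart_inv c u) w w - gc c x w w =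
        (\<Sum>p\<in>C\<times>C. (w \<bullet> fst p) * (w \<bullet> snd p) * (gc c (chart_inv c u) (fst p) (snd p) - gc c x (fst p) (snd p)))"
      using expand[OF chart_inv_mem[OF c(1) u(1)]] expand[OF c(2)] by (simp add: sum_subtractf right_diff_distrib)
    also have "\<bar>\<dots>\<bar> \<le> (\<Sum>p\<in>C\<times>C. norm w * norm w * \<eta>)"
    proof (rule order_trans[OF sum_abs], rule sum_mono)
      fix p assume p: "p \<in> C \<times> C"
      have "\<bar>w \<bullet> fst p\<bar> \<le> norm w" "\<bar>w \<bullet> snd p\<bar> \<le> norm w"
        using Cauchy_Schwarz_ineq2[of w "fst p"] Cauchy_Schwarz_ineq2[of w "snd p"] C(2) p by auto
      moreover have "\<bar>gc c (chart_inv c u) (fst p) (snd p) - gc c x (fst p) (snd p)\<bar> \<le> \<eta>" using u(2) p by fastforce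
      ultimately show "\<bar>(w \<bullet> fst p) * (w \<bullet> snd p) * (gc c (chart_inv c u) (fst p) (snd p) - gc c x (fst p) (snd p))\<bar>
          \<le> norm w * norm w * \<eta>"
        unfolding abs_mult by (intro mult_mono) auto
    qed
    also have "\<dots> = real (card (C\<times>C)) * \<eta> * (norm w)\<^sup>2" by (simp add: power2_eq_square)
    also have "\<dots> \<le> (\<epsilon> * m\<^sup>2) * (norm w)\<^sup>2"
    proof (rule mult_right_mono)
      have "real (card (C\<times>C)) * \<eta> \<le> (real (card (C\<times>C)) + 1) * \<eta>" using \<eta> by simp
      also have "\<dots> = \<epsilon> * m\<^sup>2" unfolding \<eta>_def by (simp add: add_pos_nonneg)
      finally show "real (card (C\<times>C)) * \<eta> \<le> \<epsilon> * m\<^sup>2" .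
    qed simp
    also have "\<dots> = \<epsilon> * (m * norm w)\<^sup>2" by (simp add: power_mult_distrib)
    also have "\<dots> \<le> \<epsilon> * (gnorm c x w)\<^sup>2"
      using m(1) m(3)[of w] \<epsilon> by (intro mult_left_mono power_mono) auto
    also have "(gnorm c x w)\<^sup>2 = gc c x w w" using gc_nonneg[OF c] by simp
    finally show ?thesis .
  qed
  show ?thesis
  proof (rule that[OF R(1)])
    show "ball (snd c x) R \<subseteq> snd c ` fst c" using R(2) by (auto simp: dist_commute)
    fix u w assume u: "u \<in> ball (snd c x) R"
    have "(1 - \<epsilon>)\<^sup>2 \<le> 1 - \<epsilon>" "1 + \<epsilon> \<le> (1 + \<epsilon>)\<^sup>2" using \<epsilon> by (auto simp: power2_eq_square algebra_simps mult_le_one)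
    then have *: "(1 - \<epsilon>)\<^sup>2 * gc c x w w \<le> (1 - \<epsilon>) * gc c x w w" "(1 + \<epsilon>) * gc c x w w \<le> (1 + \<epsilon>)\<^sup>2 * gc c x w w"
      using gc_nonneg[OF c] by (auto intro!: mult_right_mono)
    have cl: "(1 - \<epsilon>) * gc c x w w \<le> gc c (chart_inv c u) w w" "gc c (chart_inv c u) w w \<le> (1 + \<epsilon>) * gc c x w w"
      using close[OF u, of w] by (auto simp: algebra_simps abs_le_iff)
    have "sqrt ((1 - \<epsilon>)\<^sup>2 * gc c x w w) \<le> gnorm c (chart_inv c u) w" using * cl by (intro real_sqrt_le_mono) auto
    then show "(1 - \<epsilon>) * gnorm c x w \<le> gnorm c (chart_inv c u) w" using \<epsilon> by (simp add: real_sqrt_mult)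
    have "gnorm c (chart_inv c u) w \<le> sqrt ((1 + \<epsilon>)\<^sup>2 * gc c x w w)" using * cl by (intro real_sqrt_le_mono) auto
    then show "gnorm c (chart_inv c u) w \<le> (1 + \<epsilon>) * gnorm c x w" using \<epsilon> by (simp add: real_sqrt_mult)
  qed
qed

lemma curve_length_nonneg: "piecewise_C1_curve A \<gamma> \<Longrightarrow> 0 \<le> curve_length A g \<gamma>"
  using integral_speed_nonneg[of \<gamma> 0 1] by (simp add: curve_length_eq)

lemma dist_le_curve_length:
  assumes "piecewise_C1_curve A \<gamma>" "pathstart \<gamma> = x" "pathfinish \<gamma> = y"
  shows "dM x y \<le> curve_length A g \<gamma>"
  unfolding riemannian_dist_def
  by (rule cINF_lower) (use assms curve_length_nonneg in \<open>auto intro!: bdd_belowI[of _ 0]\<close>)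

lemma dist_greatest:
  assumes "\<exists>\<gamma>. piecewise_C1_curve A \<gamma> \<and> pathstart \<gamma> = x \<and> pathfinish \<gamma> = y"
    "\<And>\<gamma>. piecewise_C1_curve A \<gamma> \<Longrightarrow> pathstart \<gamma> = x \<Longrightarrow> pathfinish \<gamma> = y \<Longrightarrow> r \<le> curve_length A g \<gamma>"
  shows "r \<le> dM x y"
  unfolding riemannian_dist_def by (rule cINF_greatest) (use assms in auto)

lemma chart_ball_eq:
  assumes c: "c \<in> A" and sub: "ball p R \<subseteq> snd c ` fst c"
  shows "chart_inv c ` ball p R = fst c \<inter> snd c -` ball p R"
proof (intro equalityI subsetI)
  fix y assume "y \<in> chart_inv c ` ball p R"
  then obtain u where "u \<in> ball p R" "y = chart_inv c u" by blast
  moreover then have "u \<in> snd c ` fst c" using sub by blast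
  ultimately show "y \<in> fst c \<inter> snd c -` ball p R"
    using chart_inv_mem[OF c] chart_inv_right[OF c] by simp
next
  fix y assume y: "y \<in> fst c \<inter> snd c -` ball p R"
  then have "y = chart_inv c (snd c y)" using chart_inv_left[OF c] by simp
  then show "y \<in> chart_inv c ` ball p R" using y by blast
qed

lemma open_chart_ball:
  assumes "c \<in> A" "ball p R \<subseteq> snd c ` fst c"
  shows "open (chart_inv c ` ball p R)"
  unfolding chart_ball_eq[OF assms]
  by (rule continuous_open_preimage[OF continuous_on_chart[OF assms(1)] open_chart_domain[OF assms(1)] open_ball])

text \<open>A curve that starts in the middle of a coordinate ball has to cross a shell of the ball
  before it leaves the ball.\<close>

lemma escape_length:
  assumes c: "c \<in> A" "x \<in> fst c" and R: "R > 0" "ball (snd c x) R \<subseteq> snd c ` fst c"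
    and near: "\<And>u w. u \<in> ball (snd c x) R \<Longrightarrow> \<kappa> * gnorm c x w \<le> gnorm c (chart_inv c u) w" "0 < \<kappa>"
    and m: "0 < m" "\<And>w. m * norm w \<le> gnorm c x w"
    and \<gamma>: "piecewise_C1_curve A \<gamma>" "\<gamma> 0 = chart_inv c u" "u \<in> ball (snd c x) (R/4)"
    and leave: "\<not> \<gamma> ` {0..1} \<subseteq> chart_inv c ` ball (snd c x) R"
  shows "\<kappa> * m * (R / 4) \<le> curve_length A g \<gamma>"
proof -
  let ?V = "chart_inv c ` ball (snd c x) R" and ?K = "chart_inv c ` cball (snd c x) (R/2)"
  obtain B :: "'e set" where B: "finite B" "span B = UNIV" using finite_dimensional by blast
  have openV: "open ?V" by (rule open_chart_ball[OF c(1) R(2)])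
  have cb: "cball (snd c x) (R/2) \<subseteq> ball (snd c x) R" using R(1) by auto
  have "compact ?K"
    by (rule compact_continuous_image[OF continuous_on_subset[OF continuous_on_chart_inv[OF c(1)]]
          compact_cball_finite_span[OF B]]) (use cb R(2) in blast)
  then have closedK: "closed ?K" by (rule compact_imp_closed)
  have path: "path \<gamma>" and cont: "continuous_on {0..1} \<gamma>"
    using \<gamma>(1) unfolding piecewise_C1_curve_iff path_def by auto
  define Z where "Z = {0..1} \<inter> \<gamma> -` (- ?V)"
  have "closed Z" unfolding Z_def
    by (rule continuous_closed_preimage[OF cont]) (use openV in \<open>auto simp: closed_def\<close>)
  then have "compact ({0..1} \<inter> Z)" by (rule compact_Int_closed[OF compact_Icc])
  then have "compact Z" unfolding Z_def by (simp add: Int_absorb1)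
  moreover have "Z \<noteq> {}" unfolding Z_def using leave by auto
  ultimately obtain \<tau> where \<tau>: "\<tau> \<in> Z" "\<And>t. t \<in> Z \<Longrightarrow> \<tau> \<le> t"
    using compact_attains_inf[of Z] by metis
  have uu: "u \<in> ball (snd c x) R" using \<gamma>(3) R(1) by auto
  then have "0 \<notin> Z" unfolding Z_def using \<gamma>(2) by auto
  then have \<tau>01: "0 < \<tau>" "\<tau> \<le> 1" using \<tau>(1) unfolding Z_def by (cases "\<tau> = 0", auto)+
  have before: "\<gamma> t \<in> ?V" if "0 \<le> t" "t < \<tau>" for t
    using \<tau>(2)[of t] that \<tau>01 unfolding Z_def by force
  have "\<exists>t\<in>{0..<\<tau>}. \<gamma> t \<notin> ?K"
  proof (rule ccontr)
    assume "\<not> ?thesis"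
    then have "{0..<\<tau>} \<subseteq> {0..1} \<inter> \<gamma> -` ?K" using \<tau>01 by auto
    moreover have "closed ({0..1} \<inter> \<gamma> -` ?K)"
      by (rule continuous_closed_preimage[OF cont _ closedK]) simp
    ultimately have "closure {0..<\<tau>} \<subseteq> {0..1} \<inter> \<gamma> -` ?K" by (rule closure_minimal)
    moreover have "\<tau> \<in> closure {0..<\<tau>}" using \<tau>01 by simp
    ultimately have "\<gamma> \<tau> \<in> ?K" by blast
    then have "\<gamma> \<tau> \<in> ?V" using cb by blast
    then show False using \<tau>(1) unfolding Z_def by blast
  qed
  then obtain t where t: "0 \<le> t" "t < \<tau>" "\<gamma> t \<notin> ?K" by auto
  obtain v where v: "v \<in> ball (snd c x) R" "\<gamma> t = chart_inv c v" using before[OF t(1,2)] by blast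
  have "v \<notin> cball (snd c x) (R/2)" using t(3) v(2) by blast
  then have far: "R / 4 \<le> norm (v - u)"
    using \<gamma>(3) norm_triangle_ineq[of "v - u" "u - snd c x"]
    by (auto simp: dist_norm norm_minus_commute)
  have "\<kappa> * m * (R/4) \<le> \<kappa> * (m * norm (v - u))" using near(2) m(1) far by (simp add: mult_left_mono)
  also have "\<dots> \<le> \<kappa> * gnorm c x (v - u)" using near(2) m(2) by (intro mult_left_mono) auto
  also have "\<dots> \<le> integral {0..t} (speed \<gamma>)"
  proof -
    have "\<kappa> * gnorm c x (snd c (\<gamma> t) - snd c (\<gamma> 0)) \<le> integral {0..t} (speed \<gamma>)"
    proof (rule integral_speed_ge_displacement[OF \<gamma>(1) t(1) _ c(1) _ bilinear_gc[OF c] gc_sym[OF c] gc_pos[OF c]])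
      show "t \<le> 1" using t \<tau>01 by simp
      show "\<gamma> ` {0..t} \<subseteq> fst c" using before t(2) chart_inv_mem[OF c(1)] R(2) by force
      show "0 \<le> \<kappa>" using near(2) by simp
      fix s w assume "s \<in> {0..t}"
      then obtain u' where "u' \<in> ball (snd c x) R" "\<gamma> s = chart_inv c u'" using before[of s] t(2) by auto
      then show "\<kappa> * gnorm c x w \<le> gnorm c (\<gamma> s) w" using near(1) by simp
    qed
    moreover have "snd c (\<gamma> t) = v" "snd c (\<gamma> 0) = u"
      using v \<gamma>(2) uu chart_inv_right[OF c(1)] R(2) by auto
    ultimately show ?thesis by simp
  qed
  also have "\<dots> \<le> curve_length A g \<gamma>" by (rule integral_speed_mono[OF \<gamma>(1) t(1)]) (use t \<tau>01 in simp)
  finally show ?thesis .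
qed

lemma segment_in_ball:
  fixes u v p :: "'e"
  assumes "u \<in> ball p R" "v \<in> ball p R" "t \<in> {0..1}"
  shows "u + t *\<^sub>R (v - u) \<in> ball p R"
proof -
  have "(1 - t) *\<^sub>R u + t *\<^sub>R v \<in> ball p R"
    using convexD[OF convex_ball assms(1,2), of "1 - t" t] assms(3) by simp
  then show ?thesis by (simp add: algebra_simps)
qed

text \<open>Near a point, the distance is the norm given by the metric at that point, up to a factor
  close to 1: coordinate segments are nearly shortest, and curves that leave the coordinate ball
  are too long to matter.\<close>

lemma dist_near_point:
  assumes c: "c \<in> A" "x \<in> fst c" and \<epsilon>: "0 < \<epsilon>" "\<epsilon> < 1"
  obtains R \<rho> where "R > 0" "\<rho> > 0" "ball (snd c x) R \<subseteq> snd c ` fst c"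
    "\<And>u v. u \<in> ball (snd c x) R \<Longrightarrow> v \<in> ball (snd c x) R \<Longrightarrow>
       (1 - \<epsilon>) * gnorm c x (v - u) \<le> dM (chart_inv c u) (chart_inv c v)"
    "\<And>u v. u \<in> ball (snd c x) R \<Longrightarrow> v \<in> ball (snd c x) R \<Longrightarrow>
       dM (chart_inv c u) (chart_inv c v) \<le> (1 + \<epsilon>) * gnorm c x (v - u)"
    "\<And>\<gamma>. piecewise_C1_curve A \<gamma> \<Longrightarrow> pathstart \<gamma> = x \<Longrightarrow> pathfinish \<gamma> \<notin> chart_inv c ` ball (snd c x) R \<Longrightarrow>
       \<rho> \<le> curve_length A g \<gamma>"
proof -
  obtain R0 where R0: "R0 > 0" "ball (snd c x) R0 \<subseteq> snd c ` fst c"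
    "\<And>u w. u \<in> ball (snd c x) R0 \<Longrightarrow> (1 - \<epsilon>) * gnorm c x w \<le> gnorm c (chart_inv c u) w"
    "\<And>u w. u \<in> ball (snd c x) R0 \<Longrightarrow> gnorm c (chart_inv c u) w \<le> (1 + \<epsilon>) * gnorm c x w"
    using metric_nearly_constant[OF c \<epsilon>] by blast
  obtain m M where m: "m > 0" "M > 0" "\<And>w. m * norm w \<le> gnorm c x w" "\<And>w. gnorm c x w \<le> M * norm w"
    using gnorm_equiv[OF c] by blast
  define R where "R = min (R0/4) (m * R0 / (8 * M))"
  have R: "R > 0" "R \<le> R0/4" "M * (2 * R) \<le> m * (R0/4)"
  proof -
    show "R > 0" "R \<le> R0/4" unfolding R_def using R0(1) m by auto
    have "R \<le> m * R0 / (8 * M)" unfolding R_def by simp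
    then show "M * (2 * R) \<le> m * (R0/4)" using m(2) by (simp add: field_simps)
  qed
  have sub: "ball (snd c x) R \<subseteq> ball (snd c x) R0" using R R0(1) by (intro subset_ball) simp
  have inv: "snd c (chart_inv c u) = u" if "u \<in> ball (snd c x) R0" for u
    using chart_inv_right[OF c(1)] R0(2) that by blast
  define \<rho> where "\<rho> = min ((1 - \<epsilon>) * m * (R0/4)) ((1 - \<epsilon>) * m * R)"
  have \<rho>: "\<rho> > 0" unfolding \<rho>_def using \<epsilon> m R R0(1) by simp
  have low: "(1 - \<epsilon>) * gnorm c x (v - u) \<le> curve_length A g \<gamma>"
    if \<gamma>: "piecewise_C1_curve A \<gamma>" "\<gamma> 0 = chart_inv c u" "\<gamma> 1 = chart_inv c v" and u: "u \<in> ball (snd c x) R"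
      and v: "v \<in> ball (snd c x) R0" and stay: "\<gamma> ` {0..1} \<subseteq> chart_inv c ` ball (snd c x) R0" for u v \<gamma>
  proof -
    have "(1 - \<epsilon>) * gnorm c x (snd c (\<gamma> 1) - snd c (\<gamma> 0)) \<le> integral {0..1} (speed \<gamma>)"
    proof (rule integral_speed_ge_displacement[OF \<gamma>(1) _ _ c(1) _ bilinear_gc[OF c] gc_sym[OF c] gc_pos[OF c]])
      have "chart_inv c ` ball (snd c x) R0 \<subseteq> fst c"
        by (rule image_subsetI, rule chart_inv_mem[OF c(1)], rule subsetD[OF R0(2)])
      then show "\<gamma> ` {0..1} \<subseteq> fst c" using stay by (rule subset_trans[rotated])
      fix s w assume "s \<in> {0..(1::real)}"
      then obtain u' where "u' \<in> ball (snd c x) R0" "\<gamma> s = chart_inv c u'" using stay by blast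
      then show "(1 - \<epsilon>) * gnorm c x w \<le> gnorm c (\<gamma> s) w" using R0(3) by simp
    qed (use \<epsilon> in auto)
    then show ?thesis unfolding \<gamma>(2,3) curve_length_eq inv[OF v] inv[OF subsetD[OF sub u]] .
  qed
  have seg: "piecewise_C1_curve A (\<lambda>t. chart_inv c (u + t *\<^sub>R (v - u)))"
     "curve_length A g (\<lambda>t. chart_inv c (u + t *\<^sub>R (v - u))) \<le> (1 + \<epsilon>) * gnorm c x (v - u)"
    if u: "u \<in> ball (snd c x) R" "v \<in> ball (snd c x) R" for u v
  proof -
    let ?\<gamma> = "\<lambda>t. chart_inv c (u + t *\<^sub>R (v - u))"
    have mem: "u + t *\<^sub>R (v - u) \<in> ball (snd c x) R0" if "t \<in> {0..1}" for t
      using segment_in_ball[OF u that] sub by blast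
    then have mem': "u + t *\<^sub>R (v - u) \<in> snd c ` fst c" if "t \<in> {0..1}" for t using that R0(2) by blast
    show pw: "piecewise_C1_curve A ?\<gamma>" by (rule coordinate_segment(1)[OF c(1) mem'])
    have "integral {0..1} (speed ?\<gamma>) \<le> integral {0..1::real} (\<lambda>_. (1 + \<epsilon>) * gnorm c x (v - u))"
    proof (rule integral_le_off_finite[OF speed_integrable[OF pw]])
      fix t :: real assume t: "t \<in> {0..1} - {0,1}"
      then have "speed ?\<gamma> t = gnorm c (chart_inv c (u + t *\<^sub>R (v - u))) (v - u)"
        by (intro coordinate_segment(2)[OF c(1) mem']) auto
      then show "speed ?\<gamma> t \<le> (1 + \<epsilon>) * gnorm c x (v - u)" using R0(4)[OF mem] t by simp
    qed auto
    then show "curve_length A g ?\<gamma> \<le> (1 + \<epsilon>) * gnorm c x (v - u)" by (simp add: curve_length_eq)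
  qed
  show ?thesis
  proof (rule that[OF R(1) \<rho>])
    show "ball (snd c x) R \<subseteq> snd c ` fst c" using sub R0(2) by blast
    fix u v assume uv: "u \<in> ball (snd c x) R" "v \<in> ball (snd c x) R"
    show up: "dM (chart_inv c u) (chart_inv c v) \<le> (1 + \<epsilon>) * gnorm c x (v - u)"
      using dist_le_curve_length[OF seg(1)[OF uv]] seg(2)[OF uv] by (force simp: pathstart_def pathfinish_def)
    show "(1 - \<epsilon>) * gnorm c x (v - u) \<le> dM (chart_inv c u) (chart_inv c v)"
    proof (rule dist_greatest)
      show "\<exists>\<gamma>. piecewise_C1_curve A \<gamma> \<and> pathstart \<gamma> = chart_inv c u \<and> pathfinish \<gamma> = chart_inv c v"
        using seg(1)[OF uv] by (intro exI[of _ "\<lambda>t. chart_inv c (u + t *\<^sub>R (v - u))"]) (simp add: pathstart_def pathfinish_def)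
      fix \<gamma> assume \<gamma>: "piecewise_C1_curve A \<gamma>" "pathstart \<gamma> = chart_inv c u" "pathfinish \<gamma> = chart_inv c v"
      show "(1 - \<epsilon>) * gnorm c x (v - u) \<le> curve_length A g \<gamma>"
      proof (cases "\<gamma> ` {0..1} \<subseteq> chart_inv c ` ball (snd c x) R0")
        case True
        then show ?thesis using low \<gamma> uv sub unfolding pathstart_def pathfinish_def by blast
      next
        case False
        have "norm (v - u) \<le> 2 * R"
          using uv norm_triangle_ineq4[of "v - snd c x" "u - snd c x"] by (auto simp: dist_norm norm_minus_commute)
        then have "gnorm c x (v - u) \<le> M * (2 * R)" using m(4)[of "v - u"] m(2) by (meson mult_left_mono less_imp_le order_trans)
        then have "(1 - \<epsilon>) * gnorm c x (v - u) \<le> (1 - \<epsilon>) * (m * (R0/4))" using R(3) \<epsilon> by (intro mult_left_mono) auto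
        also have "\<dots> = (1 - \<epsilon>) * m * (R0/4)" by simp
        also have "\<dots> \<le> curve_length A g \<gamma>"
        proof (rule escape_length[OF c R0(1,2,3) _ m(1,3) \<gamma>(1) _ _ False])
          show "\<gamma> 0 = chart_inv c u" using \<gamma>(2) by (simp add: pathstart_def)
          show "u \<in> ball (snd c x) (R0/4)" using uv(1) R(2) by auto
        qed (use \<epsilon> in auto)
        finally show ?thesis .
      qed
    qed
  next
    fix \<gamma> assume \<gamma>: "piecewise_C1_curve A \<gamma>" "pathstart \<gamma> = x" "pathfinish \<gamma> \<notin> chart_inv c ` ball (snd c x) R"
    have x: "x = chart_inv c (snd c x)" using chart_inv_left[OF c] by simp
    show "\<rho> \<le> curve_length A g \<gamma>"
    proof (cases "\<gamma> ` {0..1} \<subseteq> chart_inv c ` ball (snd c x) R0")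
      case True
      then have "\<gamma> 1 \<in> chart_inv c ` ball (snd c x) R0" by auto
      then obtain v where v: "v \<in> ball (snd c x) R0" "\<gamma> 1 = chart_inv c v" by blast
      then have "v \<notin> ball (snd c x) R" using \<gamma>(3) unfolding pathfinish_def by auto
      then have "R \<le> norm (v - snd c x)" by (simp add: dist_norm norm_minus_commute)
      then have "(1 - \<epsilon>) * m * R \<le> (1 - \<epsilon>) * (m * norm (v - snd c x))" using \<epsilon> m(1) by (simp add: mult_left_mono)
      also have "\<dots> \<le> (1 - \<epsilon>) * gnorm c x (v - snd c x)" using \<epsilon> m(3) by (intro mult_left_mono) auto
      also have "\<dots> \<le> curve_length A g \<gamma>"
        by (rule low[OF \<gamma>(1) _ v(2) _ v(1) True]) (use \<gamma>(2) x R(1) in \<open>auto simp: pathstart_def\<close>)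
      finally show ?thesis unfolding \<rho>_def by simp
    next
      case False
      have "(1 - \<epsilon>) * m * (R0/4) \<le> curve_length A g \<gamma>"
      proof (rule escape_length[OF c R0(1,2,3) _ m(1,3) \<gamma>(1) _ _ False])
        show "\<gamma> 0 = chart_inv c (snd c x)" using \<gamma>(2) x by (simp add: pathstart_def)
        show "snd c x \<in> ball (snd c x) (R0/4)" using R0(1) by simp
      qed (use \<epsilon> in auto)
      then show ?thesis unfolding \<rho>_def by simp
    qed
  qed
qed

end

section \<open>Distance functions that induce the topology\<close>

text \<open>The distance is a parameter and not the \<open>dist\<close> of a type class, because the distance of a
  Riemannian metric is constructed on a type that carries a topology only.\<close>

locale topological_distance =
  fixes d :: "'a::t2_space \<Rightarrow> 'a \<Rightarrow> real"
  assumes d_self [simp]: "d x x = 0"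
    and d_pos: "x \<noteq> y \<Longrightarrow> 0 < d x y"
    and d_sym: "d x y = d y x"
    and d_triangle: "d x z \<le> d x y + d y z"
    and open_iff_d: "open U \<longleftrightarrow> (\<forall>x\<in>U. \<exists>e>0. \<forall>y. d x y < e \<longrightarrow> y \<in> U)"
begin

lemma d_nonneg [simp]: "0 \<le> d x y"
  using d_pos[of x y] by (cases "x = y") auto

lemma open_d_ball: "open {y. d x y < e}"
  unfolding open_iff_d
proof (intro ballI)
  fix y assume "y \<in> {y. d x y < e}"
  then have "0 < e - d x y" by simp
  moreover have "z \<in> {y. d x y < e}" if "d y z < e - d x y" for z
    using d_triangle[of x z y] that by simp
  ultimately show "\<exists>e'>0. \<forall>z. d y z < e' \<longrightarrow> z \<in> {y. d x y < e}" by blast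
qed

lemma continuous_on_d: "continuous_on UNIV (d x)"
  unfolding continuous_on_open_vimage[OF open_UNIV]
proof (intro allI impI)
  fix B :: "real set" assume B: "open B"
  have "open (d x -` B)"
    unfolding open_iff_d
  proof
    fix y assume "y \<in> d x -` B"
    then obtain e where e: "e > 0" "\<And>t. dist t (d x y) < e \<Longrightarrow> t \<in> B" using B unfolding open_dist by auto
    have "z \<in> d x -` B" if "d y z < e" for z
    proof -
      have "dist (d x z) (d x y) \<le> d y z"
        using d_triangle[of x z y] d_triangle[of x y z] d_sym[of z y] by (simp add: dist_real_def abs_le_iff)
      then show ?thesis using e(2) that by simp
    qed
    then show "\<exists>e>0. \<forall>z. d y z < e \<longrightarrow> z \<in> d x -` B" using e(1) by blast
  qed
  then show "open (d x -` B \<inter> UNIV)" by simp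
qed

end

text \<open>The map \<open>h\<close> contracts the ball of radius \<open>\<rho>\<close> around \<open>x\<close> to its point \<open>z\<close>, and it does so in a
  Lipschitz manner in time and space.\<close>

definition ball_contraction ::
  "('a \<Rightarrow> 'a \<Rightarrow> real) \<Rightarrow> 'a \<Rightarrow> real \<Rightarrow> 'a \<Rightarrow> (real \<Rightarrow> 'a \<Rightarrow> 'a) \<Rightarrow> real \<Rightarrow> bool" where
  "ball_contraction d x \<rho> z h C \<longleftrightarrow>
     (\<forall>w w'. d x w < \<rho> \<longrightarrow> d x w' < \<rho> \<longrightarrow> h 0 w = z \<and> h 1 w = w \<and>
       (\<forall>s\<in>{0..1}. \<forall>s'\<in>{0..1}. h s z = z \<and> d (h s w) (h s' w') \<le> C * (\<bar>s - s'\<bar> + d w w')))"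

lemma ball_contraction_subball:
  "ball_contraction d x \<rho> z h C \<Longrightarrow> (\<And>w. d y w < \<rho>' \<Longrightarrow> d x w < \<rho>) \<Longrightarrow> ball_contraction d y \<rho>' z h C"
  unfolding ball_contraction_def by blast

locale connected_riemannian = riemannian A g
  for A :: "('a::t2_space, 'e::real_inner) chart set" and g :: "('a, 'e) metric_tensor" +
  assumes connected_space: "connected (UNIV :: 'a set)"
begin

section \<open>The distance as a metric\<close>

lemma segment_curve:
  assumes "c \<in> A" "ball p R \<subseteq> snd c ` fst c" "u \<in> ball p R" "v \<in> ball p R"
  shows "\<exists>\<gamma>. piecewise_C1_curve A \<gamma> \<and> pathstart \<gamma> = chart_inv c u \<and> pathfinish \<gamma> = chart_inv c v"
proof -
  have "piecewise_C1_curve A (\<lambda>t. chart_inv c (u + t *\<^sub>R (v - u)))"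
    by (rule coordinate_segment(1)[OF assms(1)]) (rule subsetD[OF assms(2) segment_in_ball[OF assms(3,4)]])
  then show ?thesis
    by (intro exI[of _ "\<lambda>t. chart_inv c (u + t *\<^sub>R (v - u))"]) (simp add: pathstart_def pathfinish_def)
qed

text \<open>The points that can be reached from \<open>x\<close> form a set that is open and closed, since any two points
  of a coordinate ball are joined by a coordinate segment.\<close>

lemma ex_piecewise_C1_curve:
  "\<exists>\<gamma>. piecewise_C1_curve A \<gamma> \<and> pathstart \<gamma> = x \<and> pathfinish \<gamma> = y"
proof -
  define X where "X = {y. \<exists>\<gamma>. piecewise_C1_curve A \<gamma> \<and> pathstart \<gamma> = x \<and> pathfinish \<gamma> = y}"
  have nbhd: "\<exists>V. open V \<and> y \<in> V \<and> (\<forall>z\<in>V. z \<in> X \<longleftrightarrow> y \<in> X) \<and> (x \<in> V \<longrightarrow> x \<in> X)" for y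
  proof -
    obtain c where c: "c \<in> A" "y \<in> fst c" using ex_chart by blast
    have "snd c y \<in> snd c ` fst c" using c(2) by blast
    then obtain R where R: "R > 0" "ball (snd c y) R \<subseteq> snd c ` fst c"
      using open_chart_image[OF c(1)] openE by metis
    let ?V = "chart_inv c ` ball (snd c y) R"
    have y: "y = chart_inv c (snd c y)" "snd c y \<in> ball (snd c y) R" using chart_inv_left[OF c] R(1) by auto
    have step: "v' \<in> X" if v: "v \<in> X" "v \<in> ?V" "v' \<in> ?V" for v v'
    proof -
      obtain \<gamma> where \<gamma>: "piecewise_C1_curve A \<gamma>" "pathstart \<gamma> = x" "pathfinish \<gamma> = v"
        using \<open>v \<in> X\<close> unfolding X_def by blast
      obtain u u' where u: "u \<in> ball (snd c y) R" "v = chart_inv c u" "u' \<in> ball (snd c y) R" "v' = chart_inv c u'"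
        using v(2,3) by blast
      obtain \<eta> where \<eta>: "piecewise_C1_curve A \<eta>" "pathstart \<eta> = v" "pathfinish \<eta> = v'"
        using segment_curve[OF c(1) R(2) u(1,3)] u by blast
      have "piecewise_C1_curve A (\<gamma> +++ \<eta>)" using piecewise_C1_join(1)[OF \<gamma>(1) \<eta>(1)] \<gamma>(3) \<eta>(2) by simp
      then show ?thesis unfolding X_def using \<gamma>(2) \<eta>(3) by (intro CollectI exI[of _ "\<gamma> +++ \<eta>"]) simp
    qed
    have yV: "y \<in> ?V" using y by blast
    have xX: "x \<in> X" if xV: "x \<in> ?V"
    proof -
      obtain u where "u \<in> ball (snd c y) R" "x = chart_inv c u" using xV by blast
      then show ?thesis unfolding X_def using segment_curve[OF c(1) R(2), of u u] by simp
    qed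
    show ?thesis
    proof (intro exI[of _ ?V] conjI)
      show "\<forall>z\<in>?V. z \<in> X \<longleftrightarrow> y \<in> X" using step yV by blast
      show "x \<in> ?V \<longrightarrow> x \<in> X" using xX by (intro impI)
    qed (rule open_chart_ball[OF c(1) R(2)], rule yV)
  qed
  have "open X" unfolding open_subopen[of X] using nbhd by (meson subsetI)
  moreover have "open (- X)" unfolding open_subopen[of "- X"] using nbhd by (metis ComplD ComplI subsetI)
  moreover have "x \<in> X" using nbhd[of x] by blast
  ultimately have "X = UNIV" using connectedD[OF connected_space, of X "-X"] by auto
  then show ?thesis unfolding X_def by blast
qed

lemma dist_less_curve:
  assumes "dM x y < s"
  obtains \<gamma> where "piecewise_C1_curve A \<gamma>" "pathstart \<gamma> = x" "pathfinish \<gamma> = y" "curve_length A g \<gamma> < s"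
  using assms dist_greatest[OF ex_piecewise_C1_curve, of x y s] by (meson not_le)

lemma dist_nonneg: "0 \<le> dM x y"
  by (rule dist_greatest[OF ex_piecewise_C1_curve]) (rule curve_length_nonneg)

lemma dist_self: "dM x x = 0"
proof -
  obtain c where c: "c \<in> A" "x \<in> fst c" using ex_chart by blast
  obtain R where R: "R > 0"
    "\<And>u v. u \<in> ball (snd c x) R \<Longrightarrow> v \<in> ball (snd c x) R \<Longrightarrow>
       dM (chart_inv c u) (chart_inv c v) \<le> (1 + 1/2) * gnorm c x (v - u)"
    by (rule dist_near_point[OF c, of "1/2"]) auto
  have "dM x x \<le> 0"
    using R(2)[of "snd c x" "snd c x"] R(1) chart_inv_left[OF c] bilinear_lzero[OF bilinear_gc[OF c], of 0] by simp
  then show ?thesis using dist_nonneg[of x x] by simp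
qed

lemma dist_triangle: "dM x z \<le> dM x y + dM y z"
proof (rule field_le_epsilon)
  fix e :: real assume e: "0 < e"
  obtain \<gamma> where \<gamma>: "piecewise_C1_curve A \<gamma>" "pathstart \<gamma> = x" "pathfinish \<gamma> = y" "curve_length A g \<gamma> < dM x y + e/2"
    using dist_less_curve[of x y "dM x y + e/2"] e by auto
  obtain \<eta> where \<eta>: "piecewise_C1_curve A \<eta>" "pathstart \<eta> = y" "pathfinish \<eta> = z" "curve_length A g \<eta> < dM y z + e/2"
    using dist_less_curve[of y z "dM y z + e/2"] e by auto
  have eq: "pathfinish \<gamma> = pathstart \<eta>" using \<gamma> \<eta> by simp
  have "dM x z \<le> curve_length A g (\<gamma> +++ \<eta>)"
    by (rule dist_le_curve_length[OF piecewise_C1_join(1)[OF \<gamma>(1) \<eta>(1) eq]]) (use \<gamma> \<eta> in auto)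
  also have "\<dots> \<le> dM x y + dM y z + e" unfolding piecewise_C1_join(2)[OF \<gamma>(1) \<eta>(1) eq] using \<gamma>(4) \<eta>(4) by simp
  finally show "dM x z \<le> dM x y + dM y z + e" .
qed

lemma dist_along_curve:
  assumes "piecewise_C1_curve A \<gamma>" "0 \<le> a" "a < b" "b \<le> 1"
  shows "dM (\<gamma> a) (\<gamma> b) \<le> integral {a..b} (speed \<gamma>)" and "dM (\<gamma> b) (\<gamma> a) \<le> integral {a..b} (speed \<gamma>)"
proof -
  have img: "(\<lambda>t. a + (b - a) * t) ` {0..1} = {a..b}" "(\<lambda>t. b + (a - b) * t) ` {0..1} = {a..b}"
    using image_affinity_atLeastAtMost[of "b - a" a 0 1] image_affinity_atLeastAtMost[of "a - b" b 0 1] assms(3)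
    by (simp_all add: add.commute)
  have sub: "(\<lambda>t. a + (b - a) * t) ` {0..1} \<subseteq> {0..1}" "(\<lambda>t. b + (a - b) * t) ` {0..1} \<subseteq> {0..1}"
    unfolding img using assms by auto
  show "dM (\<gamma> a) (\<gamma> b) \<le> integral {a..b} (speed \<gamma>)"
    using dist_le_curve_length[OF affine_reparametrization(1)[OF assms(1) _ sub(1)] refl refl] assms(3)
      affine_reparametrization(2)[OF assms(1) _ sub(1)] unfolding img by (simp add: pathstart_def pathfinish_def)
  show "dM (\<gamma> b) (\<gamma> a) \<le> integral {a..b} (speed \<gamma>)"
    using dist_le_curve_length[OF affine_reparametrization(1)[OF assms(1) _ sub(2)] refl refl] assms(3)
      affine_reparametrization(2)[OF assms(1) _ sub(2)] unfolding img by (simp add: pathstart_def pathfinish_def)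
qed

lemma dist_sym: "dM x y = dM y x"
proof -
  have "dM y x \<le> dM x y" for x y
  proof (rule dist_greatest[OF ex_piecewise_C1_curve])
    fix \<gamma> assume \<gamma>: "piecewise_C1_curve A \<gamma>" "pathstart \<gamma> = x" "pathfinish \<gamma> = y"
    show "dM y x \<le> curve_length A g \<gamma>"
      using dist_along_curve(2)[OF \<gamma>(1), of 0 1] \<gamma> by (simp add: curve_length_eq pathstart_def pathfinish_def)
  qed
  then show ?thesis by (simp add: antisym)
qed

text \<open>The version of \<open>dist_near_point\<close> for later use: a short distance from \<open>x\<close> keeps the points in
  the coordinate ball.\<close>

lemma dist_chart_comparison:
  assumes c: "c \<in> A" "x \<in> fst c" and \<epsilon>: "0 < \<epsilon>" "\<epsilon> < 1"
  obtains R \<rho> where "R > 0" "\<rho> > 0" "ball (snd c x) R \<subseteq> snd c ` fst c"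
    "\<And>u v. u \<in> ball (snd c x) R \<Longrightarrow> v \<in> ball (snd c x) R \<Longrightarrow>
       (1 - \<epsilon>) * gnorm c x (v - u) \<le> dM (chart_inv c u) (chart_inv c v)"
    "\<And>u v. u \<in> ball (snd c x) R \<Longrightarrow> v \<in> ball (snd c x) R \<Longrightarrow>
       dM (chart_inv c u) (chart_inv c v) \<le> (1 + \<epsilon>) * gnorm c x (v - u)"
    "\<And>y. dM x y < \<rho> \<Longrightarrow> y \<in> fst c \<and> snd c y \<in> ball (snd c x) R"
proof -
  obtain R \<rho> where R: "R > 0" "\<rho> > 0" "ball (snd c x) R \<subseteq> snd c ` fst c"
    "\<And>u v. u \<in> ball (snd c x) R \<Longrightarrow> v \<in> ball (snd c x) R \<Longrightarrow>
       (1 - \<epsilon>) * gnorm c x (v - u) \<le> dM (chart_inv c u) (chart_inv c v)"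
    "\<And>u v. u \<in> ball (snd c x) R \<Longrightarrow> v \<in> ball (snd c x) R \<Longrightarrow>
       dM (chart_inv c u) (chart_inv c v) \<le> (1 + \<epsilon>) * gnorm c x (v - u)"
    "\<And>\<gamma>. piecewise_C1_curve A \<gamma> \<Longrightarrow> pathstart \<gamma> = x \<Longrightarrow> pathfinish \<gamma> \<notin> chart_inv c ` ball (snd c x) R \<Longrightarrow>
       \<rho> \<le> curve_length A g \<gamma>"
    using dist_near_point[OF c \<epsilon>] by blast
  have "y \<in> fst c \<and> snd c y \<in> ball (snd c x) R" if "dM x y < \<rho>" for y
  proof -
    have "y \<in> chart_inv c ` ball (snd c x) R"
      using R(6) dist_less_curve[OF that] by (metis not_le)
    then show ?thesis unfolding chart_ball_eq[OF c(1) R(3)] by blast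
  qed
  with R show ?thesis using that by blast
qed

lemma dist_pos:
  assumes "x \<noteq> y" shows "0 < dM x y"
proof -
  obtain c where c: "c \<in> A" "x \<in> fst c" using ex_chart by blast
  obtain R \<rho> where R: "R > 0" "\<rho> > 0"
    "\<And>u v. u \<in> ball (snd c x) R \<Longrightarrow> v \<in> ball (snd c x) R \<Longrightarrow>
       (1 - 1/2) * gnorm c x (v - u) \<le> dM (chart_inv c u) (chart_inv c v)"
    "\<And>y. dM x y < \<rho> \<Longrightarrow> y \<in> fst c \<and> snd c y \<in> ball (snd c x) R"
    by (rule dist_chart_comparison[OF c, of "1/2"]) auto
  show ?thesis
  proof (cases "dM x y < \<rho>")
    case True
    then have y: "y \<in> fst c" "snd c y \<in> ball (snd c x) R" using R(4) by auto
    have "snd c y \<noteq> snd c x" using assms chart_inv_left[OF c] chart_inv_left[OF c(1) y(1)] by metis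
    then have "0 < gnorm c x (snd c y - snd c x)" using gc_pos[OF c] by simp
    then have "0 < (1 - 1/2) * gnorm c x (snd c y - snd c x)" by simp
    also have "\<dots> \<le> dM (chart_inv c (snd c x)) (chart_inv c (snd c y))" using R(3)[OF _ y(2)] R(1) by simp
    finally show ?thesis using chart_inv_left[OF c] chart_inv_left[OF c(1) y(1)] by simp
  next
    case False
    then show ?thesis using R(2) by linarith
  qed
qed

text \<open>In a chart, the distance is bounded from above and from below by multiples of the norm.\<close>

lemma open_iff_dist: "open U \<longleftrightarrow> (\<forall>x\<in>U. \<exists>e>0. \<forall>y. dM x y < e \<longrightarrow> y \<in> U)"
proof (intro iffI ballI)
  fix x assume U: "open U" "x \<in> U"
  obtain c where c: "c \<in> A" "x \<in> fst c" using ex_chart by blast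
  obtain R \<rho> where R: "R > 0" "\<rho> > 0" "ball (snd c x) R \<subseteq> snd c ` fst c"
    "\<And>u v. u \<in> ball (snd c x) R \<Longrightarrow> v \<in> ball (snd c x) R \<Longrightarrow>
       (1 - 1/2) * gnorm c x (v - u) \<le> dM (chart_inv c u) (chart_inv c v)"
    "\<And>y. dM x y < \<rho> \<Longrightarrow> y \<in> fst c \<and> snd c y \<in> ball (snd c x) R"
    by (rule dist_chart_comparison[OF c, of "1/2"]) auto
  obtain m M where m: "m > 0" "M > 0" "\<And>w. m * norm w \<le> gnorm c x w" "\<And>w. gnorm c x w \<le> M * norm w"
    using gnorm_equiv[OF c] by blast
  have "open (snd c ` fst c \<inter> chart_inv c -` U)"
    by (rule continuous_open_preimage[OF continuous_on_chart_inv[OF c(1)] open_chart_image[OF c(1)] U(1)])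
  moreover have "snd c x \<in> snd c ` fst c \<inter> chart_inv c -` U" using c U(2) chart_inv_left[OF c] by simp
  ultimately obtain R' where R': "R' > 0" "ball (snd c x) R' \<subseteq> snd c ` fst c \<inter> chart_inv c -` U" by (meson openE)
  show "\<exists>e>0. \<forall>y. dM x y < e \<longrightarrow> y \<in> U"
  proof (intro exI[of _ "min \<rho> (m * R' / 2)"] conjI allI impI)
    show "0 < min \<rho> (m * R' / 2)" using R(2) R'(1) m(1) by simp
    fix y assume y: "dM x y < min \<rho> (m * R' / 2)"
    then have yc: "y \<in> fst c" "snd c y \<in> ball (snd c x) R" using R(5) by auto
    have "(1/2) * (m * norm (snd c y - snd c x)) \<le> (1/2) * gnorm c x (snd c y - snd c x)" using m(3) by simp
    also have "\<dots> \<le> dM x y"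
      using R(4)[OF _ yc(2), of "snd c x"] R(1) chart_inv_left[OF c] chart_inv_left[OF c(1) yc(1)] by simp
    also have "\<dots> < (1/2) * (m * R')" using y by simp
    finally have "norm (snd c y - snd c x) < R'" using m(1) by simp
    then have "snd c y \<in> ball (snd c x) R'" by (simp add: dist_norm norm_minus_commute)
    then have "chart_inv c (snd c y) \<in> U" using R'(2) by blast
    then show "y \<in> U" using chart_inv_left[OF c(1) yc(1)] by simp
  qed
next
  assume *: "\<forall>x\<in>U. \<exists>e>0. \<forall>y. dM x y < e \<longrightarrow> y \<in> U"
  show "open U"
    unfolding open_subopen[of U]
  proof
    fix x assume "x \<in> U"
    then obtain e where e: "e > 0" "\<And>y. dM x y < e \<Longrightarrow> y \<in> U" using * by blast
    obtain c where c: "c \<in> A" "x \<in> fst c" using ex_chart by blast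
    obtain R \<rho> where R: "R > 0" "\<rho> > 0" "ball (snd c x) R \<subseteq> snd c ` fst c"
      "\<And>u v. u \<in> ball (snd c x) R \<Longrightarrow> v \<in> ball (snd c x) R \<Longrightarrow>
         (1 - 1/2) * gnorm c x (v - u) \<le> dM (chart_inv c u) (chart_inv c v)"
      "\<And>u v. u \<in> ball (snd c x) R \<Longrightarrow> v \<in> ball (snd c x) R \<Longrightarrow>
         dM (chart_inv c u) (chart_inv c v) \<le> (1 + 1/2) * gnorm c x (v - u)"
      "\<And>y. dM x y < \<rho> \<Longrightarrow> y \<in> fst c \<and> snd c y \<in> ball (snd c x) R"
      by (rule dist_chart_comparison[OF c, of "1/2"]) auto
    obtain m M where m: "m > 0" "M > 0" "\<And>w. m * norm w \<le> gnorm c x w" "\<And>w. gnorm c x w \<le> M * norm w"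
    using gnorm_equiv[OF c] by blast
    define R' where "R' = min R (e / (2 * M))"
    have R': "R' > 0" "R' \<le> R" unfolding R'_def using R(1) e(1) m(2) by auto
    have "2 * M * R' \<le> e" unfolding R'_def using m(2) e(1) by (simp add: min_def field_simps)
    have sub: "ball (snd c x) R' \<subseteq> ball (snd c x) R" using R'(2) by (rule subset_ball)
    show "\<exists>T. open T \<and> x \<in> T \<and> T \<subseteq> U"
    proof (intro exI[of _ "chart_inv c ` ball (snd c x) R'"] conjI)
      show "open (chart_inv c ` ball (snd c x) R')"
        by (rule open_chart_ball[OF c(1)]) (use sub R(3) in blast)
      have "x = chart_inv c (snd c x)" "snd c x \<in> ball (snd c x) R'" using chart_inv_left[OF c] R'(1) by auto
      then show "x \<in> chart_inv c ` ball (snd c x) R'" by blast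
      show "chart_inv c ` ball (snd c x) R' \<subseteq> U"
      proof
        fix y assume "y \<in> chart_inv c ` ball (snd c x) R'"
        then obtain v where v: "v \<in> ball (snd c x) R'" "y = chart_inv c v" by blast
        have vR: "v \<in> ball (snd c x) R" using v(1) sub by blast
        have nv: "norm (v - snd c x) < R'" using v(1) by (simp add: dist_norm norm_minus_commute)
        have "dM x y \<le> (1 + 1/2) * gnorm c x (v - snd c x)"
          using R(5)[OF _ vR, of "snd c x"] R(1) v(2) chart_inv_left[OF c] by simp
        also have "\<dots> \<le> (1 + 1/2) * (M * norm (v - snd c x))" using m(4) by (intro mult_left_mono) auto
        also have "\<dots> \<le> (3/2) * (M * R')" using nv m(2) by simp
        also have "\<dots> < 2 * M * R'" using m(2) R'(1) by simp
        also have "\<dots> \<le> e" by fact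
        finally show "y \<in> U" by (rule e(2))
      qed
    qed
  qed
qed

sublocale topological_distance dM
  by unfold_locales (fact dist_self dist_pos dist_sym dist_triangle open_iff_dist)+

text \<open>Subdivide a nearly shortest curve into arcs that are short by continuity of the arc length.\<close>

lemma dist_chain:
  assumes "dM x y < s" "0 < \<eta>"
  shows "\<exists>m ys. ys 0 = x \<and> ys m = y \<and> (\<forall>j<m. dM (ys j) (ys (Suc j)) < \<eta>) \<and>
    (\<Sum>j<m. dM (ys j) (ys (Suc j))) < s"
proof -
  obtain \<gamma> where \<gamma>: "piecewise_C1_curve A \<gamma>" "pathstart \<gamma> = x" "pathfinish \<gamma> = y" "curve_length A g \<gamma> < s"
    using dist_less_curve[OF assms(1)] by blast
  define F where "F t = integral {0..t} (speed \<gamma>)" for t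
  have "continuous_on {0..1} F"
    unfolding F_def by (rule indefinite_integral_continuous_1[OF speed_integrable[OF \<gamma>(1)]])
  then have "uniformly_continuous_on {0..1} F" using compact_uniformly_continuous compact_Icc by blast
  then obtain \<delta> where \<delta>: "\<delta> > 0" "\<And>a b. a \<in> {0..1} \<Longrightarrow> b \<in> {0..1} \<Longrightarrow> dist b a < \<delta> \<Longrightarrow> dist (F b) (F a) < \<eta>"
    unfolding uniformly_continuous_on_def using assms(2) by metis
  obtain m where m: "m > 0" "inverse (real m) < \<delta>" using ex_inverse_of_nat_less[OF \<delta>(1)] by blast
  define t where "t j = real j / real m" for j
  have t: "t 0 = 0" "t m = 1" "\<And>j. j < m \<Longrightarrow> 0 \<le> t j \<and> t j < t (Suc j) \<and> t (Suc j) \<le> 1 \<and> dist (t (Suc j)) (t j) < \<delta>"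
    unfolding t_def using m by (auto simp: dist_real_def field_simps)
  have step: "dM (\<gamma> (t j)) (\<gamma> (t (Suc j))) \<le> F (t (Suc j)) - F (t j)" if "j < m" for j
  proof -
    have "integral {0..t j} (speed \<gamma>) + integral {t j..t (Suc j)} (speed \<gamma>) = integral {0..t (Suc j)} (speed \<gamma>)"
      by (rule Henstock_Kurzweil_Integration.integral_combine)
        (use t(3)[OF that] in \<open>auto intro: speed_integrable_subinterval[OF \<gamma>(1)]\<close>)
    moreover have "dM (\<gamma> (t j)) (\<gamma> (t (Suc j))) \<le> integral {t j..t (Suc j)} (speed \<gamma>)"
      by (rule dist_along_curve(1)[OF \<gamma>(1)]) (use t(3)[OF that] in auto)
    ultimately show ?thesis unfolding F_def by simp
  qed
  show ?thesis
  proof (intro exI[of _ m] exI[of _ "\<lambda>j. \<gamma> (t j)"] conjI allI impI)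
    show "\<gamma> (t 0) = x" "\<gamma> (t m) = y" using t(1,2) \<gamma>(2,3) by (simp_all add: pathstart_def pathfinish_def)
    show "dM (\<gamma> (t j)) (\<gamma> (t (Suc j))) < \<eta>" if "j < m" for j
    proof -
      have "dist (F (t (Suc j))) (F (t j)) < \<eta>" by (rule \<delta>(2)) (use t(3)[OF that] in auto)
      then show ?thesis using step[OF that] by (simp add: dist_real_def)
    qed
    have "(\<Sum>j<m. dM (\<gamma> (t j)) (\<gamma> (t (Suc j)))) \<le> (\<Sum>j<m. F (t (Suc j)) - F (t j))"
      by (rule sum_mono) (use step in auto)
    also have "\<dots> = F (t m) - F (t 0)" by (rule sum_lessThan_telescope)
    also have "\<dots> = curve_length A g \<gamma>" unfolding t F_def curve_length_eq by simp
    also have "\<dots> < s" by fact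
    finally show "(\<Sum>j<m. dM (\<gamma> (t j)) (\<gamma> (t (Suc j)))) < s" .
  qed
qed

text \<open>Contract a coordinate ball along coordinate segments.\<close>

lemma local_contraction:
  "\<exists>\<rho>>0. \<forall>z. dM x z < \<rho> \<longrightarrow> (\<exists>h C. ball_contraction dM x \<rho> z h C)"
proof -
  obtain c where c: "c \<in> A" "x \<in> fst c" using ex_chart by blast
  obtain R \<rho> where R: "R > 0" "\<rho> > 0" "ball (snd c x) R \<subseteq> snd c ` fst c"
    "\<And>u v. u \<in> ball (snd c x) R \<Longrightarrow> v \<in> ball (snd c x) R \<Longrightarrow>
       (1 - 1/2) * gnorm c x (v - u) \<le> dM (chart_inv c u) (chart_inv c v)"
    "\<And>u v. u \<in> ball (snd c x) R \<Longrightarrow> v \<in> ball (snd c x) R \<Longrightarrow>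
       dM (chart_inv c u) (chart_inv c v) \<le> (1 + 1/2) * gnorm c x (v - u)"
    "\<And>y. dM x y < \<rho> \<Longrightarrow> y \<in> fst c \<and> snd c y \<in> ball (snd c x) R"
    by (rule dist_chart_comparison[OF c, of "1/2"]) auto
  obtain m M where m: "m > 0" "M > 0" "\<And>w. m * norm w \<le> gnorm c x w" "\<And>w. gnorm c x w \<le> M * norm w"
    using gnorm_equiv[OF c] by blast
  define C where "C = (1 + 1/2) * M * (2 * R + 2 / m)"
  have "\<exists>h C. ball_contraction dM x \<rho> z h C" if z: "dM x z < \<rho>" for z
  proof -
    define h where "h s w = chart_inv c (snd c z + s *\<^sub>R (snd c w - snd c z))" for s w
    have z': "z \<in> fst c" "snd c z \<in> ball (snd c x) R" using R(6)[OF z] by auto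
    have "dM (h s w) (h s' w') \<le> C * (\<bar>s - s'\<bar> + dM w w')"
      if w: "dM x w < \<rho>" "dM x w' < \<rho>" and s: "s \<in> {0..1}" "s' \<in> {0..1}" for w w' s s'
    proof -
      have w': "w \<in> fst c" "snd c w \<in> ball (snd c x) R" "w' \<in> fst c" "snd c w' \<in> ball (snd c x) R"
        using R(6)[OF w(1)] R(6)[OF w(2)] by auto
      let ?u = "snd c z + s *\<^sub>R (snd c w - snd c z)" and ?v = "snd c z + s' *\<^sub>R (snd c w' - snd c z)"
      have uv: "?u \<in> ball (snd c x) R" "?v \<in> ball (snd c x) R"
        using segment_in_ball[OF z'(2) w'(2) s(1)] segment_in_ball[OF z'(2) w'(4) s(2)] by auto
      have "?v - ?u = (s' - s) *\<^sub>R (snd c w - snd c z) + s' *\<^sub>R (snd c w' - snd c w)" by (simp add: algebra_simps)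
      then have "norm (?v - ?u) \<le> \<bar>s' - s\<bar> * norm (snd c w - snd c z) + \<bar>s'\<bar> * norm (snd c w' - snd c w)"
        by (metis norm_scaleR norm_triangle_ineq)
      also have "\<dots> \<le> \<bar>s' - s\<bar> * (2 * R) + 1 * norm (snd c w' - snd c w)"
      proof (intro add_mono mult_mono)
        show "norm (snd c w - snd c z) \<le> 2 * R"
          using w'(2) z'(2) norm_triangle_ineq4[of "snd c w - snd c x" "snd c z - snd c x"]
          by (auto simp: dist_norm norm_minus_commute)
      qed (use s R(1) in auto)
      also have "norm (snd c w' - snd c w) \<le> (2 / m) * dM w w'"
      proof -
        have "(1 - 1/2) * (m * norm (snd c w' - snd c w)) \<le> (1 - 1/2) * gnorm c x (snd c w' - snd c w)"
          using m(3) by simp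
        also have "\<dots> \<le> dM w w'"
          using R(4)[OF w'(2,4)] chart_inv_left[OF c(1) w'(1)] chart_inv_left[OF c(1) w'(3)] by simp
        finally show ?thesis using m(1) by (simp add: field_simps)
      qed
      also have "\<bar>s' - s\<bar> * (2 * R) + 1 * ((2 / m) * dM w w') \<le> (2 * R + 2 / m) * (\<bar>s - s'\<bar> + dM w w')"
      proof -
        have "0 \<le> (2 / m) * \<bar>s - s'\<bar>" "0 \<le> 2 * R * dM w w'" using m(1) R(1) dist_nonneg[of w w'] by auto
        moreover have "\<bar>s' - s\<bar> = \<bar>s - s'\<bar>" by simp
        ultimately show ?thesis by (simp add: algebra_simps)
      qed
      finally have "norm (?v - ?u) \<le> (2 * R + 2 / m) * (\<bar>s - s'\<bar> + dM w w')" by simp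
      then have "(1 + 1/2) * (M * norm (?v - ?u)) \<le> (1 + 1/2) * (M * ((2 * R + 2 / m) * (\<bar>s - s'\<bar> + dM w w')))"
        using m(2) by (intro mult_left_mono) auto
      moreover have "dM (h s w) (h s' w') \<le> (1 + 1/2) * gnorm c x (?v - ?u)"
        unfolding h_def by (rule R(5)[OF uv])
      moreover have "\<dots> \<le> (1 + 1/2) * (M * norm (?v - ?u))" using m(4) by (intro mult_left_mono) auto
      ultimately show ?thesis unfolding C_def by (simp add: mult.assoc)
    qed
    note lip = this
    have ends: "h 0 w = z" "h 1 w = w" if "dM x w < \<rho>" for w
      unfolding h_def using R(6)[OF that] chart_inv_left[OF c(1)] z'(1) by auto
    have fix_z: "h s z = z" for s
      unfolding h_def using chart_inv_left[OF c(1) z'(1)] by simp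
    show ?thesis
      unfolding ball_contraction_def
      by (intro exI[of _ h] exI[of _ C] allI impI conjI ballI ends fix_z lip)
  qed
  then show ?thesis using R(2) by blast
qed

end

section \<open>Solving equations near a point with invertible derivative\<close>

text \<open>The derivative is close to the derivative at \<open>p\<close> uniformly in all directions, since this holds for
  the finitely many directions of a basis. The mean value inequality concludes.\<close>

lemma Ck_on_1_strict_derivative:
  fixes F :: "'e::real_inner \<Rightarrow> 'f::real_normed_vector"
  assumes fd: "finite B" "span B = (UNIV :: 'e set)"
    and O: "open X" "p \<in> X" "Ck_on 1 F X" and \<epsilon>: "0 < \<epsilon>"
  obtains r where "r > 0" "ball p r \<subseteq> X"
    "\<And>u v. u \<in> ball p r \<Longrightarrow> v \<in> ball p r \<Longrightarrow>
       norm (F v - F u - frechet_derivative F (at p) (v - u)) \<le> \<epsilon> * norm (v - u)"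
proof -
  obtain C where C: "finite C" "\<And>b. b \<in> C \<Longrightarrow> norm b = (1::real)" "pairwise orthogonal C"
    "\<And>w. (\<Sum>b\<in>C. (w \<bullet> b) *\<^sub>R b) = (w::'e)"
    using finite_orthonormal_basis[OF fd] by blast
  define D where "D u = frechet_derivative F (at u)" for u
  have "Ck_on (Suc 0) F X" using O(3) by simp
  then have diff: "\<And>u. u \<in> X \<Longrightarrow> F differentiable (at u)" and cont: "\<And>w. continuous_on X (\<lambda>u. D u w)"
    unfolding D_def by simp_all
  have D: "(F has_derivative D u) (at u)" if "u \<in> X" for u
    using diff[OF that] unfolding D_def by (simp add: frechet_derivative_works)
  define \<eta> where "\<eta> = \<epsilon> / (real (card C) + 1)"
  have \<eta>: "\<eta> > 0" unfolding \<eta>_def using \<epsilon> by (intro divide_pos_pos) auto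
  have "\<forall>\<^sub>F u in nhds p. norm (D u b - D p b) < \<eta>" for b
  proof -
    have "continuous (at p) (\<lambda>u. D u b)"
      using cont[of b] O(2) unfolding continuous_on_eq_continuous_at[OF O(1)] by blast
    then have "((\<lambda>u. D u b) \<longlongrightarrow> D p b) (nhds p)"
      using tendsto_at_iff_tendsto_nhds[of "\<lambda>u. D u b" p] unfolding continuous_at by simp
    from tendstoD[OF this \<eta>] show ?thesis by (simp add: dist_norm)
  qed
  then have "\<forall>\<^sub>F u in nhds p. \<forall>b\<in>C. norm (D u b - D p b) < \<eta>" using C(1) by (intro eventually_ball_finite) auto
  moreover have "\<forall>\<^sub>F u in nhds p. u \<in> X" by (rule eventually_nhds_in_open[OF O(1,2)])
  ultimately have "\<forall>\<^sub>F u in nhds p. (\<forall>b\<in>C. norm (D u b - D p b) < \<eta>) \<and> u \<in> X" by (rule eventually_conj)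
  then obtain r where r: "r > 0" "\<And>u. dist u p < r \<Longrightarrow> (\<forall>b\<in>C. norm (D u b - D p b) < \<eta>) \<and> u \<in> X"
    unfolding eventually_nhds_metric by blast
  have bl: "bounded_linear (D p)" using D[OF O(2)] by (rule has_derivative_bounded_linear)
  have bound: "norm (D u h - D p h) \<le> \<epsilon> * norm h" if "u \<in> ball p r" for u h
  proof -
    have u: "u \<in> X" "\<forall>b\<in>C. norm (D u b - D p b) < \<eta>" using r(2)[of u] that by (auto simp: dist_commute)
    have lin: "linear (\<lambda>h. D u h - D p h)"
      by (intro linear_compose_sub has_derivative_linear[OF D] u(1) O(2))
    have "D u h - D p h = (\<Sum>b\<in>C. (h \<bullet> b) *\<^sub>R (D u b - D p b))"
    proof -
      have "D u h - D p h = (\<lambda>h. D u h - D p h) (\<Sum>b\<in>C. (h \<bullet> b) *\<^sub>R b)" by (simp add: C(4))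
      also have "\<dots> = (\<Sum>b\<in>C. (\<lambda>h. D u h - D p h) ((h \<bullet> b) *\<^sub>R b))" by (rule linear_sum[OF lin])
      also have "\<dots> = (\<Sum>b\<in>C. (h \<bullet> b) *\<^sub>R (D u b - D p b))"
        by (rule sum.cong[OF refl]) (rule linear_scale[OF lin])
      finally show ?thesis .
    qed
    also have "norm \<dots> \<le> (\<Sum>b\<in>C. norm h * \<eta>)"
    proof (rule order_trans[OF norm_sum], rule sum_mono)
      fix b assume b: "b \<in> C"
      have "\<bar>h \<bullet> b\<bar> \<le> norm h" using Cauchy_Schwarz_ineq2[of h b] C(2)[OF b] by simp
      moreover have "norm (D u b - D p b) \<le> \<eta>" using u(2) b by fastforce
      ultimately show "norm ((h \<bullet> b) *\<^sub>R (D u b - D p b)) \<le> norm h * \<eta>" by (simp add: mult_mono)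
    qed
    also have "\<dots> = (real (card C) * \<eta>) * norm h" by simp
    also have "\<dots> \<le> \<epsilon> * norm h"
    proof (rule mult_right_mono)
      have "real (card C) * \<eta> \<le> (real (card C) + 1) * \<eta>" using \<eta> by simp
      also have "\<dots> = \<epsilon>" unfolding \<eta>_def by (simp add: add_pos_nonneg)
      finally show "real (card C) * \<eta> \<le> \<epsilon>" .
    qed simp
    finally show ?thesis .
  qed
  show ?thesis
  proof (rule that[OF r(1)])
    show "ball p r \<subseteq> X" using r(2) by (auto simp: dist_commute)
    fix u v assume uv: "u \<in> ball p r" "v \<in> ball p r"
    have "norm ((F v - D p v) - (F u - D p u)) \<le> \<epsilon> * norm (v - u)"
    proof (rule differentiable_bound[OF convex_ball _ _ uv(2,1)])
      fix u assume u: "u \<in> ball p r"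
      then have "u \<in> X" using r(2)[of u] by (simp add: dist_commute)
      then show "((\<lambda>v. F v - D p v) has_derivative (\<lambda>h. D u h - D p h)) (at u within ball p r)"
        by (intro has_derivative_diff has_derivative_at_withinI[OF D] bounded_linear_imp_has_derivative[OF bl])
      show "onorm (\<lambda>h. D u h - D p h) \<le> \<epsilon>" by (rule onorm_bound) (use \<epsilon> bound[OF u] in auto)
    qed
    moreover have "D p v - D p u = D p (v - u)"
      using linear_diff[OF has_derivative_linear[OF D[OF O(2)]]] by simp
    ultimately show "norm (F v - F u - frechet_derivative F (at p) (v - u)) \<le> \<epsilon> * norm (v - u)"
      unfolding D_def by (simp add: algebra_simps)
  qed
qed

text \<open>A Newton iteration with fixed derivative, that is, a contraction.\<close>

lemma solve_near_linear:
  fixes F L K :: "'e::real_inner \<Rightarrow> 'e"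
  assumes fd: "finite B" "span B = (UNIV :: 'e set)"
    and L: "linear L" "linear K" "\<And>w. K (L w) = w" "\<And>w. L (K w) = w" "\<And>w. norm (K w) \<le> \<kappa> * norm w"
    and near: "\<And>u v. u \<in> ball p r \<Longrightarrow> v \<in> ball p r \<Longrightarrow> norm (F v - F u - L (v - u)) \<le> \<epsilon> * norm (v - u)"
    and k: "0 \<le> \<kappa>" "\<kappa> * \<epsilon> \<le> 1/2"
    and \<rho>: "cball u1 \<rho> \<subseteq> ball p r" "0 \<le> \<rho>" "\<kappa> * norm (y - F u1) \<le> \<rho> / 2"
  shows "\<exists>u\<in>cball u1 \<rho>. F u = y"
proof -
  define T where "T u = u + K (y - F u)" for u
  have T: "norm (T v - T u) \<le> (1/2) * norm (v - u)" if "u \<in> cball u1 \<rho>" "v \<in> cball u1 \<rho>" for u v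
  proof -
    have uv: "u \<in> ball p r" "v \<in> ball p r" using that \<rho>(1) by auto
    have "K (y - F v) - K (y - F u) = K ((y - F v) - (y - F u))" using linear_diff[OF L(2)] by simp
    also have "(y - F v) - (y - F u) = - (F v - F u)" by simp
    also have "K (- (F v - F u)) = - K (F v - F u)" by (rule linear_neg[OF L(2)])
    finally have "T v - T u = K (L (v - u)) - K (F v - F u)"
      unfolding T_def L(3) by (simp add: algebra_simps)
    also have "\<dots> = K (L (v - u) - (F v - F u))" using linear_diff[OF L(2)] by simp
    finally have "norm (T v - T u) \<le> \<kappa> * norm (L (v - u) - (F v - F u))" using L(5) by simp
    also have "\<dots> \<le> \<kappa> * (\<epsilon> * norm (v - u))"
      using near[OF uv] k(1) by (intro mult_left_mono) (simp_all add: norm_minus_commute)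
    also have "\<dots> = (\<kappa> * \<epsilon>) * norm (v - u)" by simp
    also have "\<dots> \<le> (1/2) * norm (v - u)" using k(2) by (rule mult_right_mono) simp
    finally show ?thesis .
  qed
  have u1: "u1 \<in> cball u1 \<rho>" using \<rho>(2) by simp
  have "\<exists>!u. u \<in> cball u1 \<rho> \<and> T u = u"
  proof (rule Banach_fix)
    show "complete (cball u1 \<rho>)" by (rule complete_finite_span[OF fd])
    show "cball u1 \<rho> \<noteq> {}" using u1 by blast
    show "0 \<le> (1/2::real)" "(1/2::real) < 1" by simp_all
    show "T ` cball u1 \<rho> \<subseteq> cball u1 \<rho>"
    proof
      fix v assume "v \<in> T ` cball u1 \<rho>"
      then obtain u where u: "u \<in> cball u1 \<rho>" "v = T u" by blast
      have "norm (T u - u1) \<le> norm (T u - T u1) + norm (T u1 - u1)" using norm_triangle_ineq[of "T u - T u1" "T u1 - u1"] by simp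
      also have "\<dots> \<le> (1/2) * norm (u - u1) + \<kappa> * norm (y - F u1)"
        using T[OF u1 u(1)] L(5)[of "y - F u1"] unfolding T_def by (intro add_mono) simp_all
      also have "\<dots> \<le> \<rho>" using u(1) \<rho>(3) by (simp add: dist_norm norm_minus_commute)
      finally show "v \<in> cball u1 \<rho>" using u(2) by (simp add: dist_norm norm_minus_commute)
    qed
    show "dist (T u) (T v) \<le> (1/2) * dist u v" if "u \<in> cball u1 \<rho>" "v \<in> cball u1 \<rho>" for u v
      using T[of v u] that by (simp add: dist_norm)
  qed
  then obtain u where u: "u \<in> cball u1 \<rho>" "T u = u" by blast
  then have "K (y - F u) = 0" unfolding T_def by simp
  then have "y - F u = L 0" using L(4) by metis
  then have "F u = y" using linear_0[OF L(1)] by simp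
  then show ?thesis using u(1) by blast
qed

context connected_riemannian
begin

section \<open>Expanding maps\<close>

lemma chart_image_open:
  assumes "c \<in> A" "open V"
  shows "open (snd c ` (fst c \<inter> V))"
proof -
  have "snd c ` (fst c \<inter> V) = snd c ` fst c \<inter> chart_inv c -` V"
    using chart_inv_left[OF assms(1)] by auto
  then show ?thesis
    using continuous_open_preimage[OF continuous_on_chart_inv[OF assms(1)] open_chart_image[OF assms(1)] assms(2)] by simp
qed

lemma derivative_change_of_chart:
  fixes f :: "'x::topological_space \<Rightarrow> 'a" and \<phi> :: "'y::real_normed_vector \<Rightarrow> 'x"
  assumes c: "c' \<in> A" "c'' \<in> A" "f (\<phi> p) \<in> fst c'" "f (\<phi> p) \<in> fst c''"
    and X: "open X" "p \<in> X" "\<And>u. u \<in> X \<Longrightarrow> f (\<phi> u) \<in> fst c'"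
    and diff: "(snd c' \<circ> f \<circ> \<phi>) differentiable (at p)"
  shows "frechet_derivative (snd c'' \<circ> f \<circ> \<phi>) (at p) w =
    frechet_derivative (snd c'' \<circ> chart_inv c') (at (snd c' (f (\<phi> p)))) (frechet_derivative (snd c' \<circ> f \<circ> \<phi>) (at p) w)"
proof -
  have 1: "(snd c' \<circ> f \<circ> \<phi> has_derivative frechet_derivative (snd c' \<circ> f \<circ> \<phi>) (at p)) (at p)"
    using diff by (simp add: frechet_derivative_works)
  have 2: "(snd c'' \<circ> chart_inv c' has_derivative
      frechet_derivative (snd c'' \<circ> chart_inv c') (at (snd c' (f (\<phi> p))))) (at ((snd c' \<circ> f \<circ> \<phi>) p))"
    using transition_has_derivative[OF c] by simp
  from diff_chain_at[OF 1 2]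
  have "(snd c'' \<circ> f \<circ> \<phi> has_derivative
      frechet_derivative (snd c'' \<circ> chart_inv c') (at (snd c' (f (\<phi> p)))) \<circ> frechet_derivative (snd c' \<circ> f \<circ> \<phi>) (at p)) (at p)"
    by (rule has_derivative_transform_within_open[OF _ X(1,2)]) (simp add: chart_inv_left[OF c(1) X(3)])
  from frechet_derivative_at[OF this] show ?thesis by (metis comp_apply)
qed

lemma coord_vector_in_tangent_space:
  assumes c: "c \<in> A" "x \<in> fst c"
  shows "coord_vector A c x w \<in> tangent_space A x"
  unfolding tangent_space_def
proof (intro CollectI conjI ballI allI impI)
  show "coord_vector A c x w c' = 0" if "\<not> (c' \<in> A \<and> x \<in> fst c')" for c'
    using that by (auto simp: coord_vector_def)
  fix c1 c2 assume c12: "c1 \<in> A" "c2 \<in> A" "x \<in> fst c1" "x \<in> fst c2"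
  have x: "chart_inv c (snd c x) = x" using chart_inv_left[OF c] .
  have "frechet_derivative (snd c2 \<circ> id \<circ> chart_inv c) (at (snd c x)) w =
      frechet_derivative (snd c2 \<circ> chart_inv c1) (at (snd c1 (id (chart_inv c (snd c x)))))
        (frechet_derivative (snd c1 \<circ> id \<circ> chart_inv c) (at (snd c x)) w)"
  proof (rule derivative_change_of_chart[OF c12(1,2)])
    show "open (snd c ` (fst c \<inter> fst c1))" by (rule chart_image_open[OF c(1) open_chart_domain[OF c12(1)]])
    show "snd c x \<in> snd c ` (fst c \<inter> fst c1)" using c(2) c12(3) by blast
    show "id (chart_inv c u) \<in> fst c1" if "u \<in> snd c ` (fst c \<inter> fst c1)" for u
      using that chart_inv_left[OF c(1)] by auto
    show "snd c1 \<circ> id \<circ> chart_inv c differentiable at (snd c x)"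
      using transition_has_derivative[OF c(1) c12(1) c(2) c12(3)] by (auto intro: differentiableI)
  qed (use x c12 in auto)
  then show "coord_vector A c x w c2 =
      frechet_derivative (snd c2 \<circ> chart_inv c1) (at (snd c1 x)) (coord_vector A c x w c1)"
    using c12 x by (simp add: coord_vector_def)
qed

lemma C1_map_facts:
  assumes f: "C1_map A f" and c: "c \<in> A" "c' \<in> A"
  shows "open (snd c ` (fst c \<inter> f -` fst c'))"
    and "Ck_on 1 (snd c' \<circ> f \<circ> chart_inv c) (snd c ` (fst c \<inter> f -` fst c'))"
proof -
  have "continuous_on UNIV f" using f unfolding C1_map_def by blast
  then have "open (f -` fst c')" by (rule open_vimage[OF open_chart_domain[OF c(2)]])
  then show "open (snd c ` (fst c \<inter> f -` fst c'))" by (rule chart_image_open[OF c(1)])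
  show "Ck_on 1 (snd c' \<circ> f \<circ> chart_inv c) (snd c ` (fst c \<inter> f -` fst c'))"
    using f c unfolding C1_map_def by blast
qed

text \<open>The chart at \<open>x\<close> is the one that the definition of the tangent map selects; the chart at \<open>f x\<close> is
  arbitrary.\<close>

lemma expansion_in_charts:
  assumes f: "C1_map A f"
    and exp: "\<And>v. v \<in> tangent_space A x \<Longrightarrow> lam * tnorm g x v \<le> tnorm g (f x) (tangent_map A f x v)"
    and c': "c' \<in> A" "f x \<in> fst c'"
  defines "c \<equiv> SOME c. c \<in> A \<and> x \<in> fst c"
  shows "lam * gnorm c x w \<le> gnorm c' (f x) (frechet_derivative (snd c' \<circ> f \<circ> chart_inv c) (at (snd c x)) w)"
proof -
  have "c \<in> A \<and> x \<in> fst c" unfolding c_def by (rule someI_ex) (use ex_chart in blast)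
  then have c: "c \<in> A" "x \<in> fst c" by auto
  have x: "chart_inv c (snd c x) = x" using chart_inv_left[OF c] .
  let ?F = "snd c' \<circ> f \<circ> chart_inv c"
  have "Ck_on (Suc 0) ?F (snd c ` (fst c \<inter> f -` fst c'))" using C1_map_facts(2)[OF f c(1) c'(1)] by simp
  moreover have mem: "snd c x \<in> snd c ` (fst c \<inter> f -` fst c')" using c(2) c'(2) by blast
  ultimately have diff: "?F differentiable (at (snd c x))" unfolding Ck_on.simps by blast
  have "tangent_map A f x (coord_vector A c x w) = coord_vector A c' (f x) (frechet_derivative ?F (at (snd c x)) w)"
  proof
    fix c''
    show "tangent_map A f x (coord_vector A c x w) c'' = coord_vector A c' (f x) (frechet_derivative ?F (at (snd c x)) w) c''"
    proof (cases "c'' \<in> A \<and> f x \<in> fst c''")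
      case True
      have "frechet_derivative (snd c'' \<circ> f \<circ> chart_inv c) (at (snd c x)) w =
          frechet_derivative (snd c'' \<circ> chart_inv c') (at (snd c' (f (chart_inv c (snd c x)))))
            (frechet_derivative ?F (at (snd c x)) w)"
      proof (rule derivative_change_of_chart[OF c'(1) _ _ _ C1_map_facts(1)[OF f c(1) c'(1)] mem _ diff])
        show "f (chart_inv c u) \<in> fst c'" if "u \<in> snd c ` (fst c \<inter> f -` fst c')" for u
          using that chart_inv_left[OF c(1)] by auto
      qed (use True c' x in auto)
      then show ?thesis
        using True coord_vector_own_chart[OF c] x
        unfolding tangent_map_def Let_def c_def[symmetric] by (simp add: coord_vector_def)
    next
      case False
      then show ?thesis unfolding tangent_map_def Let_def by (auto simp: coord_vector_def)
    qed
  qed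
  then show ?thesis
    using exp[OF coord_vector_in_tangent_space[OF c, of w]] by (simp add: tnorm_def metric_coeff_def)
qed

lemma continuous_dist:
  assumes "continuous_on UNIV f" "0 < e"
  shows "\<exists>\<delta>>0. \<forall>y. dM x y < \<delta> \<longrightarrow> dM (f x) (f y) < e"
proof -
  have "open (f -` {y. dM (f x) y < e})"
    by (rule open_vimage[OF open_d_ball assms(1)])
  moreover have "x \<in> f -` {y. dM (f x) y < e}" using assms(2) dist_self by simp
  ultimately show ?thesis unfolding open_iff_dist by auto
qed

text \<open>Near \<open>x\<close>, the map is almost linear, with an inverse of norm at most \<open>1/lam\<close>, with respect to norms
  that are almost the distances near \<open>x\<close> and \<open>f x\<close>.\<close>

lemma expanding_local_inverse:
  assumes f: "C1_map A f"
    and exp: "\<And>v. v \<in> tangent_space A x \<Longrightarrow> lam * tnorm g x v \<le> tnorm g (f x) (tangent_map A f x v)"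
    and lam: "0 < lam'" "lam' < lam"
  shows "\<exists>\<rho>>0. \<forall>x1. dM x x1 < \<rho> \<longrightarrow>
     (\<forall>y. dM (f x1) y < \<rho> \<longrightarrow> (\<exists>x'. f x' = y \<and> lam' * dM x1 x' \<le> dM (f x1) y)) \<and>
     (\<forall>x2. dM x x2 < \<rho> \<longrightarrow> f x1 = f x2 \<longrightarrow> x1 = x2)"
proof -
  obtain B :: "'e set" where B: "finite B" "span B = UNIV" using finite_dimensional by blast
  define c where "c = (SOME c. c \<in> A \<and> x \<in> fst c)"
  have "c \<in> A \<and> x \<in> fst c" unfolding c_def by (rule someI_ex) (use ex_chart in blast)
  then have c: "c \<in> A" "x \<in> fst c" by auto
  obtain c' where c': "c' \<in> A" "f x \<in> fst c'" using ex_chart by blast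
  define p where "p = snd c x"
  define F where "F = snd c' \<circ> f \<circ> chart_inv c"
  define X where "X = snd c ` (fst c \<inter> f -` fst c')"
  define L where "L = frechet_derivative F (at p)"
  have X: "open X" "p \<in> X" "Ck_on 1 F X"
    unfolding X_def F_def p_def using C1_map_facts[OF f c(1) c'(1)] c(2) c'(2) by auto
  have Xmem: "chart_inv c u \<in> fst c" "f (chart_inv c u) \<in> fst c'" if "u \<in> X" for u
    using that chart_inv_left[OF c(1)] unfolding X_def by auto
  have "F differentiable (at p)" using X(2,3) by simp
  then have linL: "linear L" unfolding L_def by (rule linear_frechet_derivative)
  have expL: "lam * gnorm c x w \<le> gnorm c' (f x) (L w)" for w
    unfolding L_def F_def p_def c_def by (rule expansion_in_charts[OF f exp c'])
  obtain m M where m: "m > 0" "M > 0" "\<And>w. m * norm w \<le> gnorm c x w" "\<And>w. gnorm c x w \<le> M * norm w"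
    using gnorm_equiv[OF c] by blast
  obtain m' M' where m': "m' > 0" "M' > 0" "\<And>w. m' * norm w \<le> gnorm c' (f x) w" "\<And>w. gnorm c' (f x) w \<le> M' * norm w"
    using gnorm_equiv[OF c'] by blast
  have "inj L"
  proof (rule injI)
    fix v w assume "L v = L w"
    then have "L (v - w) = 0" using linear_diff[OF linL] by simp
    then have "lam * gnorm c x (v - w) \<le> 0" using expL[of "v - w"] bilinear_lzero[OF bilinear_gc[OF c'], of 0] by simp
    then have "gnorm c x (v - w) \<le> 0" using lam by (simp add: mult_le_0_iff)
    then show "v = w" using gc_pos[OF c, of "v - w"] by (cases "v - w = 0") auto
  qed
  then have bijL: "bij L" by (rule bij_injective_linear_finite_span[OF B linL])
  define K where "K = inv_into UNIV L"
  have KL: "K (L w) = w" "L (K w) = w" for w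
    unfolding K_def using bijL by (simp_all add: bij_is_inj bij_is_surj surj_f_inv_f inv_f_f)
  have linK: "linear K"
  proof (rule linearI)
    show "K (v + w) = K v + K w" for v w using KL linear_add[OF linL, of "K v" "K w"] by metis
    show "K (t *\<^sub>R w) = t *\<^sub>R K w" for t w using KL linear_scale[OF linL, of t "K w"] by metis
  qed
  obtain \<kappa> where \<kappa>: "\<kappa> > 0" "\<And>w. norm (K w) \<le> \<kappa> * norm w"
    using bounded_linear.pos_bounded[OF bounded_linear_finite_span[OF B linK]] by (auto simp: mult.commute)
  \<comment> \<open>the relative error of the distance and of the derivative that turns \<open>lam\<close> into \<open>lam'\<close>\<close>
  define \<theta> where "\<theta> = (lam - lam') / (lam + 1 + lam')"
  have \<theta>: "0 < \<theta>" "\<theta> < 1" "\<theta> < lam"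
  proof -
    show "0 < \<theta>" unfolding \<theta>_def using lam by (intro divide_pos_pos) auto
    have "\<theta> * (lam + 1 + lam') = lam - lam'" unfolding \<theta>_def using lam by simp
    show "\<theta> < 1" unfolding \<theta>_def using lam by simp
    have "lam - lam' < lam * (lam + 1 + lam')" using lam by (simp add: algebra_simps add_pos_pos)
    then show "\<theta> < lam" unfolding \<theta>_def using lam by (simp add: divide_less_eq)
  qed
  have \<theta>_eq: "lam' * (1 + \<theta>) \<le> (lam - \<theta>) * (1 - \<theta>)"
  proof -
    have "\<theta> * (lam + 1 + lam') = lam - lam'" unfolding \<theta>_def using lam by simp
    moreover have "0 \<le> \<theta> * \<theta>" by simp
    ultimately show ?thesis by (simp add: algebra_simps)
  qed
  define \<epsilon> where "\<epsilon> = min (\<theta> * m / M') (1 / (2 * \<kappa>))"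
  have \<epsilon>: "0 < \<epsilon>" "M' * \<epsilon> \<le> \<theta> * m" "\<kappa> * \<epsilon> \<le> 1/2"
  proof -
    show "0 < \<epsilon>" unfolding \<epsilon>_def using \<theta> m m' \<kappa> by simp
    have "\<epsilon> \<le> \<theta> * m / M'" "\<epsilon> \<le> 1 / (2 * \<kappa>)" unfolding \<epsilon>_def by auto
    then show "M' * \<epsilon> \<le> \<theta> * m" "\<kappa> * \<epsilon> \<le> 1/2" using m'(2) \<kappa>(1) by (simp_all add: field_simps)
  qed
  obtain r where r: "r > 0" "ball p r \<subseteq> X"
    "\<And>u v. u \<in> ball p r \<Longrightarrow> v \<in> ball p r \<Longrightarrow> norm (F v - F u - L (v - u)) \<le> \<epsilon> * norm (v - u)"
    using Ck_on_1_strict_derivative[OF B X \<epsilon>(1)] unfolding L_def by blast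
  obtain R \<rho>1 where R: "R > 0" "\<rho>1 > 0" "ball p R \<subseteq> snd c ` fst c"
    "\<And>u v. u \<in> ball p R \<Longrightarrow> v \<in> ball p R \<Longrightarrow> (1 - \<theta>) * gnorm c x (v - u) \<le> dM (chart_inv c u) (chart_inv c v)"
    "\<And>u v. u \<in> ball p R \<Longrightarrow> v \<in> ball p R \<Longrightarrow> dM (chart_inv c u) (chart_inv c v) \<le> (1 + \<theta>) * gnorm c x (v - u)"
    "\<And>y. dM x y < \<rho>1 \<Longrightarrow> y \<in> fst c \<and> snd c y \<in> ball p R"
    using dist_chart_comparison[OF c \<theta>(1,2)] unfolding p_def by blast
  obtain R' \<rho>2 where R': "R' > 0" "\<rho>2 > 0" "ball (snd c' (f x)) R' \<subseteq> snd c' ` fst c'"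
    "\<And>u v. u \<in> ball (snd c' (f x)) R' \<Longrightarrow> v \<in> ball (snd c' (f x)) R' \<Longrightarrow> (1 - \<theta>) * gnorm c' (f x) (v - u) \<le> dM (chart_inv c' u) (chart_inv c' v)"
    "\<And>u v. u \<in> ball (snd c' (f x)) R' \<Longrightarrow> v \<in> ball (snd c' (f x)) R' \<Longrightarrow> dM (chart_inv c' u) (chart_inv c' v) \<le> (1 + \<theta>) * gnorm c' (f x) (v - u)"
    "\<And>y. dM (f x) y < \<rho>2 \<Longrightarrow> y \<in> fst c' \<and> snd c' y \<in> ball (snd c' (f x)) R'"
    using dist_chart_comparison[OF c' \<theta>(1,2)] by blast
  have "continuous_on UNIV f" using f unfolding C1_map_def by blast
  then obtain \<rho>3 where \<rho>3: "\<rho>3 > 0" "\<And>y. dM x y < \<rho>3 \<Longrightarrow> dM (f x) (f y) < \<rho>2 / 2"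
    using continuous_dist[of f "\<rho>2 / 2" x] R'(2) by auto
  define r0 where "r0 = min r R"
  have r0: "r0 > 0" "ball p r0 \<subseteq> ball p r" "ball p r0 \<subseteq> ball p R" unfolding r0_def using r(1) R(1) by auto
  define \<rho> where "\<rho> = Min {\<rho>1, \<rho>2 / 2, \<rho>3, (1 - \<theta>) * m * (r0 / 4), (1 - \<theta>) * m' * (r0 / (8 * \<kappa>))}"
  have \<rho>: "\<rho> > 0" "\<rho> \<le> \<rho>1" "\<rho> \<le> \<rho>2 / 2" "\<rho> \<le> \<rho>3" "\<rho> \<le> (1 - \<theta>) * m * (r0 / 4)" "\<rho> \<le> (1 - \<theta>) * m' * (r0 / (8 * \<kappa>))"
  proof -
    have "0 < (1 - \<theta>) * m * (r0 / 4)" "0 < (1 - \<theta>) * m' * (r0 / (8 * \<kappa>))"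
      using \<theta>(2) m(1) m'(1) r0(1) \<kappa>(1) by simp_all
    then show "\<rho> > 0" unfolding \<rho>_def using R(2) R'(2) \<rho>3(1) by (subst Min_gr_iff) auto
  qed (unfold \<rho>_def, (rule Min_le; simp)+)
  have close: "x1 \<in> fst c" "norm (snd c x1 - p) < r0 / 4" "snd c x1 \<in> ball p r0" if x1: "dM x x1 < \<rho>" for x1
  proof -
    show x1c: "x1 \<in> fst c" using R(6)[of x1] x1 \<rho>(2) by auto
    have "snd c x1 \<in> ball p R" using R(6)[of x1] x1 \<rho>(2) by auto
    then have "(1 - \<theta>) * gnorm c x (snd c x1 - p) \<le> dM x x1"
      using R(4)[of p "snd c x1"] R(1) chart_inv_left[OF c] chart_inv_left[OF c(1) x1c] unfolding p_def by simp
    moreover have "(1 - \<theta>) * (m * norm (snd c x1 - p)) \<le> (1 - \<theta>) * gnorm c x (snd c x1 - p)"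
      using m(3) \<theta>(2) by (intro mult_left_mono) auto
    ultimately have "((1 - \<theta>) * m) * norm (snd c x1 - p) < ((1 - \<theta>) * m) * (r0 / 4)" using x1 \<rho>(5) by simp
    then show "norm (snd c x1 - p) < r0 / 4" using \<theta>(2) m(1) by simp
    then show "snd c x1 \<in> ball p r0" using r0(1) by (simp add: dist_norm norm_minus_commute)
  qed
  have contr: "(lam - \<theta>) * gnorm c x (v - u) \<le> gnorm c' (f x) (F v - F u)" if uv: "u \<in> ball p r0" "v \<in> ball p r0" for u v
  proof -
    let ?e = "L (v - u) - (F v - F u)"
    have "norm (F v - F u - L (v - u)) \<le> \<epsilon> * norm (v - u)"
      by (rule r(3)) (use uv r0(2) in blast)+
    then have "norm ?e \<le> \<epsilon> * norm (v - u)" by (simp only: norm_minus_commute)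
    then have "gnorm c' (f x) ?e \<le> M' * (\<epsilon> * norm (v - u))" using m'(2,4) by (meson mult_left_mono less_imp_le order_trans)
    also have "\<dots> = (M' * \<epsilon>) * norm (v - u)" by simp
    also have "\<dots> \<le> (\<theta> * m) * norm (v - u)" using \<epsilon>(2) by (rule mult_right_mono) simp
    also have "\<dots> \<le> \<theta> * gnorm c x (v - u)" using m(3)[of "v - u"] \<theta>(1) by simp
    finally have e: "gnorm c' (f x) ?e \<le> \<theta> * gnorm c x (v - u)" .
    have "lam * gnorm c x (v - u) \<le> gnorm c' (f x) ((F v - F u) + ?e)" using expL[of "v - u"] by simp
    also have "\<dots> \<le> gnorm c' (f x) (F v - F u) + gnorm c' (f x) ?e"
      by (rule posdef_triangle[OF bilinear_gc[OF c'] gc_sym[OF c'] gc_pos[OF c']])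
    finally show ?thesis using e by (simp add: algebra_simps)
  qed
  have Fval: "F (snd c x1) = snd c' (f x1)" if "x1 \<in> fst c" for x1
    unfolding F_def using chart_inv_left[OF c(1) that] by simp
  have solve: "\<exists>x'. f x' = y \<and> lam' * dM x1 x' \<le> dM (f x1) y" if x1: "dM x x1 < \<rho>" and y: "dM (f x1) y < \<rho>" for x1 y
  proof -
    let ?u1 = "snd c x1" and ?v = "snd c' y"
    have fx1: "dM (f x) (f x1) < \<rho>2 / 2" using \<rho>3(2)[of x1] x1 \<rho>(4) by simp
    then have "dM (f x) y < \<rho>2" using y \<rho>(3) dist_triangle[of "f x" y "f x1"] by simp
    then have yc: "y \<in> fst c'" "?v \<in> ball (snd c' (f x)) R'" using R'(6) by auto
    have fx1c: "f x1 \<in> fst c'" "snd c' (f x1) \<in> ball (snd c' (f x)) R'" using R'(6)[of "f x1"] fx1 R'(2) by auto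
    have dy: "(1 - \<theta>) * gnorm c' (f x) (?v - F ?u1) \<le> dM (f x1) y"
      using R'(4)[OF fx1c(2) yc(2)] chart_inv_left[OF c'(1) yc(1)] chart_inv_left[OF c'(1) fx1c(1)] Fval[OF close(1)[OF x1]] by simp
    have "(1 - \<theta>) * (m' * norm (?v - F ?u1)) \<le> (1 - \<theta>) * gnorm c' (f x) (?v - F ?u1)"
      using m'(3) \<theta>(2) by (intro mult_left_mono) auto
    then have "((1 - \<theta>) * m') * norm (?v - F ?u1) \<le> ((1 - \<theta>) * m') * (r0 / (8 * \<kappa>))" using dy y \<rho>(6) by simp
    moreover have "0 < (1 - \<theta>) * m'" using \<theta>(2) m'(1) by simp
    ultimately have "norm (?v - F ?u1) \<le> r0 / (8 * \<kappa>)" by (rule mult_left_le_imp_le)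
    then have small: "\<kappa> * norm (?v - F ?u1) \<le> (r0 / 4) / 2" using \<kappa>(1) by (simp add: field_simps)
    have sub: "cball ?u1 (r0 / 4) \<subseteq> ball p r0"
    proof
      fix u assume "u \<in> cball ?u1 (r0 / 4)"
      then have "norm (u - ?u1) \<le> r0 / 4" by (simp add: dist_norm norm_minus_commute)
      then have "norm (u - p) < r0" using close(2)[OF x1] norm_triangle_ineq[of "u - ?u1" "?u1 - p"] r0(1) by simp
      then show "u \<in> ball p r0" by (simp add: dist_norm norm_minus_commute)
    qed
    have "\<exists>u\<in>cball ?u1 (r0 / 4). F u = ?v"
      by (rule solve_near_linear[OF B linL linK KL \<kappa>(2) r(3) less_imp_le[OF \<kappa>(1)] \<epsilon>(3) _ _ small])
        (use sub r0 in auto)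
    then obtain u where u: "u \<in> ball p r0" "F u = ?v" using sub by blast
    have uX: "u \<in> X" using u(1) r0(2) r(2) by blast
    have uR: "u \<in> ball p R" "?u1 \<in> ball p R" using u(1) close(3)[OF x1] r0(3) by auto
    have "f (chart_inv c u) = y"
      using u(2) chart_inv_left[OF c'(1) yc(1)] chart_inv_left[OF c'(1) Xmem(2)[OF uX]] unfolding F_def by (metis comp_apply)
    moreover have "lam' * dM x1 (chart_inv c u) \<le> dM (f x1) y"
    proof -
      have "dM x1 (chart_inv c u) \<le> (1 + \<theta>) * gnorm c x (u - ?u1)"
        using R(5)[OF uR(2,1)] chart_inv_left[OF c(1) close(1)[OF x1]] by simp
      then have "lam' * dM x1 (chart_inv c u) \<le> lam' * ((1 + \<theta>) * gnorm c x (u - ?u1))" using lam(1) by simp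
      also have "\<dots> = (lam' * (1 + \<theta>)) * gnorm c x (u - ?u1)" by simp
      also have "\<dots> \<le> ((lam - \<theta>) * (1 - \<theta>)) * gnorm c x (u - ?u1)"
        using \<theta>_eq by (rule mult_right_mono) (simp add: gc_nonneg[OF c])
      also have "\<dots> = (1 - \<theta>) * ((lam - \<theta>) * gnorm c x (u - ?u1))" by simp
      also have "\<dots> \<le> (1 - \<theta>) * gnorm c' (f x) (F u - F ?u1)"
        using contr[OF close(3)[OF x1] u(1)] \<theta>(2) by (intro mult_left_mono) auto
      also have "\<dots> \<le> dM (f x1) y" using dy u(2) by simp
      finally show ?thesis .
    qed
    ultimately show ?thesis by blast
  qed
  have inj: "x1 = x2" if "dM x x1 < \<rho>" "dM x x2 < \<rho>" "f x1 = f x2" for x1 x2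
  proof -
    have "(lam - \<theta>) * gnorm c x (snd c x2 - snd c x1) \<le> 0"
      using contr[OF close(3)[OF that(1)] close(3)[OF that(2)]] Fval[OF close(1)] that
        bilinear_lzero[OF bilinear_gc[OF c'], of 0] by simp
    then have "gnorm c x (snd c x2 - snd c x1) \<le> 0" using \<theta>(3) by (simp add: mult_le_0_iff)
    then have "snd c x2 = snd c x1" using gc_pos[OF c, of "snd c x2 - snd c x1"] by (cases "snd c x2 - snd c x1 = 0") auto
    then show ?thesis using chart_inv_left[OF c(1) close(1)[OF that(1)]] chart_inv_left[OF c(1) close(1)[OF that(2)]] by metis
  qed
  show ?thesis using \<rho>(1) solve inj by blast
qed

end

section \<open>Compact spaces\<close>

locale compact_distance = topological_distance d for d :: "'a::t2_space \<Rightarrow> 'a \<Rightarrow> real" +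
  assumes compact_space: "compact (UNIV :: 'a set)"
begin

lemma finite_net:
  assumes "0 < r"
  obtains E where "finite E" "\<And>x. \<exists>e\<in>E. d e x < r"
proof -
  have cover: "UNIV \<subseteq> (\<Union>e\<in>UNIV. {x. d e x < r})" using assms by auto
  obtain E where "finite E" "UNIV \<subseteq> (\<Union>e\<in>E. {x. d e x < r})"
    by (rule compactE_image[OF compact_space open_d_ball cover])
  then show ?thesis using that by blast
qed

text \<open>The least of the scales that belong to finitely many balls covering the space will do.\<close>

lemma uniform_scale:
  assumes loc: "\<And>x. \<exists>\<rho>>0. \<forall>y. d x y < \<rho> \<longrightarrow> Q \<rho> y"
    and mono: "\<And>\<rho> \<rho>' y. 0 < \<rho>' \<Longrightarrow> \<rho>' \<le> \<rho> \<Longrightarrow> Q \<rho> y \<Longrightarrow> Q \<rho>' y"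
  shows "\<exists>\<rho>>0. \<forall>y. Q \<rho> y"
proof -
  have "\<forall>x. \<exists>\<rho>. \<rho> > 0 \<and> (\<forall>y. d x y < \<rho> \<longrightarrow> Q \<rho> y)" using loc by blast
  from choice[OF this] obtain \<rho> where \<rho>: "\<And>x. \<rho> x > (0::real)" "\<And>x y. d x y < \<rho> x \<Longrightarrow> Q (\<rho> x) y"
    by blast
  have cover: "UNIV \<subseteq> (\<Union>x\<in>UNIV. {y. d x y < \<rho> x})" using \<rho>(1) by auto
  obtain E where E: "finite E" "UNIV \<subseteq> (\<Union>x\<in>E. {y. d x y < \<rho> x})"
    by (rule compactE_image[OF compact_space open_d_ball cover])
  have ne: "E \<noteq> {}" using E(2) by blast
  have "Min (\<rho> ` E) > 0" using E(1) ne \<rho>(1) by simp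
  moreover have "Q (Min (\<rho> ` E)) y" for y
  proof -
    obtain x where x: "x \<in> E" "d x y < \<rho> x" using E(2) by blast
    show ?thesis by (rule mono[OF calculation _ \<rho>(2)[OF x(2)]]) (use E(1) x(1) in simp)
  qed
  ultimately show ?thesis by blast
qed

end

section \<open>Iterates\<close>

lemma iterate_add: "iterate f k (n + m) = iterate f (k + n) m \<circ> iterate f k n"
  by (induction m) (auto simp: comp_assoc add.assoc)

lemma continuous_on_iterate:
  assumes "\<And>n. continuous_on UNIV (f n)"
  shows "continuous_on UNIV (iterate f k n)"
proof (induction n)
  case (Suc n)
  then show ?case
    using continuous_on_compose[OF Suc.IH continuous_on_subset[OF assms subset_UNIV]] by simp
qed (simp add: id_def)

section \<open>Uniformly expanding sequences\<close>

text \<open>The three properties of the maps and of the space, besides equicontinuity, that the proof needs: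
  the space is nearly a length space, the maps have local inverses that contract, and the space is
  locally contractible. The scales in the last two may depend on the map and on the point.\<close>

locale expanding_sequence = compact_distance d for d :: "'a::t2_space \<Rightarrow> 'a \<Rightarrow> real" +
  fixes f :: "nat \<Rightarrow> 'a \<Rightarrow> 'a" and lam :: real
  assumes lam: "1 < lam"
    and equicontinuous: "uniformly_equicontinuous d f"
    and chain: "d x y < s \<Longrightarrow> 0 < \<eta> \<Longrightarrow> \<exists>m ys. ys 0 = x \<and> ys m = y \<and>
      (\<forall>j<m. d (ys j) (ys (Suc j)) < \<eta>) \<and> (\<Sum>j<m. d (ys j) (ys (Suc j))) < s"
    and local_inverse: "\<exists>\<rho>>0. \<forall>x1. d x x1 < \<rho> \<longrightarrow>
      (\<forall>y. d (f n x1) y < \<rho> \<longrightarrow> (\<exists>x'. f n x' = y \<and> lam * d x1 x' \<le> d (f n x1) y)) \<and>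
      (\<forall>x2. d x x2 < \<rho> \<longrightarrow> f n x1 = f n x2 \<longrightarrow> x1 = x2)"
    and contraction: "\<exists>\<rho>>0. \<forall>z. d x z < \<rho> \<longrightarrow> (\<exists>h C. ball_contraction d x \<rho> z h C)"
begin

lemma continuous_f: "continuous_on UNIV (f n)"
  unfolding continuous_on_open_vimage[OF open_UNIV]
proof (intro allI impI)
  fix B :: "'a set" assume B: "open B"
  have "open (f n -` B)"
    unfolding open_iff_d
  proof
    fix x assume "x \<in> f n -` B"
    then obtain e where e: "e > 0" "\<And>y. d (f n x) y < e \<Longrightarrow> y \<in> B" using B unfolding open_iff_d by auto
    then obtain \<delta> where "\<delta> > 0" "\<And>y. d x y < \<delta> \<Longrightarrow> d (f n x) (f n y) < e"
      using equicontinuous unfolding uniformly_equicontinuous_def by metis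
    then show "\<exists>e>0. \<forall>y. d x y < e \<longrightarrow> y \<in> f n -` B" using e(2) by auto
  qed
  then show "open (f n -` B \<inter> UNIV)" by simp
qed

lemma local_inverse_uniform:
  "\<exists>\<rho>>0. \<forall>x. (\<forall>y. d (f n x) y < \<rho> \<longrightarrow> (\<exists>x'. f n x' = y \<and> lam * d x x' \<le> d (f n x) y)) \<and>
     (\<forall>x'. d x x' < \<rho> \<longrightarrow> f n x = f n x' \<longrightarrow> x = x')"
proof (rule uniform_scale)
  fix x
  obtain \<rho> where \<rho>: "\<rho> > 0"
    "\<And>x1 y. d x x1 < \<rho> \<Longrightarrow> d (f n x1) y < \<rho> \<Longrightarrow> \<exists>x'. f n x' = y \<and> lam * d x1 x' \<le> d (f n x1) y"
    "\<And>x1 x2. d x x1 < \<rho> \<Longrightarrow> d x x2 < \<rho> \<Longrightarrow> f n x1 = f n x2 \<Longrightarrow> x1 = x2"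
    using local_inverse[of x n] by blast
  have "(\<forall>y. d (f n x1) y < \<rho>/2 \<longrightarrow> (\<exists>x'. f n x' = y \<and> lam * d x1 x' \<le> d (f n x1) y)) \<and>
     (\<forall>x'. d x1 x' < \<rho>/2 \<longrightarrow> f n x1 = f n x' \<longrightarrow> x1 = x')" if x1: "d x x1 < \<rho>/2" for x1
  proof (intro conjI allI impI)
    show "\<exists>x'. f n x' = y \<and> lam * d x1 x' \<le> d (f n x1) y" if "d (f n x1) y < \<rho>/2" for y
      using \<rho>(2)[of x1 y] that x1 \<rho>(1) by auto
    show "x1 = x'" if "d x1 x' < \<rho>/2" "f n x1 = f n x'" for x'
      by (rule \<rho>(3)) (use that x1 \<rho>(1) d_triangle[of x x' x1] in auto)
  qed
  then show "\<exists>\<rho>>0. \<forall>x1. d x x1 < \<rho> \<longrightarrow>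
     (\<forall>y. d (f n x1) y < \<rho> \<longrightarrow> (\<exists>x'. f n x' = y \<and> lam * d x1 x' \<le> d (f n x1) y)) \<and>
     (\<forall>x'. d x1 x' < \<rho> \<longrightarrow> f n x1 = f n x' \<longrightarrow> x1 = x')"
    using \<rho>(1) by (intro exI[of _ "\<rho>/2"]) auto
qed (meson order_less_le_trans)

text \<open>Lift a nearly shortest chain step by step.\<close>

lemma lift_point:
  assumes "d (f n x) y < s"
  shows "\<exists>x'. f n x' = y \<and> lam * d x x' < s"
proof -
  obtain \<rho> where \<rho>: "\<rho> > 0" "\<And>x y. d (f n x) y < \<rho> \<Longrightarrow> \<exists>x'. f n x' = y \<and> lam * d x x' \<le> d (f n x) y"
    using local_inverse_uniform[of n] by blast
  obtain m ys where ys: "ys 0 = f n x" "ys m = y" "\<And>j. j < m \<Longrightarrow> d (ys j) (ys (Suc j)) < \<rho>"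
    "(\<Sum>j<m. d (ys j) (ys (Suc j))) < s"
    using chain[OF assms \<rho>(1)] by blast
  have "\<exists>x'. f n x' = ys k \<and> lam * d x x' \<le> (\<Sum>j<k. d (ys j) (ys (Suc j)))" if "k \<le> m" for k
    using that
  proof (induction k)
    case 0
    then show ?case using ys(1) by (intro exI[of _ x]) simp
  next
    case (Suc k)
    then obtain x1 where x1: "f n x1 = ys k" "lam * d x x1 \<le> (\<Sum>j<k. d (ys j) (ys (Suc j)))" by auto
    obtain x2 where x2: "f n x2 = ys (Suc k)" "lam * d x1 x2 \<le> d (ys k) (ys (Suc k))"
      using \<rho>(2)[of x1 "ys (Suc k)"] ys(3)[of k] x1(1) Suc.prems by auto
    have "lam * d x x2 \<le> lam * (d x x1 + d x1 x2)" using d_triangle[of x x2 x1] lam by simp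
    then show ?case using x1 x2 by (intro exI[of _ x2]) (simp add: distrib_left)
  qed
  from this[OF order_refl] show ?thesis using ys(2,4) by force
qed

lemma uniform_contraction: "\<exists>\<rho>>0. \<forall>z. \<exists>h C. ball_contraction d z \<rho> z h C"
proof (rule uniform_scale)
  fix x
  obtain \<rho> where \<rho>: "\<rho> > 0" "\<And>z. d x z < \<rho> \<Longrightarrow> \<exists>h C. ball_contraction d x \<rho> z h C"
    using contraction[of x] by blast
  have "\<exists>h C. ball_contraction d z (\<rho>/2) z h C" if z: "d x z < \<rho>/2" for z
  proof -
    obtain h C where "ball_contraction d x \<rho> z h C" using \<rho>(2)[of z] z \<rho>(1) by auto
    moreover have "d x w < \<rho>" if "d z w < \<rho>/2" for w using d_triangle[of x w z] z that by simp
    ultimately have "ball_contraction d z (\<rho>/2) z h C" by (rule ball_contraction_subball)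
    then show ?thesis by blast
  qed
  then show "\<exists>\<rho>>0. \<forall>z. d x z < \<rho> \<longrightarrow> (\<exists>h C. ball_contraction d z \<rho> z h C)"
    using \<rho>(1) by (intro exI[of _ "\<rho>/2"]) simp
next
  fix \<rho> \<rho>' y
  assume le: "\<rho>' \<le> \<rho>" and "\<exists>h C. ball_contraction d y \<rho> y h C"
  then obtain h C where "ball_contraction d y \<rho> y h C" by blast
  then have "ball_contraction d y \<rho>' y h C" by (rule ball_contraction_subball) (use le in simp)
  then show "\<exists>h C. ball_contraction d y \<rho>' y h C" by blast
qed

text \<open>If two nearby points have the same image, then the image of a short chain between them is a
  small loop, which contracts to a point inside a small ball. The successive stages of the
  contraction lift to chains with fixed end points, hence the end points agree. The scale of
  the lifting depends on \<open>n\<close>, but the size of the loops does not.\<close>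

lemma uniformly_locally_injective:
  "\<exists>r>0. \<forall>n x y. d x y < r \<longrightarrow> f n x = f n y \<longrightarrow> x = y"
proof -
  obtain \<rho> where \<rho>: "\<rho> > 0" "\<And>z. \<exists>h C. ball_contraction d z \<rho> z h C"
    using uniform_contraction by blast
  obtain r where r: "r > 0" "\<And>n x y. d x y < r \<Longrightarrow> d (f n x) (f n y) < \<rho>"
    using equicontinuous \<rho>(1) unfolding uniformly_equicontinuous_def by metis
  have "x = y" if xy: "d x y < r" "f n x = f n y" for n x y
  proof -
    define z where "z = f n x"
    obtain \<sigma> where \<sigma>: "\<sigma> > 0"
      "\<And>x y. d (f n x) y < \<sigma> \<Longrightarrow> \<exists>x'. f n x' = y \<and> lam * d x x' \<le> d (f n x) y"
      "\<And>x x'. d x x' < \<sigma> \<Longrightarrow> f n x = f n x' \<Longrightarrow> x = x'"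
      using local_inverse_uniform[of n] by blast
    define s0 where "s0 = \<sigma> / 4"
    have s0: "s0 > 0" "4 * s0 = \<sigma>" unfolding s0_def using \<sigma>(1) by auto
    have lift: "\<exists>x'. f n x' = b \<and> d a x' < s0" if "d (f n a) b < s0" for a b
    proof -
      have "d (f n a) b < \<sigma>" using that s0 by linarith
      then obtain x' where x': "f n x' = b" "lam * d a x' \<le> d (f n a) b" using \<sigma>(2) by blast
      have "1 * d a x' \<le> lam * d a x'" using lam by (intro mult_right_mono) auto
      then show ?thesis using x' that by (intro exI[of _ x']) simp
    qed
    obtain h C0 where "ball_contraction d z \<rho> z h C0" using \<rho>(2) by blast
    note h0 = this[unfolded ball_contraction_def, rule_format]
    define C where "C = \<bar>C0\<bar> + 1"
    have C: "C > 0" "C0 \<le> C" unfolding C_def by auto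
    have h: "h 0 w = z" "h 1 w = w" if "d z w < \<rho>" for w using h0[OF that that] by auto
    have hz: "h s z = z" if "s \<in> {0..1}" for s using h0[of z z] \<rho>(1) that by auto
    have hC: "d (h s w) (h s' w') \<le> C * (\<bar>s - s'\<bar> + d w w')"
      if "d z w < \<rho>" "d z w' < \<rho>" "s \<in> {0..1}" "s' \<in> {0..1}" for w w' s s'
    proof -
      have "d (h s w) (h s' w') \<le> C0 * (\<bar>s - s'\<bar> + d w w')" using h0[OF that(1,2)] that(3,4) by blast
      also have "\<dots> \<le> C * (\<bar>s - s'\<bar> + d w w')" using C(2) by (intro mult_right_mono) auto
      finally show ?thesis .
    qed
    obtain \<eta>0 where \<eta>0: "\<eta>0 > 0" "\<And>x y. d x y < \<eta>0 \<Longrightarrow> d (f n x) (f n y) < s0 / C"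
      using equicontinuous s0(1) C(1) unfolding uniformly_equicontinuous_def by (metis divide_pos_pos)
    define \<eta> where "\<eta> = min \<eta>0 s0"
    have \<eta>: "\<eta> > 0" "\<eta> \<le> s0" unfolding \<eta>_def using \<eta>0 s0 by auto
    obtain m ys where ys: "ys 0 = x" "ys m = y" "\<And>j. j < m \<Longrightarrow> d (ys j) (ys (Suc j)) < \<eta>"
      "(\<Sum>j<m. d (ys j) (ys (Suc j))) < r"
      using chain[OF xy(1) \<eta>(1)] by blast
    have partial: "d x (ys k) \<le> (\<Sum>j<k. d (ys j) (ys (Suc j)))" if "k \<le> m" for k
      using that
    proof (induction k)
      case (Suc k)
      then show ?case using d_triangle[of x "ys (Suc k)" "ys k"] by simp
    qed (simp add: ys(1))
    define zs where "zs j = f n (ys j)" for j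
    have zs: "d z (zs j) < \<rho>" if "j \<le> m" for j
    proof -
      have "(\<Sum>j<j. d (ys j) (ys (Suc j))) \<le> (\<Sum>j<m. d (ys j) (ys (Suc j)))"
        using that by (intro sum_mono2) auto
      then have "d x (ys j) < r" using partial[OF that] ys(4) by simp
      then show ?thesis unfolding z_def zs_def by (rule r(2))
    qed
    have zs_step: "d (zs j) (zs (Suc j)) < s0 / C" if "j < m" for j
      unfolding zs_def by (rule \<eta>0(2)) (use ys(3)[OF that] in \<open>simp add: \<eta>_def\<close>)
    obtain N where N: "N > 0" "inverse (real N) < s0 / C" using ex_inverse_of_nat_less[of "s0/C"] s0(1) C(1) by auto
    define H where "H k j = h (real k / real N) (zs j)" for k j
    have unit: "real k / real N \<in> {0..1}" if "k \<le> N" for k using that N(1) by simp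
    have H_step: "d (H k j) (H k (Suc j)) < s0" if "k \<le> N" "j < m" for k j
    proof -
      have "d (H k j) (H k (Suc j)) \<le> C * (\<bar>real k / real N - real k / real N\<bar> + d (zs j) (zs (Suc j)))"
        unfolding H_def by (rule hC) (use zs that unit in auto)
      also have "\<dots> < s0" using zs_step[OF that(2)] C(1) by (simp add: field_simps)
      finally show ?thesis .
    qed
    have H_up: "d (H k j) (H (Suc k) j) < s0" if "Suc k \<le> N" "j \<le> m" for k j
    proof -
      have "d (H k j) (H (Suc k) j) \<le> C * (\<bar>real k / real N - real (Suc k) / real N\<bar> + d (zs j) (zs j))"
        unfolding H_def by (rule hC) (use zs that unit in auto)
      also have "\<bar>real k / real N - real (Suc k) / real N\<bar> = inverse (real N)"
        by (simp add: field_simps flip: diff_divide_distrib)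
      also have "C * (inverse (real N) + d (zs j) (zs j)) < s0" using N(2) C(1) by (simp add: field_simps)
      finally show ?thesis .
    qed
    have ends: "H k 0 = z" "H k m = z" if "k \<le> N" for k
    proof -
      have "zs 0 = z" "zs m = z" unfolding zs_def z_def using ys(1,2) xy(2) by simp_all
      then show "H k 0 = z" "H k m = z" unfolding H_def using hz[OF unit[OF that]] by simp_all
    qed
    \<comment> \<open>lifts of the stages of the contraction, starting with the constant chain\<close>
    have "\<exists>X. (\<forall>j\<le>m. f n (X j) = H k j) \<and> X 0 = x \<and> X m = x \<and> (\<forall>j<m. d (X j) (X (Suc j)) < s0)"
      if "k \<le> N" for k
      using that
    proof (induction k)
      case 0
      have "f n x = H 0 j" if "j \<le> m" for j
        using h(1)[OF zs[OF that]] unfolding H_def z_def by simp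
      then show ?case using s0(1) by (intro exI[of _ "\<lambda>_. x"]) simp
    next
      case (Suc k)
      then obtain X where X: "\<And>j. j \<le> m \<Longrightarrow> f n (X j) = H k j" "X 0 = x" "X m = x"
        "\<And>j. j < m \<Longrightarrow> d (X j) (X (Suc j)) < s0" by auto
      have "\<exists>x'. f n x' = H (Suc k) j \<and> d (X j) x' < s0" if "j \<le> m" for j
        by (rule lift) (use H_up[OF Suc.prems that] X(1)[OF that] in simp)
      then obtain Y where Y: "\<And>j. j \<le> m \<Longrightarrow> f n (Y j) = H (Suc k) j" "\<And>j. j \<le> m \<Longrightarrow> d (X j) (Y j) < s0" by metis
      have "Y j = x" if "j = 0 \<or> j = m" for j
      proof -
        have j: "j \<le> m" "X j = x" "H (Suc k) j = z" using that X(2,3) ends[OF Suc.prems] by auto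
        have "x = Y j"
        proof (rule \<sigma>(3))
          show "d x (Y j) < \<sigma>" using Y(2)[OF j(1)] j(2) s0 by simp
          show "f n x = f n (Y j)" using Y(1)[OF j(1)] j(3) z_def by simp
        qed
        then show ?thesis by simp
      qed
      moreover have "d (Y j) (Y (Suc j)) < s0" if j: "j < m" for j
      proof -
        have "d (f n (Y j)) (H (Suc k) (Suc j)) < s0" using H_step[OF Suc.prems j] Y(1)[of j] j by simp
        then obtain w where w: "f n w = H (Suc k) (Suc j)" "d (Y j) w < s0" using lift by blast
        have "w = Y (Suc j)"
        proof (rule \<sigma>(3))
          show "f n w = f n (Y (Suc j))" using w(1) Y(1)[of "Suc j"] j by simp
          have "d w (Y (Suc j)) \<le> d w (Y j) + (d (Y j) (X j) + (d (X j) (X (Suc j)) + d (X (Suc j)) (Y (Suc j))))"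
            using d_triangle[of w "Y (Suc j)" "Y j"] d_triangle[of "Y j" "Y (Suc j)" "X j"]
              d_triangle[of "X j" "Y (Suc j)" "X (Suc j)"] by simp
          moreover have "d w (Y j) < s0" using w(2) d_sym[of w "Y j"] by simp
          moreover have "d (Y j) (X j) < s0" using Y(2)[of j] j d_sym[of "Y j" "X j"] by simp
          moreover have "d (X j) (X (Suc j)) < s0" by (rule X(4)[OF j])
          moreover have "d (X (Suc j)) (Y (Suc j)) < s0" using Y(2)[of "Suc j"] j by simp
          ultimately show "d w (Y (Suc j)) < \<sigma>" using s0(2) by linarith
        qed
        then show ?thesis using w(2) by simp
      qed
      ultimately show ?case using Y(1) by (intro exI[of _ Y]) simp
    qed
    from this[OF order_refl] obtain X where X: "\<And>j. j \<le> m \<Longrightarrow> f n (X j) = H N j" "X 0 = x" "X m = x"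
        "\<And>j. j < m \<Longrightarrow> d (X j) (X (Suc j)) < s0" by auto
    have "X j = ys j" if "j \<le> m" for j
      using that
    proof (induction j)
      case (Suc j)
      show ?case
      proof (rule \<sigma>(3))
        show "f n (X (Suc j)) = f n (ys (Suc j))"
          using X(1)[OF Suc.prems] h(2)[OF zs[OF Suc.prems]] N(1) unfolding H_def zs_def by simp
        have "d (X (Suc j)) (ys (Suc j)) \<le> d (X (Suc j)) (X j) + d (ys j) (ys (Suc j))"
          using d_triangle[of "X (Suc j)" "ys (Suc j)" "X j"] Suc by simp
        also have "\<dots> < s0 + s0"
          using X(4)[of j] ys(3)[of j] \<eta>(2) Suc.prems d_sym[of "X j"] by (intro add_strict_mono) auto
        finally show "d (X (Suc j)) (ys (Suc j)) < \<sigma>" using s0 by simp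
      qed
    qed (simp add: X(2) ys(1))
    from this[OF order_refl] show "x = y" using X(3) ys(2) by simp
  qed
  then show ?thesis using r(1) by blast
qed

section \<open>Fibres of the iterates\<close>

lemma lift_orbit:
  assumes "d (iterate f k n x) y < s"
  shows "\<exists>x'. iterate f k n x' = y \<and> (\<forall>i\<le>n. lam ^ (n - i) * d (iterate f k i x) (iterate f k i x') < s)"
  using assms
proof (induction n arbitrary: y s)
  case (Suc n)
  then obtain y' where y': "f (k + n) y' = y" "lam * d (iterate f k n x) y' < s"
    using lift_point[of "k + n" "iterate f k n x" y s] by auto
  then have "d (iterate f k n x) y' < s / lam" using lam by (simp add: field_simps)
  from Suc.IH[OF this] obtain x' where x': "iterate f k n x' = y'"
    "\<And>i. i \<le> n \<Longrightarrow> lam ^ (n - i) * d (iterate f k i x) (iterate f k i x') < s / lam" by blast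
  have "lam ^ (Suc n - i) * d (iterate f k i x) (iterate f k i x') < s" if "i \<le> Suc n" for i
  proof (cases "i = Suc n")
    case True
    then show ?thesis using Suc.prems x'(1) y'(1) by simp
  next
    case False
    then have "i \<le> n" using that by simp
    then show ?thesis using x'(2)[of i] lam by (simp add: Suc_diff_le field_simps)
  qed
  then show ?case using x'(1) y'(1) by (intro exI[of _ x']) simp
qed auto

definition inj_radius where "inj_radius = (SOME r. r > 0 \<and> (\<forall>n x y. d x y < r \<longrightarrow> f n x = f n y \<longrightarrow> x = y))"

lemma inj_radius: "inj_radius > 0" "d x y < inj_radius \<Longrightarrow> f n x = f n y \<Longrightarrow> x = y"
proof -
  have "inj_radius > 0 \<and> (\<forall>n x y. d x y < inj_radius \<longrightarrow> f n x = f n y \<longrightarrow> x = y)"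
    unfolding inj_radius_def by (rule someI_ex) (use uniformly_locally_injective in blast)
  then show "inj_radius > 0" "d x y < inj_radius \<Longrightarrow> f n x = f n y \<Longrightarrow> x = y" by blast+
qed

lemma orbits_separate:
  assumes "iterate f k n x = iterate f k n y" "\<And>i. i < n \<Longrightarrow> d (iterate f k i x) (iterate f k i y) < inj_radius"
  shows "x = y"
  using assms
proof (induction n)
  case (Suc n)
  have "iterate f k n x = iterate f k n y"
    by (rule inj_radius(2)[of _ _ "k + n"]) (use Suc.prems in auto)
  then show ?case using Suc by simp
qed simp

definition fibre where "fibre k n y = {x. iterate f k n x = y}"

text \<open>The weights \<open>lam ^ (n - i)\<close> express that the displacement of the orbit decays geometrically from
  time \<open>n\<close> backwards.\<close>

definition fibre_injection where
  "fibre_injection k n D y y' b \<longleftrightarrow> inj_on b (fibre k n y) \<and> b ` fibre k n y \<subseteq> fibre k n y' \<and>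
     (\<forall>x\<in>fibre k n y. \<forall>i\<le>n. lam ^ (n - i) * d (iterate f k i x) (iterate f k i (b x)) \<le> D)"

text \<open>Lift the orbit of each point of the fibre. Two lifts that end in the same point stay close to each
  other at all times, hence they start in the same point.\<close>

lemma fibre_injection_near:
  assumes "d y y' < inj_radius / 2"
  shows "\<exists>b. fibre_injection k n (inj_radius / 2) y y' b"
proof -
  have "\<exists>x'. iterate f k n x' = y' \<and> (\<forall>i\<le>n. lam ^ (n - i) * d (iterate f k i x) (iterate f k i x') < inj_radius / 2)"
    if "x \<in> fibre k n y" for x
    by (rule lift_orbit) (use that assms in \<open>simp add: fibre_def\<close>)
  then obtain b where b: "\<And>x. x \<in> fibre k n y \<Longrightarrow> iterate f k n (b x) = y'"
    "\<And>x i. x \<in> fibre k n y \<Longrightarrow> i \<le> n \<Longrightarrow> lam ^ (n - i) * d (iterate f k i x) (iterate f k i (b x)) < inj_radius / 2"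
    by metis
  have near: "d (iterate f k i x) (iterate f k i (b x)) < inj_radius / 2" if "x \<in> fibre k n y" "i \<le> n" for x i
  proof -
    have "1 * d (iterate f k i x) (iterate f k i (b x)) \<le> lam ^ (n - i) * d (iterate f k i x) (iterate f k i (b x))"
      by (rule mult_right_mono) (use lam in auto)
    then show ?thesis using b(2)[OF that] by simp
  qed
  have "inj_on b (fibre k n y)"
  proof (rule inj_onI)
    fix x x' assume x: "x \<in> fibre k n y" "x' \<in> fibre k n y" "b x = b x'"
    show "x = x'"
    proof (rule orbits_separate[of k n])
      show "iterate f k n x = iterate f k n x'" using x by (simp add: fibre_def)
      fix i assume "i < n"
      then have "d (iterate f k i x) (iterate f k i (b x)) < inj_radius / 2" "d (iterate f k i x') (iterate f k i (b x)) < inj_radius / 2"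
        using near[OF x(1), of i] near[OF x(2), of i] x(3) by auto
      then show "d (iterate f k i x) (iterate f k i x') < inj_radius"
        using d_triangle[of "iterate f k i x" "iterate f k i x'" "iterate f k i (b x)"] d_sym[of "iterate f k i x'"] by simp
    qed
  qed
  then show ?thesis unfolding fibre_injection_def using b by (intro exI[of _ b]) (auto simp: fibre_def less_imp_le)
qed

lemma fibre_injection_comp:
  assumes "fibre_injection k n D y y' b" "fibre_injection k n D' y' y'' b'"
  shows "fibre_injection k n (D + D') y y'' (b' \<circ> b)"
  unfolding fibre_injection_def
proof (intro conjI ballI allI impI)
  have sub: "b ` fibre k n y \<subseteq> fibre k n y'" using assms(1) unfolding fibre_injection_def by blast
  show "inj_on (b' \<circ> b) (fibre k n y)"
    using assms sub unfolding fibre_injection_def by (meson comp_inj_on inj_on_subset)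
  show "(b' \<circ> b) ` fibre k n y \<subseteq> fibre k n y''" using assms(2) sub unfolding fibre_injection_def by auto
  fix x i assume x: "x \<in> fibre k n y" "i \<le> n"
  have "lam ^ (n - i) * d (iterate f k i x) (iterate f k i ((b' \<circ> b) x)) \<le>
     lam ^ (n - i) * (d (iterate f k i x) (iterate f k i (b x)) + d (iterate f k i (b x)) (iterate f k i (b' (b x))))"
    using d_triangle[of "iterate f k i x" "iterate f k i ((b' \<circ> b) x)" "iterate f k i (b x)"] lam
    by (intro mult_left_mono) auto
  also have "\<dots> \<le> D + D'"
    unfolding distrib_left using assms sub x unfolding fibre_injection_def by (intro add_mono) auto
  finally show "lam ^ (n - i) * d (iterate f k i x) (iterate f k i ((b' \<circ> b) x)) \<le> D + D'" .
qed

lemma fibre_injection_mono: "fibre_injection k n D y y' b \<Longrightarrow> D \<le> D' \<Longrightarrow> fibre_injection k n D' y y' b"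
  unfolding fibre_injection_def by force

lemma fibre_injection_steps:
  assumes "\<And>j. j < m \<Longrightarrow> d (ys j) (ys (Suc j)) < inj_radius / 2"
  shows "\<exists>b. fibre_injection k n (real m * (inj_radius / 2)) (ys 0) (ys m) b"
  using assms
proof (induction m)
  case 0
  have "fibre_injection k n 0 (ys 0) (ys 0) id" unfolding fibre_injection_def by simp
  then show ?case by auto
next
  case (Suc m)
  then obtain b b' where "fibre_injection k n (real m * (inj_radius / 2)) (ys 0) (ys m) b"
    "fibre_injection k n (inj_radius / 2) (ys m) (ys (Suc m)) b'"
    using fibre_injection_near[of "ys m" "ys (Suc m)"] by force
  from fibre_injection_comp[OF this]
  have "fibre_injection k n (real m * (inj_radius / 2) + inj_radius / 2) (ys 0) (ys (Suc m)) (b' \<circ> b)" .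
  also have "real m * (inj_radius / 2) + inj_radius / 2 = real (Suc m) * (inj_radius / 2)" by (simp add: field_simps)
  finally show ?case by blast
qed

text \<open>Two points are joined by a chain whose number of steps is bounded, by compactness.\<close>

lemma fibre_injection_uniform:
  "\<exists>D. \<forall>k n y y'. \<exists>b. fibre_injection k n D y y' b"
proof -
  define s where "s = inj_radius / 2"
  have s: "s > 0" unfolding s_def using inj_radius(1) by simp
  obtain E where E: "finite E" "\<And>x. \<exists>e\<in>E. d e x < s" using finite_net[OF s] by blast
  have "\<exists>D. \<forall>k n. \<exists>b. fibre_injection k n D e e' b" for e e'
  proof -
    obtain m ys where "ys 0 = e" "ys m = e'" "\<And>j. j < m \<Longrightarrow> d (ys j) (ys (Suc j)) < s"
      using chain[of e e' "d e e' + 1" s] s by auto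
    then show ?thesis using fibre_injection_steps[of m ys] unfolding s_def by blast
  qed
  then obtain D where D: "\<And>e e' k n. \<exists>b. fibre_injection k n (D e e') e e' b" by metis
  define D0 where "D0 = Max ((\<lambda>(e, e'). D e e') ` (E \<times> E))"
  have D0: "D e e' \<le> D0" if "e \<in> E" "e' \<in> E" for e e'
    unfolding D0_def using E(1) that by (intro Max_ge) auto
  have "\<exists>b. fibre_injection k n (s + D0 + s) y y' b" for k n y y'
  proof -
    obtain e e' where e: "e \<in> E" "d e y < s" "e' \<in> E" "d e' y' < s" using E(2) by metis
    obtain b1 where b1: "fibre_injection k n s y e b1"
      using fibre_injection_near[of y e k n] e(2) d_sym[of e y] unfolding s_def by auto
    obtain b2 where b2: "fibre_injection k n (D e e') e e' b2" using D by blast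
    obtain b3 where b3: "fibre_injection k n s e' y' b3"
      using fibre_injection_near[of e' y' k n] e(4) unfolding s_def by auto
    have "fibre_injection k n (s + D e e' + s) y y' (b3 \<circ> (b2 \<circ> b1))"
      by (rule fibre_injection_comp[OF fibre_injection_comp[OF b1 b2] b3])
    then have "fibre_injection k n (s + D0 + s) y y' (b3 \<circ> (b2 \<circ> b1))"
      by (rule fibre_injection_mono) (use D0[OF e(1,3)] in simp)
    then show ?thesis by blast
  qed
  then show ?thesis by blast
qed

text \<open>The points of a fibre have distance at least \<open>inj_radius\<close> from each other.\<close>

lemma finite_preimage: "finite (f n -` {y})"
proof -
  obtain E where E: "finite E" "\<And>x. \<exists>e\<in>E. d e x < inj_radius / 2"
    using finite_net[of "inj_radius / 2"] inj_radius(1) by auto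
  then obtain e where e: "\<And>x. e x \<in> E" "\<And>x. d (e x) x < inj_radius / 2" by metis
  have "inj_on e (f n -` {y})"
  proof (rule inj_onI)
    fix x x' assume "x \<in> f n -` {y}" "x' \<in> f n -` {y}" "e x = e x'"
    then show "x = x'"
      using e(2)[of x] e(2)[of x'] d_triangle[of x x' "e x"] d_sym[of x "e x"] by (intro inj_radius(2)[of x x' n]) auto
  qed
  then show ?thesis using E(1) e(1) by (meson finite_imageD finite_subset image_subsetI)
qed

text \<open>The degree of \<open>f n\<close>: by \<open>card_preimage\<close>, all points have the same number of preimages.\<close>

definition deg where "deg n = card (f n -` {undefined})"

lemma card_preimage: "card (f n -` {y}) = deg n"
proof -
  have fib: "f n -` {y} = fibre n 1 y" for y by (auto simp: fibre_def)
  have "card (f n -` {y}) \<le> card (f n -` {y'})" for y y'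
  proof -
    obtain b where "fibre_injection n 1 (SOME D. \<forall>k n y y'. \<exists>b. fibre_injection k n D y y' b) y y' b"
      using someI_ex[OF fibre_injection_uniform] by blast
    then have "inj_on b (f n -` {y})" "b ` (f n -` {y}) \<subseteq> f n -` {y'}" unfolding fibre_injection_def fib by auto
    then show ?thesis using card_inj_on_le[OF _ _ finite_preimage] by blast
  qed
  then show ?thesis unfolding deg_def by (simp add: antisym)
qed

lemma deg_pos: "deg n > 0"
proof -
  obtain x' where "f n x' = undefined"
    using lift_point[of n undefined undefined "d (f n undefined) undefined + 1"] by auto
  then have "f n -` {undefined} \<noteq> {}" by blast
  then show ?thesis unfolding deg_def using finite_preimage by (simp add: card_gt_0_iff)
qed

lemma card_fibre: "finite (fibre k n y) \<and> card (fibre k n y) \<le> (\<Prod>i<n. deg (k + i))"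
proof (induction n arbitrary: y)
  case 0
  then show ?case by (simp add: fibre_def)
next
  case (Suc n)
  have eq: "fibre k (Suc n) y = (\<Union>y'\<in>f (k + n) -` {y}. fibre k n y')" by (auto simp: fibre_def)
  have "card (fibre k (Suc n) y) \<le> (\<Sum>y'\<in>f (k + n) -` {y}. card (fibre k n y'))"
    unfolding eq by (rule card_UN_le[OF finite_preimage])
  also have "\<dots> \<le> (\<Sum>y'\<in>f (k + n) -` {y}. \<Prod>i<n. deg (k + i))" by (rule sum_mono) (use Suc in blast)
  also have "\<dots> = (\<Prod>i<Suc n. deg (k + i))" by (simp add: card_preimage)
  finally show ?case unfolding eq using finite_preimage Suc by auto
qed

end

section \<open>Shannon entropy of joins\<close>

context information_space
begin

lemma entropy_simple_function_eq:
  assumes "simple_function M X"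
  shows "\<H>(X) = - (\<Sum>x\<in>X ` space M. prob (X -` {x} \<inter> space M) * log b (prob (X -` {x} \<inter> space M)))"
  by (rule entropy_simple_distributed[OF simple_distributedI[OF assms measure_nonneg refl]])

lemma entropy_simple_function_le_card:
  assumes "simple_function M X"
  shows "\<H>(X) \<le> log b (real (card (X ` space M)))"
  by (rule entropy_le_card[OF simple_distributedI[OF assms measure_nonneg refl]])

lemma entropy_Pair_le:
  assumes "simple_function M X" "simple_function M Y"
  shows "\<H>(\<lambda>x. (X x, Y x)) \<le> \<H>(X) + \<H>(Y)"
  using entropy_chain_rule[OF assms] conditional_entropy_less_eq_entropy[OF assms(2,1)] by simp

lemma entropy_le_if_determined:
  assumes W: "simple_function M W" and det: "\<And>x y. x \<in> space M \<Longrightarrow> y \<in> space M \<Longrightarrow> W x = W y \<Longrightarrow> Z x = Z y"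
  shows "\<H>(Z) \<le> \<H>(W)"
proof -
  define h where "h w = Z (SOME x. x \<in> space M \<and> W x = w)" for w
  have h: "h (W x) = Z x" if "x \<in> space M" for x
  proof -
    have "(SOME y. y \<in> space M \<and> W y = W x) \<in> space M \<and> W (SOME y. y \<in> space M \<and> W y = W x) = W x"
      by (rule someI_ex) (use that in blast)
    then show ?thesis unfolding h_def using det that by blast
  qed
  have sf: "simple_function M (h \<circ> W)" by (rule simple_function_compose[OF W])
  have sfZ: "simple_function M Z"
    using sf simple_function_cong[of M "h \<circ> W" Z] h by simp
  have im: "(h \<circ> W) ` space M = Z ` space M" using h by (force simp: image_iff)
  have pre: "(h \<circ> W) -` {z} \<inter> space M = Z -` {z} \<inter> space M" for z using h by auto
  have "\<H>(Z) = \<H>(h \<circ> W)"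
    using entropy_simple_function_eq[OF sfZ] entropy_simple_function_eq[OF sf]
    unfolding im pre by simp
  also have "\<dots> \<le> \<H>(W)" by (rule entropy_data_processing[OF W])
  finally show ?thesis .
qed

lemma entropy_map_le:
  assumes "\<And>i. simple_function M (Y i)"
  shows "simple_function M (\<lambda>x. map (\<lambda>i. Y i x) [0..<n]) \<and> \<H>(\<lambda>x. map (\<lambda>i. Y i x) [0..<n]) \<le> (\<Sum>i<n. \<H>(Y i))"
proof (induction n)
  case 0
  have sf: "simple_function M (\<lambda>x. [] :: 'b list)" by (rule simple_function_const)
  have "\<H>(\<lambda>x. [] :: 'b list) \<le> log b (card ((\<lambda>x. [] :: 'b list) ` space M))"
    by (rule entropy_simple_function_le_card[OF sf])
  then show ?case using sf not_empty by (simp add: image_constant_conv)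
next
  case (Suc n)
  let ?W = "\<lambda>x. map (\<lambda>i. Y i x) [0..<n]"
  have sf: "simple_function M (\<lambda>x. (?W x, Y n x))" using Suc assms by (intro simple_function_Pair) auto
  have sf': "simple_function M (\<lambda>x. map (\<lambda>i. Y i x) [0..<Suc n])"
    using simple_function_compose[OF sf, of "\<lambda>(w, y). w @ [y]"] by (simp add: comp_def)
  have "\<H>(\<lambda>x. map (\<lambda>i. Y i x) [0..<Suc n]) \<le> \<H>(\<lambda>x. (?W x, Y n x))"
    by (rule entropy_le_if_determined[OF sf]) simp
  also have "\<dots> \<le> \<H>(?W) + \<H>(Y n)" using Suc assms by (intro entropy_Pair_le) auto
  also have "\<dots> \<le> (\<Sum>i<Suc n. \<H>(Y i))" using Suc by simp
  finally show ?case using sf' by blast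
qed

end

lemma pullback_join_partition:
  assumes P: "\<And>n. finite_borel_partition (P n)" and f: "\<And>n. continuous_on UNIV (f n)"
  shows "finite (pullback_join f P n)" "\<Union>(pullback_join f P n) = UNIV"
    "pullback_join f P n \<subseteq> sets borel"
    "\<And>C C'. C \<in> pullback_join f P n \<Longrightarrow> C' \<in> pullback_join f P n \<Longrightarrow> C \<inter> C' \<noteq> {} \<Longrightarrow> C = C'"
proof -
  have part: "finite (P i)" "\<Union>(P i) = UNIV" "P i \<subseteq> sets borel"
    "\<And>Q Q'. Q \<in> P i \<Longrightarrow> Q' \<in> P i \<Longrightarrow> Q \<inter> Q' \<noteq> {} \<Longrightarrow> Q = Q'" for i
    using P[of i] unfolding finite_borel_partition_def partition_on_def disjoint_def by auto
  have eq: "pullback_join f P n = (\<lambda>s. \<Inter>i<n. iterate f 0 i -` s i) ` (Pi\<^sub>E {..<n} P)"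
  proof (intro equalityI subsetI)
    fix C assume "C \<in> pullback_join f P n"
    then obtain s where s: "C = (\<Inter>i<n. iterate f 0 i -` s i)" "\<forall>i<n. s i \<in> P i" unfolding pullback_join_def by blast
    have "C = (\<Inter>i<n. iterate f 0 i -` restrict s {..<n} i)" unfolding s(1) by auto
    moreover have "restrict s {..<n} \<in> Pi\<^sub>E {..<n} P" using s(2) by auto
    ultimately show "C \<in> (\<lambda>s. \<Inter>i<n. iterate f 0 i -` s i) ` (Pi\<^sub>E {..<n} P)" by (rule image_eqI)
  next
    fix C assume "C \<in> (\<lambda>s. \<Inter>i<n. iterate f 0 i -` s i) ` (Pi\<^sub>E {..<n} P)"
    then obtain s where "C = (\<Inter>i<n. iterate f 0 i -` s i)" "s \<in> Pi\<^sub>E {..<n} P" by blast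
    then show "C \<in> pullback_join f P n" unfolding pullback_join_def by (auto simp: PiE_iff)
  qed
  show "finite (pullback_join f P n)" unfolding eq using part(1) by (intro finite_imageI finite_PiE) auto
  show "\<Union>(pullback_join f P n) = UNIV"
  proof -
    have "\<exists>C\<in>pullback_join f P n. x \<in> C" for x
    proof -
      have "\<forall>i. \<exists>Q. Q \<in> P i \<and> iterate f 0 i x \<in> Q" using part(2) by (metis UNIV_I UnionE)
      then obtain s where "\<And>i. s i \<in> P i" "\<And>i. iterate f 0 i x \<in> s i" by metis
      then show ?thesis unfolding pullback_join_def by (intro bexI[of _ "\<Inter>i<n. iterate f 0 i -` s i"]) auto
    qed
    then show ?thesis by blast
  qed
  show "pullback_join f P n \<subseteq> sets borel"
  proof
    fix C assume "C \<in> pullback_join f P n"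
    then obtain s where s: "C = (\<Inter>i<n. iterate f 0 i -` s i)" "\<forall>i<n. s i \<in> P i" unfolding pullback_join_def by blast
    have "iterate f 0 i -` s i \<in> sets borel" if "i < n" for i
    proof -
      have "iterate f 0 i \<in> borel_measurable borel"
        by (rule borel_measurable_continuous_onI[OF continuous_on_iterate[of f, OF f]])
      moreover have "s i \<in> sets borel" using s(2) that part(3) by blast
      ultimately show ?thesis using measurable_sets[of "iterate f 0 i" borel borel "s i"] by simp
    qed
    then show "C \<in> sets borel" unfolding s(1) by (cases "n = 0") (auto intro!: sets.finite_INT)
  qed
  fix C C' assume C: "C \<in> pullback_join f P n" "C' \<in> pullback_join f P n" "C \<inter> C' \<noteq> {}"
  obtain s where s: "C = (\<Inter>i<n. iterate f 0 i -` s i)" "\<forall>i<n. s i \<in> P i" using C(1) unfolding pullback_join_def by blast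
  obtain s' where s': "C' = (\<Inter>i<n. iterate f 0 i -` s' i)" "\<forall>i<n. s' i \<in> P i" using C(2) unfolding pullback_join_def by blast
  obtain x where "x \<in> C" "x \<in> C'" using C(3) by blast
  then have "s i = s' i" if "i < n" for i using part(4)[of "s i" i "s' i"] s s' that by auto
  then show "C = C'" unfolding s(1) s'(1) by auto
qed

section \<open>The metric entropy is bounded by the topological entropy\<close>

text \<open>The function \<open>x ln x\<close> vanishes at 0 and at 1 and is continuous there.\<close>

lemma x_ln_x_small:
  fixes \<zeta> :: real
  assumes "0 < \<zeta>"
  shows "\<exists>\<epsilon>>0. \<epsilon> < 1 \<and> (\<forall>x. 0 \<le> x \<longrightarrow> x \<le> \<epsilon> \<longrightarrow> - (x * ln x) \<le> \<zeta>) \<and> (\<forall>x. 1 - \<epsilon> \<le> x \<longrightarrow> x \<le> 1 \<longrightarrow> - (x * ln x) \<le> \<zeta>)"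
proof -
  define \<epsilon> where "\<epsilon> = min (1/2) (min \<zeta> ((\<zeta>/2)\<^sup>2))"
  have \<epsilon>: "0 < \<epsilon>" "\<epsilon> < 1" "\<epsilon> \<le> \<zeta>" "\<epsilon> \<le> (\<zeta>/2)\<^sup>2" unfolding \<epsilon>_def using assms by auto
  have "- (x * ln x) \<le> \<zeta>" if x: "0 \<le> x" "x \<le> \<epsilon>" for x
  proof (cases "x = 0")
    case False
    then have pos: "x > 0" using x by simp
    \<comment> \<open>\<open>- x ln x = 2 x ln (1 / \<surd>x) \<le> 2 \<surd>x\<close>\<close>
    have "ln (1 / sqrt x) \<le> 1 / sqrt x" using ln_le_minus_one[of "1 / sqrt x"] pos by simp
    moreover have "ln (1 / sqrt x) = - (ln x / 2)" using pos by (simp add: ln_div ln_sqrt)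
    ultimately have "x * (- ln x) \<le> x * (2 * (1 / sqrt x))" using pos by (intro mult_left_mono) auto
    also have "\<dots> = 2 * sqrt x" using pos by (simp add: field_simps)
    also have "\<dots> \<le> 2 * sqrt ((\<zeta>/2)\<^sup>2)" using x \<epsilon>(4) by (intro mult_left_mono real_sqrt_le_mono) auto
    also have "\<dots> = \<zeta>" using assms by simp
    finally show ?thesis by simp
  qed (use assms in simp)
  moreover have "- (x * ln x) \<le> \<zeta>" if x: "1 - \<epsilon> \<le> x" "x \<le> 1" for x
  proof -
    have pos: "x > 0" using x \<epsilon> by simp
    have "x * ln (1 / x) \<le> x * (1 / x - 1)" using ln_le_minus_one[of "1 / x"] pos by (intro mult_left_mono) auto
    then show ?thesis using pos x \<epsilon>(3) by (simp add: ln_div right_diff_distrib)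
  qed
  ultimately show ?thesis using \<epsilon>(1,2) by blast
qed

lemma limsup_affine_le:
  fixes x a :: "nat \<Rightarrow> real"
  assumes "\<And>n. 0 < n \<Longrightarrow> x n \<le> a n + c + real n * \<kappa>"
  shows "limsup (\<lambda>n. ereal (x n / real n)) \<le> limsup (\<lambda>n. ereal (a n / real n)) + ereal \<kappa>"
proof -
  have "(\<lambda>n. c / real n) \<longlonglongrightarrow> 0" by (rule lim_const_over_n)
  then have "(\<lambda>n. c / real n + \<kappa>) \<longlonglongrightarrow> 0 + \<kappa>" by (intro tendsto_intros)
  then have lim: "(\<lambda>n. ereal (c / real n + \<kappa>)) \<longlonglongrightarrow> ereal \<kappa>" by simp
  have "limsup (\<lambda>n. ereal (x n / real n)) \<le> limsup (\<lambda>n. ereal (c / real n + \<kappa>) + ereal (a n / real n))"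
  proof (rule Limsup_mono)
    show "\<forall>\<^sub>F n in sequentially. ereal (x n / real n) \<le> ereal (c / real n + \<kappa>) + ereal (a n / real n)"
      using eventually_gt_at_top[of 0]
    proof eventually_elim
      case (elim n)
      then have "x n / real n \<le> (a n + c + real n * \<kappa>) / real n" using assms by (intro divide_right_mono) auto
      then show ?case using elim by (simp add: add_divide_distrib)
    qed
  qed
  also have "\<dots> = ereal \<kappa> + limsup (\<lambda>n. ereal (a n / real n))"
    by (rule ereal_limsup_lim_add[OF lim]) simp
  finally show ?thesis by (simp add: add.commute)
qed

lemma min_subcover_card_le:
  assumes "D \<subseteq> C" "finite D" "\<Union>D = UNIV"
  shows "min_subcover_card C \<le> card D"
  unfolding min_subcover_card_def by (rule Least_le) (use assms in blast)

lemma min_subcover: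
  assumes "D \<subseteq> C" "finite D" "\<Union>D = UNIV"
  obtains D' where "D' \<subseteq> C" "finite D'" "\<Union>D' = UNIV" "card D' = min_subcover_card C"
proof -
  have "\<exists>D'\<subseteq>C. finite D' \<and> \<Union>D' = UNIV \<and> card D' = min_subcover_card C"
    unfolding min_subcover_card_def by (rule LeastI_ex) (use assms in blast)
  then show ?thesis using that by blast
qed

text \<open>All of the at most \<open>N + 1\<close> probabilities are close to 0 or to 1, where \<open>- x ln x\<close> is small.\<close>

lemma (in information_space) entropy_concentrated_le:
  assumes b: "b = exp 1" and Y: "simple_function M Y" and card: "card (Y ` space M) \<le> N + 1"
    and main: "1 - \<epsilon> \<le> prob (Y -` {y0} \<inter> space M)"
    and small: "\<And>y. y \<in> Y ` space M \<Longrightarrow> y \<noteq> y0 \<Longrightarrow> prob (Y -` {y} \<inter> space M) \<le> \<epsilon>"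
    and \<zeta>: "0 \<le> \<zeta>" "\<And>x. 0 \<le> x \<Longrightarrow> x \<le> \<epsilon> \<Longrightarrow> - (x * ln x) \<le> \<zeta>" "\<And>x. 1 - \<epsilon> \<le> x \<Longrightarrow> x \<le> 1 \<Longrightarrow> - (x * ln x) \<le> \<zeta>"
  shows "\<H>(Y) \<le> real (N + 1) * \<zeta>"
proof -
  let ?p = "\<lambda>y. prob (Y -` {y} \<inter> space M)"
  have "\<H>(Y) = - (\<Sum>y\<in>Y ` space M. ?p y * log b (?p y))"
    by (rule entropy_simple_function_eq[OF Y])
  also have "\<dots> = (\<Sum>y\<in>Y ` space M. - (?p y * ln (?p y)))" by (simp add: sum_negf b log_def)
  also have "\<dots> \<le> (\<Sum>y\<in>Y ` space M. \<zeta>)"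
  proof (rule sum_mono)
    fix y assume "y \<in> Y ` space M"
    then show "- (?p y * ln (?p y)) \<le> \<zeta>"
      using \<zeta>(2)[of "?p y"] \<zeta>(3)[of "?p y"] main small by (cases "y = y0") auto
  qed
  also have "\<dots> = real (card (Y ` space M)) * \<zeta>" by simp
  also have "\<dots> \<le> real (N + 1) * \<zeta>" using card \<zeta>(1) by (intro mult_right_mono) auto
  finally show ?thesis .
qed

text \<open>The itinerary of a point with respect to the partitions is determined by an element of a
  cover that contains the point, where the elements of the cover are so small that their images
  meet at most one of the compact cores at each time, together with the cells that are visited
  outside of their cores. The latter information has small entropy, since the cores are large.\<close>

lemma (in compact_distance) partition_entropy_le_topological_entropy:
  assumes f: "\<And>n. continuous_on UNIV (f n)" and \<mu>: "invariant_measure_seq f \<mu>" and P: "P \<in> class_EM d \<mu>"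
  shows "partition_entropy f P \<mu> \<le> topological_entropy d f"
proof (rule ereal_le_epsilon2)
  fix \<kappa> :: real assume \<kappa>: "0 < \<kappa>"
  note PE = CollectD[OF P[unfolded class_EM_def]]
  from PE obtain N where N: "\<And>n. card (P n) \<le> N" by (elim conjE exE) metis
  from PE have fbp: "\<And>n. finite_borel_partition (P n)" by (elim conjE) metis
  have part: "finite (P i)" "\<Union>(P i) = UNIV" "P i \<subseteq> sets borel"
    "\<And>Q Q'. Q \<in> P i \<Longrightarrow> Q' \<in> P i \<Longrightarrow> Q \<inter> Q' \<noteq> {} \<Longrightarrow> Q = Q'" for i
    using fbp[of i] unfolding finite_borel_partition_def partition_on_def disjoint_def by auto
  define \<zeta> where "\<zeta> = \<kappa> / real (N + 1)"
  have \<zeta>: "0 < \<zeta>" "real (N + 1) * \<zeta> = \<kappa>" unfolding \<zeta>_def using \<kappa> by simp_all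
  obtain \<epsilon> where \<epsilon>: "0 < \<epsilon>" "\<epsilon> < 1" "\<And>x. 0 \<le> x \<Longrightarrow> x \<le> \<epsilon> \<Longrightarrow> - (x * ln x) \<le> \<zeta>"
    "\<And>x. 1 - \<epsilon> \<le> x \<Longrightarrow> x \<le> 1 \<Longrightarrow> - (x * ln x) \<le> \<zeta>"
    using x_ln_x_small[OF \<zeta>(1)] by blast
  define \<epsilon>' where "\<epsilon>' = \<epsilon> / real (N + 1)"
  have \<epsilon>': "0 < \<epsilon>'" "\<epsilon>' \<le> \<epsilon>" "real N * \<epsilon>' \<le> \<epsilon>"
    unfolding \<epsilon>'_def using \<epsilon>(1) by (simp_all add: field_simps)
  obtain \<delta> K where \<delta>: "\<delta> > 0"
    and K: "\<And>n Q. Q \<in> P n \<Longrightarrow> compact (K n Q)" "\<And>n Q. Q \<in> P n \<Longrightarrow> K n Q \<subseteq> Q"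
      "\<And>n Q. Q \<in> P n \<Longrightarrow> measure (\<mu> n) (Q - K n Q) \<le> \<epsilon>'"
      "\<And>n Q R x y. Q \<in> P n \<Longrightarrow> R \<in> P n \<Longrightarrow> Q \<noteq> R \<Longrightarrow> x \<in> K n Q \<Longrightarrow> y \<in> K n R \<Longrightarrow> \<delta> \<le> d x y"
  proof -
    have "\<exists>\<delta>>0. \<exists>K. \<forall>n. (\<forall>Q\<in>P n. compact (K n Q) \<and> K n Q \<subseteq> Q \<and> measure (\<mu> n) (Q - K n Q) \<le> \<epsilon>') \<and>
            (\<forall>Q\<in>P n. \<forall>R\<in>P n. Q \<noteq> R \<longrightarrow> (\<forall>x\<in>K n Q. \<forall>y\<in>K n R. d x y \<ge> \<delta>))"
      by (rule PE[THEN conjunct2, THEN conjunct2, rule_format, OF \<epsilon>'(1)])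
    then obtain \<delta> K where "\<delta> > 0" and *: "\<forall>n. (\<forall>Q\<in>P n. compact (K n Q) \<and> K n Q \<subseteq> Q \<and> measure (\<mu> n) (Q - K n Q) \<le> \<epsilon>') \<and>
            (\<forall>Q\<in>P n. \<forall>R\<in>P n. Q \<noteq> R \<longrightarrow> (\<forall>x\<in>K n Q. \<forall>y\<in>K n R. d x y \<ge> \<delta>))"
      by (elim exE conjE)
    then show ?thesis by (intro that[of \<delta> K]) simp_all
  qed
  define U where "U = (\<lambda>n::nat. (\<lambda>x. {y. d x y < \<delta>/2}) ` UNIV)"
  have U_open: "open_cover (U n)" for n
    unfolding open_cover_def
  proof (intro conjI ballI)
    show "open V" if "V \<in> U n" for V using that open_d_ball unfolding U_def by blast
    show "\<Union>(U n) = UNIV" unfolding U_def using \<delta> by auto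
  qed
  have U_leb: "lebesgue_number d (U n) (\<delta>/2)" for n
    unfolding lebesgue_number_def
  proof (intro conjI allI impI)
    fix S assume "\<exists>r<\<delta>/2. \<forall>x\<in>S. \<forall>y\<in>S. d x y \<le> r"
    then obtain r where r: "r < \<delta>/2" "\<forall>x\<in>S. \<forall>y\<in>S. d x y \<le> r" by blast
    show "\<exists>V\<in>U n. S \<subseteq> V"
    proof (cases "S = {}")
      case False
      then obtain x where "x \<in> S" by blast
      then have "S \<subseteq> {y. d x y < \<delta>/2}" using r by force
      then show ?thesis unfolding U_def by blast
    qed (auto simp: U_def)
  qed (use \<delta> in simp)
  have main: "shannon_entropy (\<mu> 0) (pullback_join f P n) \<le> ln (real (min_subcover_card (pullback_join f U n))) + 0 + real n * \<kappa>" for n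
  proof -
    have ms: "prob_space (\<mu> i)" "sets (\<mu> i) = sets borel" "distr (\<mu> i) borel (f i) = \<mu> (Suc i)" for i
      using \<mu> unfolding invariant_measure_seq_def by auto
    have sp: "space (\<mu> i) = UNIV" for i using sets_eq_imp_space_eq[OF ms(2)[of i]] by simp
    interpret prob_space "\<mu> 0" by (rule ms(1))
    interpret information_space "\<mu> 0" "exp 1" by unfold_locales simp
    have Fmeas: "iterate f 0 i \<in> measurable (\<mu> 0) borel" for i
      unfolding measurable_cong_sets[OF ms(2) refl]
      by (rule borel_measurable_continuous_onI, rule continuous_on_iterate, rule f)
    have push: "measure (\<mu> 0) (iterate f 0 i -` B) = measure (\<mu> i) B" if B: "B \<in> sets borel" for i B
    proof -
      have "distr (\<mu> 0) borel (iterate f 0 i) = \<mu> i"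
      proof (induction i)
        case 0
        show ?case using distr_id2[of borel "\<mu> 0"] ms(2) by (simp add: id_def)
      next
        case (Suc i)
        have fm: "f i \<in> measurable borel borel" by (rule borel_measurable_continuous_onI[OF f])
        have "distr (distr (\<mu> 0) borel (iterate f 0 i)) borel (f i) = distr (\<mu> 0) borel (f i \<circ> iterate f 0 i)"
          by (rule distr_distr[OF fm Fmeas])
        then show ?case using Suc ms(3) by (simp add: comp_def)
      qed
      then show ?thesis using measure_distr[OF Fmeas B] sp by (metis Int_UNIV_right)
    qed
    \<comment> \<open>an element of a minimal subcover\<close>
    obtain D where D: "D \<subseteq> pullback_join f U n" "finite D" "\<Union>D = UNIV" "card D = min_subcover_card (pullback_join f U n)"
    proof -
      have op: "\<And>V. V \<in> pullback_join f U n \<Longrightarrow> open V"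
      proof -
        fix V assume "V \<in> pullback_join f U n"
        then obtain s where s: "V = (\<Inter>i<n. iterate f 0 i -` s i)" "\<forall>i<n. s i \<in> U i" unfolding pullback_join_def by blast
        have "open (iterate f 0 i -` s i)" if "i < n" for i
          by (rule open_vimage[OF _ continuous_on_iterate[of f, OF f]]) (use s(2) that U_open in \<open>auto simp: open_cover_def\<close>)
        then show "open V" unfolding s(1) by (intro open_INT) auto
      qed
      have cov: "UNIV \<subseteq> \<Union>(pullback_join f U n)"
      proof
        fix x
        have "x \<in> (\<Inter>i<n. iterate f 0 i -` {y. d (iterate f 0 i x) y < \<delta>/2})" using \<delta> by simp
        moreover have "(\<Inter>i<n. iterate f 0 i -` {y. d (iterate f 0 i x) y < \<delta>/2}) \<in> pullback_join f U n"
          unfolding pullback_join_def U_def by (intro CollectI exI[of _ "\<lambda>i. {y. d (iterate f 0 i x) y < \<delta>/2}"]) auto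
        ultimately show "x \<in> \<Union>(pullback_join f U n)" by blast
      qed
      obtain D0 where "D0 \<subseteq> pullback_join f U n" "finite D0" "UNIV \<subseteq> \<Union>D0"
        using compactE[OF compact_space cov op] by metis
      then show ?thesis using min_subcover[of D0 "pullback_join f U n"] that by (metis top.extremum_uniqueI)
    qed
    from ex_bij_betw_nat_finite[OF D(2)] obtain V where "bij_betw V {0..<card D} D" by (rule exE)
    then have V: "bij_betw V {..<card D} D" by (simp add: atLeast0LessThan)
    define S where "S x = (LEAST j. j < card D \<and> x \<in> V j)" for x
    have S: "S x < card D \<and> x \<in> V (S x)" for x
    proof -
      have "x \<in> \<Union>D" unfolding D(3) by simp
      then obtain W where "W \<in> D" "x \<in> W" by (rule UnionE)
      moreover have "D = V ` {..<card D}" using bij_betw_imp_surj_on[OF V] by simp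
      ultimately obtain j where "j < card D \<and> x \<in> V j" by auto
      from LeastI[of "\<lambda>j. j < card D \<and> x \<in> V j", OF this] show ?thesis unfolding S_def .
    qed
    have Vopen: "open (V j)" if "j < card D" for j
    proof -
      have "V j \<in> D" using bij_betwE[OF V] that by blast
      then have "V j \<in> pullback_join f U n" using D(1) by blast
      then obtain s where s: "V j = (\<Inter>i<n. iterate f 0 i -` s i)" "\<forall>i<n. s i \<in> U i" unfolding pullback_join_def by blast
      have "open (iterate f 0 i -` s i)" if "i < n" for i
        by (rule open_vimage[OF _ continuous_on_iterate[of f, OF f]]) (use s(2) that U_open in \<open>auto simp: open_cover_def\<close>)
      then show "open (V j)" unfolding s(1) by (intro open_INT) auto
    qed
    have Ssf: "simple_function (\<mu> 0) S"
      unfolding simple_function_def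
    proof (intro conjI ballI)
      show "finite (S ` space (\<mu> 0))" by (rule finite_subset[of _ "{..<card D}"]) (use S in auto)
      fix j assume "j \<in> S ` space (\<mu> 0)"
      then have j: "j < card D" using S by auto
      have "S -` {j} = V j - (\<Union>l<j. V l)"
      proof (intro equalityI subsetI)
        fix x assume "x \<in> S -` {j}"
        then have sj: "S x = j" by simp
        have "x \<notin> V l" if "l < j" for l
          using not_less_Least[of l "\<lambda>j. j < card D \<and> x \<in> V j"] that j sj unfolding S_def by auto
        then show "x \<in> V j - (\<Union>l<j. V l)" using S[of x] sj by auto
      next
        fix x assume x: "x \<in> V j - (\<Union>l<j. V l)"
        have "S x = j" unfolding S_def
        proof (rule Least_equality)
          show "j < card D \<and> x \<in> V j" using j x by blast
          show "j \<le> l" if "l < card D \<and> x \<in> V l" for l using that x by (meson DiffD2 UN_I lessThan_iff not_le)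
        qed
        then show "x \<in> S -` {j}" by simp
      qed
      moreover have "open (\<Union>l<j. V l)" using Vopen j by (intro open_UN) auto
      ultimately show "S -` {j} \<inter> space (\<mu> 0) \<in> sets (\<mu> 0)"
        unfolding ms(2) sp using Vopen[OF j] by (simp add: borel_open sets.Diff)
    qed
    have HS: "entropy_Pow S \<le> ln (real (min_subcover_card (pullback_join f U n)))"
    proof -
      have "entropy_Pow S \<le> log (exp 1) (real (card (S ` space (\<mu> 0))))"
        by (rule entropy_simple_function_le_card[OF Ssf])
      also have "\<dots> \<le> ln (real (card D))"
      proof -
        have "card (S ` space (\<mu> 0)) \<le> card {..<card D}" by (rule card_mono) (use S in auto)
        moreover have "card (S ` space (\<mu> 0)) > 0" using simple_functionD(1)[OF Ssf] not_empty by (simp add: card_gt_0_iff)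
        ultimately show ?thesis by (simp add: log_def)
      qed
      finally show ?thesis using D(4) by simp
    qed
    \<comment> \<open>the cell, unless the point lies in the core of its cell\<close>
    define cell where "cell i y = (THE Q. Q \<in> P i \<and> y \<in> Q)" for i y
    have cell: "cell i y \<in> P i" "y \<in> cell i y" for i y
    proof -
      have "\<exists>!Q. Q \<in> P i \<and> y \<in> Q" using part(2)[of i] part(4)[of _ i] by (metis IntI UNIV_I UnionE empty_iff)
      from theI'[OF this] show "cell i y \<in> P i" "y \<in> cell i y" unfolding cell_def by auto
    qed
    have cell_eq: "cell i y = Q" if "Q \<in> P i" "y \<in> Q" for i y Q
      using part(4)[OF cell(1) that(1)] cell(2) that(2) by blast
    define Y where "Y i x = (let y = iterate f 0 i x in if y \<in> K i (cell i y) then None else Some (cell i y))" for i x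
    have Kb: "K i Q \<in> sets borel" if "Q \<in> P i" for i Q by (rule borel_compact[OF K(1)[OF that]])
    have Ysome: "Y i -` {Some Q} = iterate f 0 i -` (Q - K i Q)" if "Q \<in> P i" for i Q
      using that cell cell_eq by (auto simp: Y_def Let_def split: if_splits)
    have Ynone: "Y i -` {None} = iterate f 0 i -` (\<Union>Q\<in>P i. K i Q)" for i
    proof (intro equalityI subsetI)
      fix x assume "x \<in> Y i -` {None}"
      then have "iterate f 0 i x \<in> K i (cell i (iterate f 0 i x))" by (simp add: Y_def Let_def split: if_splits)
      then show "x \<in> iterate f 0 i -` (\<Union>Q\<in>P i. K i Q)" using cell(1) by blast
    next
      fix x assume "x \<in> iterate f 0 i -` (\<Union>Q\<in>P i. K i Q)"
      then obtain Q where Q: "Q \<in> P i" "iterate f 0 i x \<in> K i Q" by blast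
      then have "cell i (iterate f 0 i x) = Q" using K(2)[OF Q(1)] cell_eq by blast
      then show "x \<in> Y i -` {None}" using Q(2) by (simp add: Y_def Let_def)
    qed
    have Yim: "Y i ` UNIV \<subseteq> insert None (Some ` P i)" for i
      using cell(1) by (auto simp: Y_def Let_def)
    have Fs: "iterate f 0 i -` B \<in> sets (\<mu> 0)" if "B \<in> sets borel" for i B
      using measurable_sets[OF Fmeas that] sp by simp
    have Ysf: "simple_function (\<mu> 0) (Y i)" for i
      unfolding simple_function_def
    proof (intro conjI ballI)
      show "finite (Y i ` space (\<mu> 0))" unfolding sp by (rule finite_subset[OF Yim]) (use part(1) in simp)
      fix y assume "y \<in> Y i ` space (\<mu> 0)"
      then have "y \<in> insert None (Some ` P i)" unfolding sp by (rule subsetD[OF Yim])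
      then have "y = None \<or> (\<exists>Q\<in>P i. y = Some Q)" by auto
      then show "Y i -` {y} \<inter> space (\<mu> 0) \<in> sets (\<mu> 0)"
      proof
        assume "y = None"
        then show ?thesis unfolding sp using Ynone Fs[of "\<Union>Q\<in>P i. K i Q" i] Kb part(1) by (simp add: sets.finite_UN)
      next
        assume "\<exists>Q\<in>P i. y = Some Q"
        then obtain Q where "Q \<in> P i" "y = Some Q" by blast
        then show ?thesis unfolding sp using Ysome Fs[of "Q - K i Q" i] Kb[of Q i] part(3)[of i] by auto
      qed
    qed
    have HY: "entropy_Pow (Y i) \<le> \<kappa>" for i
    proof -
      have small: "prob (Y i -` {Some Q} \<inter> space (\<mu> 0)) \<le> \<epsilon>'" if "Q \<in> P i" for Q
      proof -
        have "Q - K i Q \<in> sets borel" using Kb[OF that] part(3)[of i] that by auto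
        then show ?thesis unfolding sp using Ysome[OF that] push[of "Q - K i Q" i] K(3)[OF that] by simp
      qed
      have "entropy_Pow (Y i) \<le> real (N + 1) * \<zeta>"
      proof (rule entropy_concentrated_le[OF refl Ysf _ _ _ _ \<epsilon>(3,4)])
        have "card (Y i ` space (\<mu> 0)) \<le> card (insert None (Some ` P i))"
          unfolding sp by (rule card_mono[OF _ Yim]) (use part(1) in simp)
        also have "\<dots> \<le> N + 1" using N[of i] part(1)[of i] by (simp add: card_insert_if card_image)
        finally show "card (Y i ` space (\<mu> 0)) \<le> N + 1" .
        have "space (\<mu> 0) - (Y i -` {None} \<inter> space (\<mu> 0)) = (\<Union>Q\<in>P i. Y i -` {Some Q} \<inter> space (\<mu> 0))"
        proof -
          have "Y i x = None \<or> Y i x \<in> Some ` P i" for x using subsetD[OF Yim[of i], of "Y i x"] by auto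
          then show ?thesis unfolding sp by fastforce
        qed
        moreover have "prob (\<Union>Q\<in>P i. Y i -` {Some Q} \<inter> space (\<mu> 0)) \<le> (\<Sum>Q\<in>P i. prob (Y i -` {Some Q} \<inter> space (\<mu> 0)))"
          by (rule finite_measure_subadditive_finite[OF part(1)]) (use simple_functionD(2)[OF Ysf] in auto)
        moreover have "\<dots> \<le> (\<Sum>Q\<in>P i. \<epsilon>')" by (rule sum_mono) (rule small)
        moreover have "(\<Sum>Q\<in>P i. \<epsilon>') \<le> real N * \<epsilon>'" using N[of i] \<epsilon>'(1) by simp
        moreover have "prob (space (\<mu> 0) - (Y i -` {None} \<inter> space (\<mu> 0))) = 1 - prob (Y i -` {None} \<inter> space (\<mu> 0))"
          by (rule prob_compl[OF simple_functionD(2)[OF Ysf]])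
        ultimately show "1 - \<epsilon> \<le> prob (Y i -` {None} \<inter> space (\<mu> 0))" using \<epsilon>'(3) by simp
        show "prob (Y i -` {y} \<inter> space (\<mu> 0)) \<le> \<epsilon>" if y: "y \<in> Y i ` space (\<mu> 0)" "y \<noteq> None" for y
        proof -
          have "y \<in> insert None (Some ` P i)" using y(1) unfolding sp by (rule subsetD[OF Yim])
          then obtain Q where "Q \<in> P i" "y = Some Q" using y(2) by auto
          then show ?thesis using small[of Q] \<epsilon>'(2) by simp
        qed
        show "0 \<le> \<zeta>" using \<zeta>(1) by simp
      qed
      then show ?thesis using \<zeta>(2) by simp
    qed
    \<comment> \<open>the itinerary\<close>
    define Z where "Z x = (\<Inter>i<n. iterate f 0 i -` cell i (iterate f 0 i x))" for x
    note J = pullback_join_partition[where P = P and f = f and n = n, OF fbp f]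
    have Zmem: "Z x \<in> pullback_join f P n" "x \<in> Z x" for x
      unfolding Z_def pullback_join_def using cell by (auto intro!: exI[of _ "\<lambda>i. cell i (iterate f 0 i x)"])
    have Zpre: "Z -` {C} = C" if "C \<in> pullback_join f P n" for C
    proof (intro equalityI subsetI)
      fix x assume "x \<in> Z -` {C}"
      then show "x \<in> C" using Zmem(2)[of x] by simp
    next
      fix x assume "x \<in> C"
      then show "x \<in> Z -` {C}" using J(4)[OF Zmem(1) that] Zmem(2)[of x] by blast
    qed
    have Zsf: "simple_function (\<mu> 0) Z"
      unfolding simple_function_def sp ms(2)
    proof (intro conjI ballI)
      show "finite (Z ` UNIV)" by (rule finite_subset[OF _ J(1)]) (use Zmem(1) in blast)
      fix C assume "C \<in> Z ` UNIV"
      then have "C \<in> pullback_join f P n" using Zmem(1) by blast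
      then show "Z -` {C} \<inter> UNIV \<in> sets borel" using Zpre J(3) by auto
    qed
    have HZ: "shannon_entropy (\<mu> 0) (pullback_join f P n) = entropy_Pow Z"
    proof -
      have "entropy_Pow Z = - (\<Sum>C\<in>Z ` UNIV. prob (Z -` {C}) * log (exp 1) (prob (Z -` {C})))"
        using entropy_simple_function_eq[OF Zsf] unfolding sp by simp
      also have "(\<Sum>C\<in>Z ` UNIV. prob (Z -` {C}) * log (exp 1) (prob (Z -` {C}))) = (\<Sum>C\<in>pullback_join f P n. prob C * ln (prob C))"
      proof (rule sum.mono_neutral_cong_left[OF J(1)])
        show "Z ` UNIV \<subseteq> pullback_join f P n" using Zmem(1) by blast
        show "\<forall>C\<in>pullback_join f P n - Z ` UNIV. prob C * ln (prob C) = 0"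
        proof
          fix C assume C: "C \<in> pullback_join f P n - Z ` UNIV"
          then have "C = Z -` {C}" using Zpre by blast
          also have "\<dots> = {}" using C by blast
          finally show "prob C * ln (prob C) = 0" by simp
        qed
        show "prob (Z -` {C}) * log (exp 1) (prob (Z -` {C})) = prob C * ln (prob C)" if "C \<in> Z ` UNIV" for C
          using that Zpre[of C] Zmem(1) by (auto simp: log_def)
      qed
      finally show ?thesis unfolding shannon_entropy_def by simp
    qed
    let ?W = "\<lambda>x. map (\<lambda>i. Y i x) [0..<n]"
    have W: "simple_function (\<mu> 0) ?W" "entropy_Pow ?W \<le> (\<Sum>i<n. entropy_Pow (Y i))" using entropy_map_le[of Y n] Ysf by auto
    have "entropy_Pow Z \<le> entropy_Pow (\<lambda>x. (S x, ?W x))"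
    proof (rule entropy_le_if_determined[OF simple_function_Pair[OF Ssf W(1)]])
      fix x x' assume eq: "(S x, ?W x) = (S x', ?W x')"
      have "cell i (iterate f 0 i x) = cell i (iterate f 0 i x')" if i: "i < n" for i
      proof -
        let ?y = "iterate f 0 i x" and ?y' = "iterate f 0 i x'"
        have Yeq: "Y i x = Y i x'" using eq i by (auto dest: map_eq_conv[THEN iffD1])
        show ?thesis
        proof (cases "Y i x")
          case None
          then have core: "?y \<in> K i (cell i ?y)" "?y' \<in> K i (cell i ?y')"
            using Yeq by (auto simp: Y_def Let_def split: if_splits)
          have "V (S x) \<in> D" using bij_betwE[OF V] S[of x] by blast
          then have "V (S x) \<in> pullback_join f U n" using D(1) by blast
          then obtain s where s: "V (S x) = (\<Inter>i<n. iterate f 0 i -` s i)" "\<forall>i<n. s i \<in> U i" unfolding pullback_join_def by blast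
          have "x \<in> V (S x)" "x' \<in> V (S x)" using S[of x] S[of x'] eq by auto
          then have "?y \<in> s i" "?y' \<in> s i" using s(1) i by auto
          moreover obtain z where "s i = {y. d z y < \<delta>/2}" using s(2) i unfolding U_def by blast
          ultimately have "d z ?y < \<delta>/2" "d z ?y' < \<delta>/2" by auto
          then have "d ?y ?y' < \<delta>" using d_triangle[of ?y ?y' z] d_sym[of ?y z] by simp
          then show ?thesis using K(4)[OF cell(1) cell(1) _ core] by fastforce
        next
          case (Some Q)
          then show ?thesis using Yeq by (auto simp: Y_def Let_def split: if_splits)
        qed
      qed
      then show "Z x = Z x'" unfolding Z_def by auto
    qed
    also have "\<dots> \<le> entropy_Pow S + entropy_Pow ?W" by (rule entropy_Pair_le[OF Ssf W(1)])
    also have "\<dots> \<le> ln (real (min_subcover_card (pullback_join f U n))) + (\<Sum>i<n. \<kappa>)"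
      using HS W(2) sum_mono[of "{..<n}" "\<lambda>i. entropy_Pow (Y i)" "\<lambda>_. \<kappa>"] HY by (intro add_mono) auto
    finally show ?thesis unfolding HZ by simp
  qed
  have "partition_entropy f P \<mu> \<le> cover_entropy f U + ereal \<kappa>"
    unfolding partition_entropy_def cover_entropy_def by (rule limsup_affine_le) (rule main)
  also have "cover_entropy f U \<le> topological_entropy d f"
    unfolding topological_entropy_def
    by (rule SUP_upper) (use U_open U_leb \<delta> in \<open>auto intro!: exI[of _ "\<delta>/2"]\<close>)
  then have "cover_entropy f U + ereal \<kappa> \<le> topological_entropy d f + ereal \<kappa>" by (rule add_right_mono)
  finally show "partition_entropy f P \<mu> \<le> topological_entropy d f + ereal \<kappa>" .
qed

context expanding_sequence
begin

section \<open>The topological entropy is bounded by the growth of the degrees\<close>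

definition log_degrees where "log_degrees n = (\<Sum>i<n. ln (real (deg i)))"

definition degree_growth where "degree_growth = limsup (\<lambda>n. ereal (log_degrees n / real n))"

lemma ln_prod_deg: "ln (real (\<Prod>i<n. deg i)) = log_degrees n"
  unfolding log_degrees_def using deg_pos by (simp add: ln_prod)

text \<open>The preimages of a finite net shadow all orbits.\<close>

lemma cover_entropy_le_degree_growth:
  assumes U: "\<And>n. open_cover (U n)" and leb: "\<And>n. lebesgue_number d (U n) \<delta>"
  shows "cover_entropy f U \<le> degree_growth"
proof -
  have \<delta>: "\<delta> > 0" using leb unfolding lebesgue_number_def by blast
  define \<epsilon> where "\<epsilon> = \<delta> / 4"
  have \<epsilon>: "\<epsilon> > 0" "2 * \<epsilon> < \<delta>" unfolding \<epsilon>_def using \<delta> by auto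
  obtain E where E: "finite E" "\<And>x. \<exists>e\<in>E. d e x < \<epsilon>" using finite_net[OF \<epsilon>(1)] by blast
  have Ene: "E \<noteq> {}" using E(2) by blast
  have "ln (real (min_subcover_card (pullback_join f U n))) \<le> log_degrees n + ln (real (card E)) + real n * 0" for n
  proof -
    define T where "T = (\<Union>e\<in>E. fibre 0 n e)"
    have T: "finite T" "card T \<le> card E * (\<Prod>i<n. deg i)"
    proof -
      show "finite T" unfolding T_def using E(1) card_fibre by blast
      have "card T \<le> (\<Sum>e\<in>E. card (fibre 0 n e))" unfolding T_def by (rule card_UN_le[OF E(1)])
      also have "\<dots> \<le> (\<Sum>e\<in>E. \<Prod>i<n. deg i)" by (rule sum_mono) (use card_fibre[of 0 n] in simp)
      finally show "card T \<le> card E * (\<Prod>i<n. deg i)" by simp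
    qed
    have "\<exists>V\<in>U i. {z. d (iterate f 0 i t) z < \<epsilon>} \<subseteq> V" for i t
    proof -
      have "d x y \<le> 2 * \<epsilon>" if "d (iterate f 0 i t) x < \<epsilon>" "d (iterate f 0 i t) y < \<epsilon>" for x y
        using d_triangle[of x y "iterate f 0 i t"] that d_sym[of x] by simp
      then have "\<exists>r<\<delta>. \<forall>x\<in>{z. d (iterate f 0 i t) z < \<epsilon>}. \<forall>y\<in>{z. d (iterate f 0 i t) z < \<epsilon>}. d x y \<le> r"
        using \<epsilon>(2) by (intro exI[of _ "2 * \<epsilon>"]) simp
      then show ?thesis using leb[of i] unfolding lebesgue_number_def by blast
    qed
    then obtain V where V: "\<And>i t. V i t \<in> U i" "\<And>i t. {z. d (iterate f 0 i t) z < \<epsilon>} \<subseteq> V i t" by metis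
    define W where "W t = (\<Inter>i<n. iterate f 0 i -` V i t)" for t
    have "min_subcover_card (pullback_join f U n) \<le> card (W ` T)"
    proof (rule min_subcover_card_le)
      show "W ` T \<subseteq> pullback_join f U n"
      proof (intro image_subsetI)
        fix t show "W t \<in> pullback_join f U n"
          unfolding pullback_join_def W_def using V(1) by (intro CollectI exI[of _ "\<lambda>i. V i t"]) simp
      qed
      show "finite (W ` T)" using T(1) by simp
      have "\<exists>t\<in>T. x \<in> W t" for x
      proof -
        obtain e where e: "e \<in> E" "d (iterate f 0 n x) e < \<epsilon>" using E(2)[of "iterate f 0 n x"] d_sym by auto
        obtain t where t: "iterate f 0 n t = e" "\<And>i. i \<le> n \<Longrightarrow> lam ^ (n - i) * d (iterate f 0 i x) (iterate f 0 i t) < \<epsilon>"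
          using lift_orbit[OF e(2)] by blast
        have "iterate f 0 i x \<in> V i t" if "i < n" for i
        proof -
          have "1 * d (iterate f 0 i x) (iterate f 0 i t) \<le> lam ^ (n - i) * d (iterate f 0 i x) (iterate f 0 i t)"
            using lam by (intro mult_right_mono) auto
          then have "d (iterate f 0 i t) (iterate f 0 i x) < \<epsilon>" using t(2)[of i] that d_sym by simp
          then show ?thesis using V(2) by blast
        qed
        then have "x \<in> W t" unfolding W_def by blast
        moreover have "t \<in> T" unfolding T_def fibre_def using e(1) t(1) by blast
        ultimately show ?thesis by blast
      qed
      then show "\<Union>(W ` T) = UNIV" by blast
    qed
    also have "card (W ` T) \<le> card T" by (rule card_image_le[OF T(1)])
    also have "card T \<le> card E * (\<Prod>i<n. deg i)" by (rule T(2))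
    finally have le: "min_subcover_card (pullback_join f U n) \<le> card E * (\<Prod>i<n. deg i)" .
    have cE: "card E > 0" using E(1) Ene by (simp add: card_gt_0_iff)
    have pp: "(\<Prod>i<n. deg i) > 0" using deg_pos by (simp add: prod_pos)
    have "ln (real (min_subcover_card (pullback_join f U n))) \<le> ln (real (card E * (\<Prod>i<n. deg i)))"
    proof (cases "min_subcover_card (pullback_join f U n) = 0")
      case True
      have "1 \<le> card E * (\<Prod>i<n. deg i)" using cE pp by (metis One_nat_def Suc_leI nat_0_less_mult_iff)
      then have "1 \<le> real (card E * (\<Prod>i<n. deg i))" by linarith
      then show ?thesis using True by simp
    next
      case False
      then have "0 < real (min_subcover_card (pullback_join f U n))" by simp
      moreover have "real (min_subcover_card (pullback_join f U n)) \<le> real (card E * (\<Prod>i<n. deg i))"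
        using le by (simp only: of_nat_le_iff)
      ultimately show ?thesis by (simp only: ln_le_cancel_iff less_le_trans)
    qed
    also have "\<dots> = ln (real (card E)) + ln (real (\<Prod>i<n. deg i))" using cE pp unfolding of_nat_mult by (simp add: ln_mult del: of_nat_prod)
    finally show ?thesis using ln_prod_deg by simp
  qed
  then have "cover_entropy f U \<le> degree_growth + ereal 0"
    unfolding cover_entropy_def degree_growth_def by (intro limsup_affine_le)
  then show ?thesis by simp
qed

lemma topological_entropy_le_degree_growth: "topological_entropy d f \<le> degree_growth"
  unfolding topological_entropy_def by (rule SUP_least) (use cover_entropy_le_degree_growth in blast)

section \<open>The random backward orbit\<close>

definition base :: 'a where "base = undefined"

definition distortion where "distortion = (SOME D. \<forall>k n y y'. \<exists>b. fibre_injection k n D y y' b)"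

definition transport where "transport N y = (SOME b. fibre_injection 0 N distortion base y b)"

definition pre_enum where "pre_enum N = (SOME q. bij_betw q {..<deg N} (f N -` {base}))"

lemma transport: "fibre_injection 0 N distortion base y (transport N y)"
proof -
  have "\<forall>k n y y'. \<exists>b. fibre_injection k n distortion y y' b"
    unfolding distortion_def by (rule someI_ex) (rule fibre_injection_uniform)
  then have "\<exists>b. fibre_injection 0 N distortion base y b" by blast
  then show ?thesis unfolding transport_def by (rule someI_ex)
qed

lemma pre_enum: "bij_betw (pre_enum N) {..<deg N} (f N -` {base})"
proof -
  have "\<exists>q. bij_betw q {..<deg N} (f N -` {base})"
    using ex_bij_betw_nat_finite[OF finite_preimage, of N base] by (simp add: card_preimage atLeast0LessThan)
  then show ?thesis unfolding pre_enum_def by (rule someI_ex)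
qed

lemma distortion_nonneg: "0 \<le> distortion"
proof -
  have b: "fibre_injection 0 0 distortion base base (transport 0 base)" by (rule transport)
  have "base \<in> fibre 0 0 base" by (simp add: fibre_def)
  then have "lam ^ (0 - 0) * d (iterate f 0 0 base) (iterate f 0 0 (transport 0 base base)) \<le> distortion"
    using b unfolding fibre_injection_def by blast
  moreover have "0 \<le> lam ^ (0 - 0) * d (iterate f 0 0 base) (iterate f 0 0 (transport 0 base base))" by simp
  ultimately show ?thesis by linarith
qed

text \<open>The preimage of the base point under \<open>N\<close> steps that is selected by the digits of \<open>\<omega>\<close>: the
  digit \<open>N\<close> chooses a preimage of the base point, to which the previous point is transported.\<close>

primrec tree_point :: "nat \<Rightarrow> (nat \<Rightarrow> nat) \<Rightarrow> 'a" where
  "tree_point 0 \<omega> = base"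
| "tree_point (Suc N) \<omega> = transport N (pre_enum N (\<omega> N)) (tree_point N \<omega>)"

definition codes where "codes = {\<omega>. \<forall>i. \<omega> i < deg i}"

lemma tree_point_in_fibre:
  assumes "\<omega> \<in> codes"
  shows "tree_point N \<omega> \<in> fibre 0 N base"
proof (induction N)
  case 0
  then show ?case by (simp add: fibre_def)
next
  case (Suc N)
  have "f N (pre_enum N (\<omega> N)) = base"
    using bij_betwE[OF pre_enum, of N] assms unfolding codes_def by auto
  moreover have "tree_point (Suc N) \<omega> \<in> fibre 0 N (pre_enum N (\<omega> N))"
    using transport Suc unfolding fibre_injection_def by auto
  ultimately show ?case by (simp add: fibre_def)
qed

lemma tree_point_determines_digits:
  assumes "\<omega> \<in> codes" "\<omega>' \<in> codes" "tree_point N \<omega> = tree_point N \<omega>'" "i < N"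
  shows "\<omega> i = \<omega>' i"
  using assms(3,4)
proof (induction N arbitrary: i)
  case (Suc N)
  have mem: "tree_point N \<omega>'' \<in> fibre 0 N base" "\<omega>'' N < deg N" if "\<omega>'' \<in> codes" for \<omega>''
    using tree_point_in_fibre that unfolding codes_def by auto
  have tr: "iterate f 0 N (tree_point (Suc N) \<omega>'') = pre_enum N (\<omega>'' N)" if "\<omega>'' \<in> codes" for \<omega>''
    using transport mem(1)[OF that] unfolding fibre_injection_def by (auto simp: fibre_def)
  have "pre_enum N (\<omega> N) = pre_enum N (\<omega>' N)" using tr[OF assms(1)] tr[OF assms(2)] Suc.prems(1) by simp
  then have N: "\<omega> N = \<omega>' N"
    using pre_enum mem(2)[OF assms(1)] mem(2)[OF assms(2)] unfolding bij_betw_def inj_on_def by blast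
  have "inj_on (transport N (pre_enum N (\<omega> N))) (fibre 0 N base)" using transport unfolding fibre_injection_def by blast
  then have eq: "tree_point N \<omega> = tree_point N \<omega>'"
    by (rule inj_onD[OF _ _ mem(1)[OF assms(1)] mem(1)[OF assms(2)]]) (use Suc.prems(1) N in simp)
  show ?case
  proof (cases "i = N")
    case False
    then show ?thesis using Suc.IH[OF eq] Suc.prems(2) by simp
  qed (simp add: N)
qed simp

lemma tree_point_step:
  assumes "\<omega> \<in> codes" "i \<le> N"
  shows "lam ^ (N - i) * d (iterate f 0 i (tree_point N \<omega>)) (iterate f 0 i (tree_point (Suc N) \<omega>)) \<le> distortion"
  using transport tree_point_in_fibre[OF assms(1)] assms(2) unfolding fibre_injection_def by simp

text \<open>The sum of the geometric series of the errors.\<close>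

definition total_error where "total_error = distortion * lam / (lam - 1)"

lemma total_error: "0 \<le> total_error" "distortion + total_error / lam = total_error"
proof -
  show "0 \<le> total_error" unfolding total_error_def using lam distortion_nonneg by simp
  have "distortion * (lam - 1) + distortion = distortion * lam" by (simp add: algebra_simps)
  then show "distortion + total_error / lam = total_error" unfolding total_error_def using lam
    by (simp add: field_simps)
qed

text \<open>The points whose orbit is as close to the orbit of the tree point as that of the limit should be.
  These sets are compact and nested, so that their intersection provides the limit.\<close>

definition shadow_set where
  "shadow_set N \<omega> = {y. \<forall>i\<le>N. lam ^ (N - i) * d (iterate f 0 i (tree_point N \<omega>)) (iterate f 0 i y) \<le> total_error}"

lemma closed_shadow_set: "closed (shadow_set N \<omega>)"
proof -
  have "shadow_set N \<omega> = (\<Inter>i\<in>{..N}. {y. lam ^ (N - i) * d (iterate f 0 i (tree_point N \<omega>)) (iterate f 0 i y) \<le> total_error})"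
    unfolding shadow_set_def by auto
  moreover have "closed {y. lam ^ (N - i) * d (iterate f 0 i (tree_point N \<omega>)) (iterate f 0 i y) \<le> total_error}" for i
  proof (rule closed_Collect_le)
    show "continuous_on UNIV (\<lambda>y. lam ^ (N - i) * d (iterate f 0 i (tree_point N \<omega>)) (iterate f 0 i y))"
      by (intro continuous_intros continuous_on_compose2[OF continuous_on_d continuous_on_iterate[of f, OF continuous_f]]) auto
  qed (rule continuous_on_const)
  ultimately show ?thesis by (simp add: closed_INT)
qed

lemma shadow_set_Suc:
  assumes "\<omega> \<in> codes"
  shows "shadow_set (Suc N) \<omega> \<subseteq> shadow_set N \<omega>"
proof
  fix y assume y: "y \<in> shadow_set (Suc N) \<omega>"
  have "lam ^ (N - i) * d (iterate f 0 i (tree_point N \<omega>)) (iterate f 0 i y) \<le> total_error" if i: "i \<le> N" for i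
  proof -
    let ?a = "iterate f 0 i (tree_point N \<omega>)" and ?b = "iterate f 0 i (tree_point (Suc N) \<omega>)" and ?c = "iterate f 0 i y"
    have "lam ^ (Suc N - i) * d ?b ?c \<le> total_error" using y i unfolding shadow_set_def by (simp del: tree_point.simps)
    then have 1: "lam ^ (N - i) * d ?b ?c \<le> total_error / lam" using lam i by (simp add: Suc_diff_le field_simps del: tree_point.simps)
    have "lam ^ (N - i) * d ?a ?c \<le> lam ^ (N - i) * (d ?a ?b + d ?b ?c)"
      using d_triangle lam by (intro mult_left_mono) auto
    also have "\<dots> \<le> distortion + total_error / lam"
      unfolding distrib_left using tree_point_step[OF assms i] 1 by (rule add_mono)
    finally show ?thesis using total_error(2) by simp
  qed
  then show "y \<in> shadow_set N \<omega>" unfolding shadow_set_def by blast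
qed

definition limit_point where "limit_point \<omega> = (SOME x. \<forall>N. x \<in> shadow_set N \<omega>)"

lemma limit_point:
  assumes "\<omega> \<in> codes"
  shows "limit_point \<omega> \<in> shadow_set N \<omega>"
proof -
  have anti: "shadow_set M \<omega> \<subseteq> shadow_set N \<omega>" if "N \<le> M" for N M
    using that by (induction M rule: dec_induct) (use shadow_set_Suc[OF assms] in auto)
  have ne: "tree_point N \<omega> \<in> shadow_set N \<omega>" for N unfolding shadow_set_def using total_error(1) by simp
  have "UNIV \<inter> (\<Inter>N\<in>UNIV. shadow_set N \<omega>) \<noteq> {}"
  proof (rule compact_imp_fip_image[OF compact_space])
    show "closed (shadow_set N \<omega>)" for N by (rule closed_shadow_set)
    fix I' :: "nat set" assume I': "finite I'"
    have "tree_point (Max (insert 0 I')) \<omega> \<in> shadow_set N \<omega>" if "N \<in> I'" for N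
      using anti[of N "Max (insert 0 I')"] ne I' that by (meson Max_ge finite_insert insertI2 subsetD)
    then show "UNIV \<inter> (\<Inter>N\<in>I'. shadow_set N \<omega>) \<noteq> {}" by blast
  qed
  then have "\<exists>x. \<forall>N. x \<in> shadow_set N \<omega>" by blast
  then have "\<forall>N. limit_point \<omega> \<in> shadow_set N \<omega>" unfolding limit_point_def by (rule someI_ex)
  then show ?thesis by blast
qed

lemma limit_point_near:
  assumes "\<omega> \<in> codes" "i \<le> N"
  shows "d (iterate f 0 i (tree_point N \<omega>)) (iterate f 0 i (limit_point \<omega>)) \<le> total_error / lam ^ (N - i)"
  using limit_point[OF assms(1), of N] assms(2) lam unfolding shadow_set_def by (simp add: field_simps)

lemma error_small:
  assumes "0 < e" shows "\<exists>m. total_error / lam ^ m < e"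
proof -
  have "(\<lambda>m. total_error / lam ^ m) \<longlonglongrightarrow> 0" by (rule LIMSEQ_divide_realpow_zero[OF lam])
  then have "\<forall>\<^sub>F m in sequentially. total_error / lam ^ m < e" using assms by (rule order_tendstoD)
  then show ?thesis by (auto simp: eventually_sequentially)
qed

section \<open>The law of the limit\<close>

definition digit_measure where "digit_measure i = uniform_count_measure {..<deg i}"

definition code_measure where "code_measure = PiM UNIV digit_measure"

lemma product_prob_space_digits: "product_prob_space digit_measure"
proof -
  have "prob_space (digit_measure i)" for i
    unfolding digit_measure_def using deg_pos[of i] by (intro prob_space_uniform_count_measure) auto
  then show ?thesis
    unfolding product_prob_space_def product_prob_space_axioms_def product_sigma_finite_def
    by (auto intro: prob_space_imp_sigma_finite)
qed

lemma prob_space_code_measure: "prob_space code_measure"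
proof -
  interpret product_prob_space digit_measure UNIV by (rule product_prob_space_digits)
  show ?thesis unfolding code_measure_def by (rule prob_space_axioms)
qed

lemma space_code_measure: "space code_measure = codes"
  unfolding code_measure_def space_PiM digit_measure_def codes_def by (auto simp: space_uniform_count_measure PiE_UNIV_domain)

lemma measure_cylinder_le:
  assumes "\<omega>0 \<in> codes"
  shows "{\<omega>\<in>codes. \<forall>i<N. \<omega> i = \<omega>0 i} \<in> sets code_measure"
    and "measure code_measure {\<omega>\<in>codes. \<forall>i<N. \<omega> i = \<omega>0 i} = 1 / real (\<Prod>i<N. deg i)"
proof -
  interpret product_prob_space digit_measure UNIV by (rule product_prob_space_digits)
  have s: "{\<omega>0 i} \<in> sets (digit_measure i)" for i
    unfolding digit_measure_def using assms by (simp add: sets_uniform_count_measure codes_def)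
  have eq: "{\<omega>\<in>codes. \<forall>i<N. \<omega> i = \<omega>0 i} = {\<omega>\<in>space (PiM UNIV digit_measure). \<forall>i\<in>{..<N}. \<omega> i \<in> {\<omega>0 i}}"
    using space_code_measure unfolding code_measure_def by auto
  have "emeasure (PiM UNIV digit_measure) {\<omega>\<in>space (PiM UNIV digit_measure). \<forall>i\<in>{..<N}. \<omega> i \<in> {\<omega>0 i}} =
      (\<Prod>i\<in>{..<N}. emeasure (digit_measure i) {\<omega>0 i})"
    by (rule emeasure_PiM_Collect) (use s in auto)
  also have "\<dots> = (\<Prod>i<N. ennreal (1 / real (deg i)))"
  proof (rule prod.cong[OF refl])
    fix i
    have "emeasure (digit_measure i) {\<omega>0 i} = card {\<omega>0 i} / card {..<deg i}"
      unfolding digit_measure_def by (rule emeasure_uniform_count_measure) (use assms in \<open>auto simp: codes_def\<close>)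
    then show "emeasure (digit_measure i) {\<omega>0 i} = ennreal (1 / real (deg i))" by simp
  qed
  also have "\<dots> = ennreal (\<Prod>i<N. 1 / real (deg i))" by (rule prod_ennreal) simp
  also have "(\<Prod>i<N. 1 / real (deg i)) = 1 / real (\<Prod>i<N. deg i)" by (simp add: prod_dividef)
  finally show "measure code_measure {\<omega>\<in>codes. \<forall>i<N. \<omega> i = \<omega>0 i} = 1 / real (\<Prod>i<N. deg i)"
    unfolding eq code_measure_def by (simp add: measure_def del: of_nat_prod)
  have "{\<omega>\<in>space (PiM UNIV digit_measure). \<forall>i\<in>{..<N}. \<omega> i \<in> {\<omega>0 i}} \<in> sets (PiM UNIV digit_measure)"
  proof (rule sets.sets_Collect_finite_All)
    fix i show "{\<omega> \<in> space (PiM UNIV digit_measure). \<omega> i \<in> {\<omega>0 i}} \<in> sets (PiM UNIV digit_measure)"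
      using measurable_sets[OF measurable_component_singleton[of i UNIV digit_measure] s]
      by (simp add: vimage_def Int_def conj_commute)
  qed auto
  then show "{\<omega>\<in>codes. \<forall>i<N. \<omega> i = \<omega>0 i} \<in> sets code_measure" unfolding eq code_measure_def .
qed

lemma tree_point_measurable: "{\<omega>\<in>codes. tree_point N \<omega> \<in> B} \<in> sets code_measure"
proof (induction N arbitrary: B)
  case 0
  have "{\<omega>\<in>codes. tree_point 0 \<omega> \<in> B} = (if base \<in> B then space code_measure else {})"
    unfolding space_code_measure by auto
  then show ?case by simp
next
  case (Suc N)
  have eq: "{\<omega>\<in>codes. tree_point (Suc N) \<omega> \<in> B} =
      (\<Union>j\<in>{..<deg N}. {\<omega>\<in>codes. \<omega> N = j} \<inter> {\<omega>\<in>codes. tree_point N \<omega> \<in> transport N (pre_enum N j) -` B})"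
    by (auto simp: codes_def)
  have digit: "{\<omega>\<in>codes. \<omega> N = j} \<in> sets code_measure" if "j < deg N" for j
  proof -
    have "{j} \<in> sets (digit_measure N)" unfolding digit_measure_def using that by (simp add: sets_uniform_count_measure)
    from measurable_sets[OF measurable_component_singleton[of N UNIV digit_measure] this]
    have "{\<omega> \<in> space (PiM UNIV digit_measure). \<omega> N = j} \<in> sets (PiM UNIV digit_measure)"
      by (simp add: vimage_def Int_def conj_commute)
    then show ?thesis using space_code_measure unfolding code_measure_def by simp
  qed
  show ?case unfolding eq
    by (intro sets.finite_UN sets.Int Suc.IH finite_lessThan) (use digit in simp)
qed

text \<open>The limit lies in a closed set if and only if, at every stage, the set comes as close to the tree
  point as the limit is bound to be.\<close>

lemma limit_point_measurable: "limit_point \<in> borel_measurable code_measure"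
proof (rule borel_measurableI)
  fix S :: "'a set" assume S: "open S"
  define C where "C = - S"
  have "limit_point -` C \<inter> space code_measure =
      (\<Inter>N. {\<omega>\<in>codes. tree_point N \<omega> \<in> {t. \<exists>y\<in>C. d t y \<le> total_error / lam ^ N}})"
  proof (intro equalityI subsetI)
    fix \<omega> assume "\<omega> \<in> limit_point -` C \<inter> space code_measure"
    then have \<omega>: "\<omega> \<in> codes" "limit_point \<omega> \<in> C" using space_code_measure by auto
    then show "\<omega> \<in> (\<Inter>N. {\<omega>\<in>codes. tree_point N \<omega> \<in> {t. \<exists>y\<in>C. d t y \<le> total_error / lam ^ N}})"
      using limit_point_near[OF \<omega>(1), of 0] by auto
  next
    fix \<omega> assume "\<omega> \<in> (\<Inter>N. {\<omega>\<in>codes. tree_point N \<omega> \<in> {t. \<exists>y\<in>C. d t y \<le> total_error / lam ^ N}})"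
    then have \<omega>: "\<omega> \<in> codes" "\<And>N. \<exists>y\<in>C. d (tree_point N \<omega>) y \<le> total_error / lam ^ N" by auto
    have "limit_point \<omega> \<in> C"
    proof (rule ccontr)
      assume "limit_point \<omega> \<notin> C"
      then have "limit_point \<omega> \<in> S" unfolding C_def by simp
      then obtain e where e: "e > 0" "\<And>y. d (limit_point \<omega>) y < e \<Longrightarrow> y \<in> S" using S unfolding open_iff_d by blast
      obtain m where m: "total_error / lam ^ m < e / 2" using error_small[of "e/2"] e(1) by auto
      obtain y where y: "y \<in> C" "d (tree_point m \<omega>) y \<le> total_error / lam ^ m" using \<omega>(2) by blast
      have "d (limit_point \<omega>) y \<le> d (tree_point m \<omega>) (limit_point \<omega>) + d (tree_point m \<omega>) y"
        using d_triangle[of "limit_point \<omega>" y "tree_point m \<omega>"] d_sym[of "limit_point \<omega>"] by simp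
      also have "\<dots> \<le> total_error / lam ^ m + total_error / lam ^ m"
        using limit_point_near[OF \<omega>(1), of 0 m] y(2) by (intro add_mono) simp_all
      also have "\<dots> < e" using m by linarith
      finally show False using e(2) y(1) unfolding C_def by blast
    qed
    then show "\<omega> \<in> limit_point -` C \<inter> space code_measure" using \<omega>(1) space_code_measure by simp
  qed
  moreover have "(\<Inter>N. {\<omega>\<in>codes. tree_point N \<omega> \<in> {t. \<exists>y\<in>C. d t y \<le> total_error / lam ^ N}}) \<in> sets code_measure"
    by (rule sets.countable_INT, rule image_subsetI, rule tree_point_measurable, rule UNIV_not_empty)
  ultimately have "limit_point -` C \<inter> space code_measure \<in> sets code_measure" by simp
  then have "space code_measure - (limit_point -` C \<inter> space code_measure) \<in> sets code_measure" by (rule sets.compl_sets)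
  also have "space code_measure - (limit_point -` C \<inter> space code_measure) = limit_point -` S \<inter> space code_measure"
    unfolding C_def by auto
  finally show "limit_point -` S \<inter> space code_measure \<in> sets code_measure" .
qed

definition tree_measure where "tree_measure = distr code_measure borel limit_point"

text \<open>If the orbits of two limits stay close for \<open>n\<close> steps, then so do the orbits of their
  approximations at a slightly later stage. These are separated by their position after \<open>n\<close>
  steps, hence few of them are possible, and each has the same small probability.\<close>

lemma tree_measure_le:
  assumes S: "S \<in> sets borel"
    and close: "\<And>x x' i. x \<in> S \<Longrightarrow> x' \<in> S \<Longrightarrow> i < n \<Longrightarrow> d (iterate f 0 i x) (iterate f 0 i x') < inj_radius / 2"
  shows "measure tree_measure S \<le> 1 / real (\<Prod>i<n. deg i)"
proof -
  interpret prob_space code_measure by (rule prob_space_code_measure)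
  obtain m where m: "total_error / lam ^ m < inj_radius / 4" using error_small[of "inj_radius / 4"] inj_radius(1) by auto
  define N where "N = n + m"
  define \<Omega> where "\<Omega> = {\<omega>\<in>codes. limit_point \<omega> \<in> S}"
  define T where "T = tree_point N ` \<Omega>"
  have near: "d (iterate f 0 i (tree_point N \<omega>)) (iterate f 0 i (limit_point \<omega>)) < inj_radius / 4" if "\<omega> \<in> codes" "i < n" for \<omega> i
  proof -
    have "d (iterate f 0 i (tree_point N \<omega>)) (iterate f 0 i (limit_point \<omega>)) \<le> total_error / lam ^ (N - i)"
      by (rule limit_point_near[OF that(1)]) (use that(2) N_def in simp)
    also have "\<dots> \<le> total_error / lam ^ m"
      using that(2) total_error(1) lam unfolding N_def by (intro divide_left_mono power_increasing) auto
    also have "\<dots> < inj_radius / 4" by (rule m)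
    finally show ?thesis .
  qed
  have sub: "T \<subseteq> fibre 0 N base" unfolding T_def \<Omega>_def using tree_point_in_fibre by auto
  have finT: "finite T" by (rule finite_subset[OF sub]) (use card_fibre in blast)
  have "inj_on (iterate f 0 n) T"
  proof (rule inj_onI)
    fix t t' assume t: "t \<in> T" "t' \<in> T" "iterate f 0 n t = iterate f 0 n t'"
    obtain \<omega> \<omega>' where \<omega>: "\<omega> \<in> codes" "limit_point \<omega> \<in> S" "t = tree_point N \<omega>"
      "\<omega>' \<in> codes" "limit_point \<omega>' \<in> S" "t' = tree_point N \<omega>'" using t(1,2) unfolding T_def \<Omega>_def by auto
    show "t = t'"
    proof (rule orbits_separate[OF t(3)])
      fix i assume i: "i < n"
      let ?F = "iterate f 0 i"
      have "d (?F t) (?F t') \<le> d (?F t) (?F (limit_point \<omega>)) + (d (?F (limit_point \<omega>)) (?F (limit_point \<omega>')) + d (?F t') (?F (limit_point \<omega>')))"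
        using d_triangle[of "?F t" "?F t'" "?F (limit_point \<omega>)"] d_triangle[of "?F (limit_point \<omega>)" "?F t'" "?F (limit_point \<omega>')"]
          d_sym[of "?F t'" "?F (limit_point \<omega>')"] by simp
      then show "d (?F t) (?F t') < inj_radius"
        using near[OF \<omega>(1) i] near[OF \<omega>(4) i] close[OF \<omega>(2,5) i] unfolding \<omega>(3,6) by linarith
    qed
  qed
  moreover have "iterate f 0 n ` T \<subseteq> fibre n m base"
    using sub unfolding N_def fibre_def iterate_add by auto
  ultimately have "card T \<le> card (fibre n m base)" using card_fibre by (intro card_inj_on_le) auto
  then have cardT: "card T \<le> (\<Prod>i<m. deg (n + i))" using card_fibre[of n m base] by simp
  have pos: "(\<Prod>i<k. deg (l + i)) > 0" for k l using deg_pos by (simp add: prod_pos)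
  have prod: "(\<Prod>i<N. deg i) = (\<Prod>i<n. deg i) * (\<Prod>i<m. deg (n + i))"
    unfolding N_def by (induction m) (simp_all add: mult.assoc)
  have single: "prob {\<omega>\<in>codes. tree_point N \<omega> = t} \<le> 1 / real (\<Prod>i<N. deg i)" for t
  proof (cases "\<exists>\<omega>0\<in>codes. tree_point N \<omega>0 = t")
    case True
    then obtain \<omega>0 where \<omega>0: "\<omega>0 \<in> codes" "tree_point N \<omega>0 = t" by blast
    have "prob {\<omega>\<in>codes. tree_point N \<omega> = t} \<le> prob {\<omega>\<in>codes. \<forall>i<N. \<omega> i = \<omega>0 i}"
      by (rule finite_measure_mono[OF _ measure_cylinder_le(1)[OF \<omega>0(1)]])
        (use tree_point_determines_digits[OF _ \<omega>0(1)] \<omega>0(2) in auto)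
    then show ?thesis using measure_cylinder_le(2)[OF \<omega>0(1)] by simp
  next
    case False
    then have "{\<omega>\<in>codes. tree_point N \<omega> = t} = {}" by auto
    then show ?thesis by (simp only: measure_empty) (simp add: prod_nonneg)
  qed
  have "measure tree_measure S = prob (limit_point -` S \<inter> space code_measure)"
    unfolding tree_measure_def by (rule measure_distr[OF limit_point_measurable S])
  also have "\<dots> \<le> prob (\<Union>t\<in>T. {\<omega>\<in>codes. tree_point N \<omega> = t})"
  proof (rule finite_measure_mono)
    show "limit_point -` S \<inter> space code_measure \<subseteq> (\<Union>t\<in>T. {\<omega>\<in>codes. tree_point N \<omega> = t})"
      unfolding T_def \<Omega>_def space_code_measure by auto
    show "(\<Union>t\<in>T. {\<omega>\<in>codes. tree_point N \<omega> = t}) \<in> sets code_measure"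
      by (rule sets.finite_UN[OF finT]) (use tree_point_measurable[of N "{_}"] in simp)
  qed
  also have "\<dots> \<le> (\<Sum>t\<in>T. prob {\<omega>\<in>codes. tree_point N \<omega> = t})"
    by (rule finite_measure_subadditive_finite[OF finT]) (use tree_point_measurable[of N "{_}"] in auto)
  also have "\<dots> \<le> (\<Sum>t\<in>T. 1 / real (\<Prod>i<N. deg i))" by (rule sum_mono) (rule single)
  also have "\<dots> = real (card T) * (1 / real (\<Prod>i<N. deg i))" by simp
  also have "\<dots> \<le> real (\<Prod>i<m. deg (n + i)) * (1 / real (\<Prod>i<N. deg i))"
    using cardT by (intro mult_right_mono) (simp_all del: of_nat_prod)
  also have "\<dots> = 1 / real (\<Prod>i<n. deg i)" unfolding prod using pos[of n m] by (simp del: of_nat_prod)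
  finally show ?thesis .
qed

definition tree_sequence where "tree_sequence n = distr tree_measure borel (iterate f 0 n)"

lemma invariant_tree_sequence: "invariant_measure_seq f tree_sequence"
  unfolding invariant_measure_seq_def
proof (intro allI conjI)
  fix n
  interpret C: prob_space code_measure by (rule prob_space_code_measure)
  interpret T: prob_space tree_measure unfolding tree_measure_def by (rule C.prob_space_distr[OF limit_point_measurable])
  have sT: "sets tree_measure = sets borel" unfolding tree_measure_def by simp
  have F: "iterate f 0 k \<in> measurable tree_measure borel" for k
    unfolding measurable_cong_sets[OF sT refl]
    by (rule borel_measurable_continuous_onI, rule continuous_on_iterate, rule continuous_f)
  show "prob_space (tree_sequence n)" unfolding tree_sequence_def by (rule T.prob_space_distr[OF F])
  show "sets (tree_sequence n) = sets borel" unfolding tree_sequence_def by simp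
  have fn: "f n \<in> borel_measurable borel" by (rule borel_measurable_continuous_onI[OF continuous_f])
  have "distr (tree_sequence n) borel (f n) = distr tree_measure borel (f n \<circ> iterate f 0 n)"
    unfolding tree_sequence_def by (rule distr_distr[OF fn F])
  then show "distr (tree_sequence n) borel (f n) = tree_sequence (Suc n)" unfolding tree_sequence_def by (simp add: comp_def)
qed

lemma tree_sequence_0: "tree_sequence 0 = tree_measure"
proof -
  have "sets tree_measure = sets borel" unfolding tree_measure_def by simp
  then show ?thesis unfolding tree_sequence_def by (simp add: id_def distr_id2)
qed

end

section \<open>Partitions with uniformly thin boundaries\<close>

text \<open>Of \<open>N\<close> disjoint intervals of radii, one has probability at most \<open>1 / N\<close>; take its middle third.\<close>

lemma (in prob_space) thin_interval:
  fixes h :: "'a \<Rightarrow> real"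
  assumes h: "h \<in> borel_measurable M" and N: "0 < N" and w: "0 < w"
  shows "\<exists>u'\<ge>u. u' + w / (3 * real N) \<le> u + w \<and>
    (\<forall>\<rho>\<in>{u'..u' + w / (3 * real N)}. prob {x\<in>space M. \<bar>h x - \<rho>\<bar> < w / (3 * real N)} \<le> 1 / real N)"
proof -
  define v where "v = w / real N"
  have v: "v > 0" "real N * v = w" "w / (3 * real N) = v / 3" unfolding v_def using N w by auto
  define J where "J i = {x\<in>space M. u + real i * v < h x \<and> h x < u + (real i + 1) * v}" for i
  have J: "J i \<in> events" for i unfolding J_def using h by measurable
  have "disjoint_family_on J {..<N}"
    unfolding disjoint_family_on_def
  proof (intro ballI impI)
    fix i j :: nat assume "i \<noteq> j"
    have "J i \<inter> J j = {}" if "i < j" for i j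
    proof -
      have "real i + 1 \<le> real j" using that by simp
      then have "(real i + 1) * v \<le> real j * v" using v(1) by (intro mult_right_mono) auto
      then show ?thesis unfolding J_def by force
    qed
    then show "J i \<inter> J j = {}" using \<open>i \<noteq> j\<close> by (metis Int_commute linorder_neqE_nat)
  qed
  then have "prob (\<Union>i\<in>{..<N}. J i) = (\<Sum>i\<in>{..<N}. prob (J i))"
    by (intro finite_measure_finite_Union) (use J in auto)
  then have sum: "(\<Sum>i<N. prob (J i)) \<le> 1" using prob_le_1 by metis
  have "\<exists>i<N. prob (J i) \<le> 1 / real N"
  proof (rule ccontr)
    assume "\<not> ?thesis"
    then have "(\<Sum>i<N. 1 / real N) < (\<Sum>i<N. prob (J i))" using N by (intro sum_strict_mono) auto
    then show False using sum N by simp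
  qed
  then obtain i where i: "i < N" "prob (J i) \<le> 1 / real N" by blast
  define u' where "u' = u + real i * v + v / 3"
  have "(real i + 1) * v \<le> real N * v" using i(1) v(1) by (intro mult_right_mono) auto
  then have iv: "real i * v + v \<le> w" using v(2) by (simp add: distrib_right)
  have iv0: "0 \<le> real i * v" using v(1) by simp
  show ?thesis
  proof (intro exI[of _ u'] conjI ballI)
    show "u \<le> u'" unfolding u'_def using iv0 v(1) by simp
    show "u' + w / (3 * real N) \<le> u + w" unfolding v(3) u'_def using iv v(1) by linarith
    fix \<rho> assume "\<rho> \<in> {u'..u' + w / (3 * real N)}"
    then have \<rho>: "u + real i * v + v / 3 \<le> \<rho>" "\<rho> \<le> u + real i * v + v / 3 + v / 3" unfolding v(3) u'_def by auto
    have "{x\<in>space M. \<bar>h x - \<rho>\<bar> < w / (3 * real N)} \<subseteq> J i"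
    proof
      fix x assume "x \<in> {x\<in>space M. \<bar>h x - \<rho>\<bar> < w / (3 * real N)}"
      then have x: "x \<in> space M" "\<bar>h x - \<rho>\<bar> < v / 3" unfolding v(3) by auto
      then have "u + real i * v < h x" "h x < u + (real i * v + v)" using \<rho> by linarith+
      then show "x \<in> J i" unfolding J_def using x(1) by (simp add: distrib_right)
    qed
    then have "prob {x\<in>space M. \<bar>h x - \<rho>\<bar> < w / (3 * real N)} \<le> prob (J i)" by (rule finite_measure_mono[OF _ J])
    then show "prob {x\<in>space M. \<bar>h x - \<rho>\<bar> < w / (3 * real N)} \<le> 1 / real N" using i(2) by simp
  qed
qed

primrec shell_width :: "real \<Rightarrow> nat \<Rightarrow> real" where
  "shell_width w 0 = w"
| "shell_width w (Suc k) = shell_width w k / (3 * real (Suc k))"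

lemma shell_width_pos: "0 < w \<Longrightarrow> 0 < shell_width w k"
  by (induction k) auto

text \<open>Nested intervals of radii. The widths of the shells do not depend on the measure.\<close>

lemma (in prob_space) radius_with_thin_shells:
  fixes h :: "'a \<Rightarrow> real"
  assumes h: "h \<in> borel_measurable M" and w: "0 < w"
  shows "\<exists>\<rho>\<in>{a..a + w}. \<forall>k. prob {x\<in>space M. \<bar>h x - \<rho>\<bar> < shell_width w (Suc k)} \<le> 1 / real (Suc k)"
proof -
  let ?w = "shell_width w"
  define good where "good k u u' \<longleftrightarrow> u \<le> u' \<and> u' + ?w (Suc k) \<le> u + ?w k \<and>
     (\<forall>\<rho>\<in>{u'..u' + ?w (Suc k)}. prob {x\<in>space M. \<bar>h x - \<rho>\<bar> < ?w (Suc k)} \<le> 1 / real (Suc k))" for k u u'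
  have "\<exists>u'. good k u u'" for k u
    unfolding good_def using thin_interval[OF h zero_less_Suc shell_width_pos[OF w], where u = u] by simp
  then obtain s where "\<And>k u. good k u (s k u)" by metis
  then have s: "\<And>k u. s k u \<ge> u" "\<And>k u. s k u + ?w (Suc k) \<le> u + ?w k"
     "\<And>k u \<rho>. \<rho> \<in> {s k u..s k u + ?w (Suc k)} \<Longrightarrow> prob {x\<in>space M. \<bar>h x - \<rho>\<bar> < ?w (Suc k)} \<le> 1 / real (Suc k)"
    unfolding good_def by (simp_all del: shell_width.simps)
  define u where "u = rec_nat a s"
  have u: "u 0 = a" "\<And>k. u (Suc k) = s k (u k)" unfolding u_def by simp_all
  have up: "u k \<le> u l" if "k \<le> l" for k l
    by (rule lift_Suc_mono_le[OF _ that]) (simp add: u(2) s(1))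
  have down: "u l + ?w l \<le> u k + ?w k" if "k \<le> l" for k l
    using lift_Suc_antimono_le[of "\<lambda>k. u k + ?w k" k l] that s(2) by (simp add: u(2) del: shell_width.simps)
  have below: "u l \<le> u k + ?w k" for k l
    using up[of l "max k l"] down[of k "max k l"] shell_width_pos[OF w, of "max k l"] by simp
  define \<rho> where "\<rho> = (SUP k. u k)"
  have bdd: "bdd_above (range u)" using below[of _ 0] by (intro bdd_aboveI[of _ "u 0 + ?w 0"]) blast
  have mem: "\<rho> \<in> {u k..u k + ?w k}" for k
    unfolding \<rho>_def using below[of _ k] by (auto intro: cSUP_upper[OF _ bdd] cSUP_least)
  show ?thesis
  proof (intro bexI[of _ \<rho>] allI)
    show "prob {x\<in>space M. \<bar>h x - \<rho>\<bar> < ?w (Suc k)} \<le> 1 / real (Suc k)" for k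
      by (rule s(3)[of _ k "u k"]) (use mem[of "Suc k"] in \<open>simp only: u(2)\<close>)
    show "\<rho> \<in> {a..a + w}" using mem[of 0] by (simp add: u(1))
  qed
qed

text \<open>The cells are the atoms of finitely many small balls, whose radii depend on the time and are such
  that thin shells around the boundaries have small mass. Outside of the shells, different cells are
  separated.\<close>

lemma (in compact_distance) small_partitions_in_class_EM:
  assumes \<mu>: "\<And>n. prob_space (\<mu> n)" "\<And>n. sets (\<mu> n) = sets borel" and r: "0 < r"
  shows "\<exists>P\<in>class_EM d \<mu>. \<forall>n. \<forall>Q\<in>P n. \<forall>x\<in>Q. \<forall>y\<in>Q. d x y < r"
proof -
  obtain E where E: "finite E" "\<And>x. \<exists>e\<in>E. d e x < r/8" using finite_net[of "r/8"] r by auto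
  have dm: "d e \<in> borel_measurable borel" for e by (rule borel_measurable_continuous_onI[OF continuous_on_d])
  have dm': "d e \<in> borel_measurable (\<mu> n)" for e n
    using dm[of e] measurable_cong_sets[OF \<mu>(2)[of n] refl] by blast
  have sp: "space (\<mu> n) = UNIV" for n using sets_eq_imp_space_eq[OF \<mu>(2)[of n]] by simp
  let ?w = "shell_width (r/8)"
  have "\<exists>\<rho>. r/8 \<le> \<rho> \<and> \<rho> \<le> r/4 \<and> (\<forall>k. measure (\<mu> n) {x. \<bar>d e x - \<rho>\<bar> < ?w (Suc k)} \<le> 1 / real (Suc k))" for n e
    using prob_space.radius_with_thin_shells[OF \<mu>(1)[of n] dm'[of e n], where w = "r/8" and a = "r/8"] r
    unfolding sp by (auto simp del: shell_width.simps)
  then obtain \<rho> where \<rho>: "\<And>n e. r/8 \<le> \<rho> n e" "\<And>n e. \<rho> n e \<le> r/4"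
    "\<And>n e k. measure (\<mu> n) {x. \<bar>d e x - \<rho> n e\<bar> < ?w (Suc k)} \<le> 1 / real (Suc k)" by metis
  define code where "code n x = {e\<in>E. d e x < \<rho> n e}" for n x
  define P where "P n = (\<lambda>L. {x. code n x = L}) ` Pow E - {{}}" for n
  have atom: "{x. code n x = L} = (\<Inter>e\<in>E. {x. d e x < \<rho> n e \<longleftrightarrow> e \<in> L})" if "L \<subseteq> E" for n L
    using that unfolding code_def by auto
  have memP: "Q \<in> P n \<longleftrightarrow> (\<exists>x. Q = {y. code n y = code n x})" for Q n
  proof
    assume "Q \<in> P n"
    then obtain L where L: "Q = {y. code n y = L}" "Q \<noteq> {}" unfolding P_def by blast
    then obtain x where "code n x = L" by blast
    then show "\<exists>x. Q = {y. code n y = code n x}" using L(1) by blast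
  next
    assume "\<exists>x. Q = {y. code n y = code n x}"
    then obtain x where x: "Q = {y. code n y = code n x}" by blast
    moreover have "code n x \<in> Pow E" unfolding code_def by blast
    moreover have "x \<in> Q" unfolding x by simp
    ultimately show "Q \<in> P n" unfolding P_def by blast
  qed
  have codeE: "code n x \<subseteq> E" for n x unfolding code_def by blast
  have borel: "P n \<subseteq> sets borel" for n
  proof
    fix Q assume "Q \<in> P n"
    then obtain x where "Q = {y. code n y = code n x}" using memP by blast
    then have Q: "Q = (\<Inter>e\<in>E. {y. d e y < \<rho> n e \<longleftrightarrow> e \<in> code n x})" using atom[OF codeE] by simp
    have "{y. d e y < \<rho> n e \<longleftrightarrow> e \<in> L} \<in> sets borel" for e L
      by (cases "e \<in> L") (use borel_measurable_less[OF dm borel_measurable_const, of e "\<rho> n e"]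
          borel_measurable_le[OF borel_measurable_const dm, of "\<rho> n e" e] in \<open>simp_all add: not_less\<close>)
    moreover have "E \<noteq> {}" using E(2) by blast
    ultimately show "Q \<in> sets borel" unfolding Q using E(1) by (intro sets.finite_INT) auto
  qed
  have fin: "finite (P n)" "card (P n) \<le> 2 ^ card E" for n
  proof -
    have f: "finite ((\<lambda>L. {x. code n x = L}) ` Pow E)" using E(1) by simp
    then show "finite (P n)" unfolding P_def by simp
    have "card (P n) \<le> card ((\<lambda>L. {x. code n x = L}) ` Pow E)" unfolding P_def using f by (intro card_mono) auto
    also have "\<dots> \<le> card (Pow E)" using E(1) by (intro card_image_le) simp
    finally show "card (P n) \<le> 2 ^ card E" using E(1) by (simp add: card_Pow)
  qed
  have part: "finite_borel_partition (P n)" for n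
    unfolding finite_borel_partition_def partition_on_def disjoint_def
  proof (intro conjI fin(1) borel)
    show "\<Union>(P n) = UNIV"
    proof -
      have "x \<in> {y. code n y = code n x} \<and> {y. code n y = code n x} \<in> P n" for x using memP by blast
      then show ?thesis by blast
    qed
    show "{} \<notin> P n" unfolding P_def by blast
    show "\<forall>Q\<in>P n. \<forall>Q'\<in>P n. Q \<noteq> Q' \<longrightarrow> Q \<inter> Q' = {}"
    proof (intro ballI impI)
      fix Q Q' assume "Q \<in> P n" "Q' \<in> P n" "Q \<noteq> Q'"
      then show "Q \<inter> Q' = {}" unfolding memP by fastforce
    qed
  qed
  have small: "d x y < r" if Q: "Q \<in> P n" and x: "x \<in> Q" and y: "y \<in> Q" for n Q x y
  proof -
    obtain z where "Q = {y. code n y = code n z}" using Q memP by blast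
    then have xy: "code n x = code n y" using x y by simp
    obtain e where e: "e \<in> E" "d e x < r/8" using E(2) by blast
    then have "e \<in> code n x" unfolding code_def using \<rho>(1)[of n e] by simp
    moreover from this have "e \<in> code n y" using xy by simp
    ultimately have "d e x < \<rho> n e" "d e y < \<rho> n e" unfolding code_def by simp_all
    then have "d e x < r/4" "d e y < r/4" using \<rho>(2)[of n e] by linarith+
    then show ?thesis using d_triangle[of x y e] d_sym[of x e] r by simp
  qed
  have "P \<in> class_EM d \<mu>"
    unfolding class_EM_def
  proof (intro CollectI conjI allI impI)
    show "finite_borel_partition (P n)" for n by (rule part)
    show "\<exists>N. \<forall>n. card (P n) \<le> N" using fin(2) by blast
    fix \<epsilon> :: real assume \<epsilon>: "0 < \<epsilon>"
    obtain k where k: "real (card E) / \<epsilon> < real (Suc k)"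
    proof -
      obtain k where "real (card E) / \<epsilon> < real k" using reals_Archimedean2 by blast
      then have "real (card E) / \<epsilon> < real (Suc k)" by simp
      then show ?thesis by (rule that)
    qed
    define \<delta> where "\<delta> = ?w (Suc k)"
    have \<delta>: "\<delta> > 0" unfolding \<delta>_def using shell_width_pos r by (simp del: shell_width.simps)
    define K where "K n Q = Q \<inter> {x. \<forall>e\<in>E. \<delta> \<le> \<bar>d e x - \<rho> n e\<bar>}" for n Q
    have comp: "compact (K n Q)" if Q: "Q \<in> P n" for n Q
    proof -
      obtain x where "Q = {y. code n y = code n x}" using Q memP by blast
      then have Q: "Q = (\<Inter>e\<in>E. {y. d e y < \<rho> n e \<longleftrightarrow> e \<in> code n x})" using atom[OF codeE] by simp
      have Keq: "K n Q = (\<Inter>e\<in>E. if e \<in> code n x then {y. d e y \<le> \<rho> n e - \<delta>} else {y. \<rho> n e + \<delta> \<le> d e y})"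
      proof (intro equalityI subsetI)
        fix y assume "y \<in> K n Q"
        then show "y \<in> (\<Inter>e\<in>E. if e \<in> code n x then {y. d e y \<le> \<rho> n e - \<delta>} else {y. \<rho> n e + \<delta> \<le> d e y})"
        proof (intro INT_I)
          fix e assume e: "e \<in> E"
          have "d e y < \<rho> n e \<longleftrightarrow> e \<in> code n x" "\<delta> \<le> \<bar>d e y - \<rho> n e\<bar>"
            using \<open>y \<in> K n Q\<close> e unfolding K_def Q by blast+
          then show "y \<in> (if e \<in> code n x then {y. d e y \<le> \<rho> n e - \<delta>} else {y. \<rho> n e + \<delta> \<le> d e y})"
            by (cases "e \<in> code n x") auto
        qed
      next
        fix y assume y: "y \<in> (\<Inter>e\<in>E. if e \<in> code n x then {y. d e y \<le> \<rho> n e - \<delta>} else {y. \<rho> n e + \<delta> \<le> d e y})"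
        have "(d e y < \<rho> n e \<longleftrightarrow> e \<in> code n x) \<and> \<delta> \<le> \<bar>d e y - \<rho> n e\<bar>" if "e \<in> E" for e
        proof -
          have "y \<in> (if e \<in> code n x then {y. d e y \<le> \<rho> n e - \<delta>} else {y. \<rho> n e + \<delta> \<le> d e y})" using y that by blast
          then show ?thesis using \<delta> by (cases "e \<in> code n x") auto
        qed
        then show "y \<in> K n Q" unfolding K_def Q by blast
      qed
      have cl: "closed (if e \<in> L then {y. d e y \<le> \<rho> n e - \<delta>} else {y. \<rho> n e + \<delta> \<le> d e y})" for e L
        using continuous_on_d by (auto intro!: closed_Collect_le continuous_on_const)
      have "closed (K n Q)" unfolding Keq by (rule closed_INT, rule ballI, rule cl)
      then show ?thesis using closed_Int_compact[OF _ compact_space, of "K n Q"] by simp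
    qed
    have meas: "measure (\<mu> n) (Q - K n Q) \<le> \<epsilon>" for n Q
    proof -
      interpret prob_space "\<mu> n" by (rule \<mu>(1))
      have ev: "{x. \<bar>d e x - \<rho> n e\<bar> < \<delta>} \<in> events" for e
      proof -
        have "{x\<in>space (\<mu> n). \<bar>d e x - \<rho> n e\<bar> < \<delta>} \<in> events" using dm'[of e n] by measurable
        then show ?thesis unfolding sp by simp
      qed
      have "measure (\<mu> n) (Q - K n Q) \<le> prob (\<Union>e\<in>E. {x. \<bar>d e x - \<rho> n e\<bar> < \<delta>})"
        by (rule finite_measure_mono) (use ev E(1) in \<open>auto simp: K_def not_le\<close>)
      also have "\<dots> \<le> (\<Sum>e\<in>E. prob {x. \<bar>d e x - \<rho> n e\<bar> < \<delta>})"
        by (rule finite_measure_subadditive_finite[OF E(1)]) (use ev in auto)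
      also have "\<dots> \<le> (\<Sum>e\<in>E. 1 / real (Suc k))" by (rule sum_mono) (unfold \<delta>_def, rule \<rho>(3))
      also have "\<dots> = real (card E) / real (Suc k)" by simp
      also have "\<dots> \<le> \<epsilon>" using k \<epsilon> by (simp add: field_simps)
      finally show ?thesis .
    qed
    have sep: "\<delta> \<le> d x y" if Q: "Q \<in> P n" "R \<in> P n" "Q \<noteq> R" and x: "x \<in> K n Q" and y: "y \<in> K n R" for n Q R x y
    proof -
      obtain x' y' where "Q = {z. code n z = code n x'}" "R = {z. code n z = code n y'}" using Q memP by metis
      then have "code n x \<noteq> code n y" using Q(3) x y unfolding K_def by auto
      then obtain e where e: "e \<in> E" "(d e x < \<rho> n e) \<noteq> (d e y < \<rho> n e)" unfolding code_def by blast
      then have "\<delta> \<le> \<bar>d e x - \<rho> n e\<bar>" "\<delta> \<le> \<bar>d e y - \<rho> n e\<bar>" using x y unfolding K_def by auto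
      then have "\<delta> \<le> \<bar>d e x - d e y\<bar>" using e(2) \<delta> by linarith
      also have "\<dots> \<le> d x y" using d_triangle[of e x y] d_triangle[of e y x] d_sym[of x y] by linarith
      finally show ?thesis .
    qed
    show "\<exists>\<delta>>0. \<exists>K. \<forall>n. (\<forall>Q\<in>P n. compact (K n Q) \<and> K n Q \<subseteq> Q \<and> measure (\<mu> n) (Q - K n Q) \<le> \<epsilon>) \<and>
        (\<forall>Q\<in>P n. \<forall>R\<in>P n. Q \<noteq> R \<longrightarrow> (\<forall>x\<in>K n Q. \<forall>y\<in>K n R. d x y \<ge> \<delta>))"
    proof (intro exI[of _ \<delta>] exI[of _ K] conjI allI ballI impI \<delta> comp meas sep)
      show "K n Q \<subseteq> Q" for n Q unfolding K_def by blast
    qed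
  qed
  then show ?thesis using small by blast
qed

section \<open>The variational principle for uniformly expanding sequences\<close>

lemma (in expanding_sequence) degree_growth_le_metric_entropy:
  "degree_growth \<le> metric_entropy_EM d f tree_sequence"
proof -
  have ims: "prob_space (tree_sequence n)" "sets (tree_sequence n) = sets borel" for n
    using invariant_tree_sequence unfolding invariant_measure_seq_def by auto
  have "0 < inj_radius / 2" using inj_radius(1) by simp
  from small_partitions_in_class_EM[where \<mu> = tree_sequence, OF ims this]
  obtain P where P: "P \<in> class_EM d tree_sequence"
    and small: "\<forall>n. \<forall>Q\<in>P n. \<forall>x\<in>Q. \<forall>y\<in>Q. d x y < inj_radius / 2" by (rule bexE)
  have fbp: "\<And>n. finite_borel_partition (P n)" using CollectD[OF P[unfolded class_EM_def]] by (elim conjE) metis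
  have "log_degrees n \<le> shannon_entropy (tree_sequence 0) (pullback_join f P n)" for n
  proof -
    interpret prob_space "tree_sequence 0" by (rule ims(1))
    note J = pullback_join_partition[where P = P and f = f and n = n, OF fbp continuous_f]
    have le: "prob C \<le> 1 / real (\<Prod>i<n. deg i)" if C: "C \<in> pullback_join f P n" for C
    proof -
      obtain s where s: "C = (\<Inter>i<n. iterate f 0 i -` s i)" "\<forall>i<n. s i \<in> P i"
        using C unfolding pullback_join_def by blast
      have "measure tree_measure C \<le> 1 / real (\<Prod>i<n. deg i)"
      proof (rule tree_measure_le)
        show "C \<in> sets borel" using J(3) C by blast
        fix x x' i assume "x \<in> C" "x' \<in> C" "i < n"
        then show "d (iterate f 0 i x) (iterate f 0 i x') < inj_radius / 2"
          using s by (intro small[rule_format, of "s i" i]) auto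
      qed
      then show ?thesis by (simp only: tree_sequence_0)
    qed
    have "prob (\<Union>C\<in>pullback_join f P n. C) = (\<Sum>C\<in>pullback_join f P n. prob C)"
    proof (rule finite_measure_finite_Union[OF J(1)])
      show "(\<lambda>C. C) ` pullback_join f P n \<subseteq> events" using J(3) ims(2) by simp
      show "disjoint_family_on (\<lambda>C. C) (pullback_join f P n)" unfolding disjoint_family_on_def using J(4) by blast
    qed
    moreover have "(\<Union>C\<in>pullback_join f P n. C) = space (tree_sequence 0)"
      using J(2) sets_eq_imp_space_eq[OF ims(2)[of 0]] by simp
    ultimately have sum: "(\<Sum>C\<in>pullback_join f P n. prob C) = 1" using prob_space by metis
    have "log_degrees n = (\<Sum>C\<in>pullback_join f P n. prob C * log_degrees n)"
      using sum by (simp flip: sum_distrib_right)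
    also have "\<dots> \<le> (\<Sum>C\<in>pullback_join f P n. - (prob C * ln (prob C)))"
    proof (rule sum_mono)
      fix C assume C: "C \<in> pullback_join f P n"
      show "prob C * log_degrees n \<le> - (prob C * ln (prob C))"
      proof (cases "prob C = 0")
        case False
        then have pos: "0 < prob C" by (simp add: zero_less_measure_iff)
        have "ln (prob C) \<le> ln (1 / real (\<Prod>i<n. deg i))"
          using le[OF C] pos by (simp only: ln_le_cancel_iff less_le_trans)
        also have "\<dots> = - log_degrees n"
          unfolding ln_prod_deg[symmetric] using deg_pos by (simp add: ln_div prod_pos)
        finally have "prob C * log_degrees n \<le> prob C * (- ln (prob C))" using pos by (intro mult_left_mono) auto
        then show ?thesis by simp
      qed simp
    qed
    finally show ?thesis unfolding shannon_entropy_def by (simp add: sum_negf)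
  qed
  then have "degree_growth \<le> partition_entropy f P tree_sequence"
    unfolding degree_growth_def partition_entropy_def
    by (intro Limsup_mono always_eventually allI) (simp add: divide_right_mono)
  also have "\<dots> \<le> metric_entropy_EM d f tree_sequence"
    unfolding metric_entropy_EM_def using P by (rule SUP_upper)
  finally show ?thesis .
qed

theorem (in expanding_sequence) variational_principle:
  "(SUP \<mu>\<in>{\<mu>. invariant_measure_seq f \<mu>}. metric_entropy_EM d f \<mu>) = topological_entropy d f"
proof (rule antisym)
  show "(SUP \<mu>\<in>{\<mu>. invariant_measure_seq f \<mu>}. metric_entropy_EM d f \<mu>) \<le> topological_entropy d f"
    unfolding metric_entropy_EM_def
    by (intro SUP_least) (auto intro: partition_entropy_le_topological_entropy[OF continuous_f])
  have "topological_entropy d f \<le> degree_growth" by (rule topological_entropy_le_degree_growth)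
  also have "\<dots> \<le> metric_entropy_EM d f tree_sequence" by (rule degree_growth_le_metric_entropy)
  also have "\<dots> \<le> (SUP \<mu>\<in>{\<mu>. invariant_measure_seq f \<mu>}. metric_entropy_EM d f \<mu>)"
    by (rule SUP_upper) (simp add: invariant_tree_sequence)
  finally show "topological_entropy d f \<le> (SUP \<mu>\<in>{\<mu>. invariant_measure_seq f \<mu>}. metric_entropy_EM d f \<mu>)" .
qed

section \<open>Expanding maps of a compact Riemannian manifold\<close>

text \<open>The infimum of curve lengths need not be attained, and coordinates distort distances, so that
  distances expand locally by every factor below \<open>lam\<close>. The mean of 1 and \<open>lam\<close> is one that exceeds 1.\<close>

theorem corollary6p3:
  fixes A :: "('a::{t2_space,second_countable_topology}, 'e::real_inner) chart set"
    and g :: "('a, 'e) metric_tensor"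
    and f :: "nat \<Rightarrow> 'a \<Rightarrow> 'a"
    and lam :: real
    and x0 :: 'a
    and \<phi> :: "(real \<Rightarrow> 'a) set \<Rightarrow> (real \<Rightarrow> 'a) set"
    and \<beta> :: "nat \<Rightarrow> real \<Rightarrow> 'a"
  assumes "riemannian_manifold A g"
    and "compact (UNIV :: 'a set)"
    and "connected (UNIV :: 'a set)"
    and "uniformly_equicontinuous (riemannian_dist A g) f"
    and "\<And>n. C1_map A (f n)"
    and "lam > 1"
    and "\<And>n x v. v \<in> tangent_space A x \<Longrightarrow>
           tnorm g (f n x) (tangent_map A (f n) x v) \<ge> lam * tnorm g x v"
    and "\<phi> \<in> hom (fundamental_group x0) (fundamental_group x0)"
    and "\<And>n. path (\<beta> n) \<and> pathstart (\<beta> n) = f n x0 \<and> pathfinish (\<beta> n) = x0"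
    and "\<And>n a. a \<in> carrier (fundamental_group x0) \<Longrightarrow> induced_endo (f n) (\<beta> n) a = \<phi> a"
  shows "(SUP \<mu>\<in>{\<mu>. invariant_measure_seq f \<mu>}. metric_entropy_EM (riemannian_dist A g) f \<mu>)
         = topological_entropy (riemannian_dist A g) f"
proof -
  interpret R: connected_riemannian A g
    using assms(1,3) by unfold_locales
  interpret E: expanding_sequence "riemannian_dist A g" f "(1 + lam) / 2"
  proof
    fix x y s n and \<eta> :: real
    show "compact (UNIV :: 'a set)" by fact
    show "1 < (1 + lam) / 2" using assms(6) by simp
    show "uniformly_equicontinuous (riemannian_dist A g) f" by fact
    show "\<exists>m ys. ys 0 = x \<and> ys m = y \<and> (\<forall>j<m. riemannian_dist A g (ys j) (ys (Suc j)) < \<eta>) \<and>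
        (\<Sum>j<m. riemannian_dist A g (ys j) (ys (Suc j))) < s"
      if "riemannian_dist A g x y < s" "0 < \<eta>"
      using that by (rule R.dist_chain)
    show "\<exists>\<rho>>0. \<forall>x1. riemannian_dist A g x x1 < \<rho> \<longrightarrow>
        (\<forall>y. riemannian_dist A g (f n x1) y < \<rho> \<longrightarrow>
          (\<exists>x'. f n x' = y \<and> (1 + lam) / 2 * riemannian_dist A g x1 x' \<le> riemannian_dist A g (f n x1) y)) \<and>
        (\<forall>x2. riemannian_dist A g x x2 < \<rho> \<longrightarrow> f n x1 = f n x2 \<longrightarrow> x1 = x2)"
      by (rule R.expanding_local_inverse[OF assms(5,7)]) (use assms(6) in simp_all)
    show "\<exists>\<rho>>0. \<forall>z. riemannian_dist A g x z < \<rho> \<longrightarrow>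
        (\<exists>h C. ball_contraction (riemannian_dist A g) x \<rho> z h C)"
      by (rule R.local_contraction)
  qed
  show ?thesis by (rule E.variational_principle)
qed

end
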